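(* Let $\Lambda\subset J^1M$ be a closed Legendrian submanifold of dimension $n=\dim M$ with mild front singularities, equipped with a $\mathbb{Z}$-valued Maslov potential $\mu$ and a compatible simplicial decomposition $\mathcal{E}$ of $M$. Let $\mathcal{A}$ be the graded free unital associative $\mathbb{Z}$-algebra with generators $m^I_{i,j}$, and let $M(e_I)$, $M_I(e_J)$, $\Theta_I$ be the matrices, described in the context. Then: (1) There is a unique degree $-1$ derivation $\partial:\mathcal{A}\to\mathcal{A}$ (a linear map satisfying $\partial(xy)=\partial(x)y+(-1)^{|x|}x\,\partial(y)$) such that, for every simplex $e_I\in\mathcal{E}$ with $I=(i_0,\dots,i_m)$, applying $\partial$ entry by entry, $$\partial M(e_I)=\Theta_I\cdot\Big(-\sum_{k=0}^m(-1)^kM_I(e_{i_0\cdots\widehat{i_k}\cdots i_m})+\sum_{k=0}^m(-1)^kM_I(e_{i_0\cdots i_k})\cdot M_I(e_{i_k\cdots i_m})\Big),$$ where for $m=0$ the first sum is absent. (2) $\partial^2=0$.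
   Context: $J^1M=T^*M\times\mathbb{R}$ has local coordinates $(x,y,z)$; $\pi_{xz}:J^1M\to M\times\mathbb{R}$ and $\pi_x:J^1M\to M$ are the front and base projections. $\Lambda$ has mild front singularities if $\pi_{xz}|_\Lambda$ is an immersion outside a codimension 1 submanifold $\Lambda_{\mathit{cusp}}\subset\Lambda$ along which it has a standard cusp singularity (locally, in suitable coordinates, $(t_1,\dots,t_n)\mapsto(t_1^3,t_1^2,t_2,\dots,t_n)$ with $\Lambda_{\mathit{cusp}}=\{t_1=0\}$). A Maslov potential is a locally constant $\mu:\Lambda\setminus\Lambda_{\mathit{cusp}}\to\mathbb{Z}$ increasing by 1 when passing through $\Lambda_{\mathit{cusp}}$ from the lower to the upper sheet of the cusp edge. $\mathcal{E}=\{e_I\}$ is a simplicial decomposition of $M$ with totally ordered vertices $e_0,e_1,\dots$; cells $e_I$ are open simplices and $I=(i_0<\dots<i_m)$ lists the vertices of $\overline{e_I}$. Compatibility of $\mathcal{E}$ with $\Lambda$ means: (P1) for each $e_I$, $\Lambda\cap\pi_x^{-1}(e_I)$ is a union of components each projected homeomorphically to $e_I$ and each contained either in $\Lambda\setminus\Lambda_{\mathit{cusp}}$ (a sheet above $e_I$; the set of sheets is $\Lambda(e_I)$) or in $\Lambda_{\mathit{cusp}}$ (a cusp component above $e_I$). The front projection of a sheet $S$ is the graph of a function $z(S):e_I\to\mathbb{R}$. (P2) For $S,S'\in\Lambda(e_I)$ one has $z(S)>z(S')$ on all of $e_I$, or $z(S)<z(S')$ on all of $e_I$, or $z(S)=z(S')$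 on all of $e_I$. (P3) If $e_J\subset\overline{e_I}$, each sheet in $\Lambda(e_J)$ belongs to the closure (in $\Lambda$) of a unique sheet in $\Lambda(e_I)$, and the remaining sheets of $\Lambda(e_I)$ meet in pairs at cusp components above $e_J$. (When $n=2$, compatibility is defined by requiring the codimension-$k$ part of the base projection of the singular set, for $\Lambda$ self-transverse in the front and base projections, to lie in the $(2-k)$-skeleton; this implies (P1)–(P3).) For each $e_I$ fix an ordering $S_1,\dots,S_{N_I}$ of $\Lambda(e_I)$ with $z(S_{i-1})\ge z(S_i)$. $\mathcal{A}$ has one generator $m^I_{i,j}$ for each $I,i,j$ with $S_i,S_j\in\Lambda(e_I)$ and $z(S_i)>z(S_j)$, graded by $|m^I_{i,j}|=\mu(S_i)-\mu(S_j)+\dim e_I-1$. $M(e_I)$ is the strictly upper triangular $N_I\times N_I$ matrix with entries $m^I_{i,j}$ where these exist and $0$ elsewhere. For $e_J\subset\overline{e_I}$, $M_I(e_J)$ is the $N_I\times N_I$ matrix having $m^J_{i,j}$ in position $(i',j')$ where $S^J_i\subset\overline{S^I_{i'}}$ and $S^J_j\subset\overline{S^I_{j'}}$; in addition, if $e_J$ is a $0$-cell, having a $1$ in position $(k,l)$ for each pair $S^I_k,S^I_l$, $k<l$, meeting one another at a cusp above $e_J$; all other entries are $0$. In particular $M_I(e_I)=M(e_I)$. $\Theta_I=\mathrm{diag}((-1)^{\mu(S_1)},\dots,(-1)^{\mu(S_{N_I})})$. *)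

theory Defs
  imports
    "HOL-Analysis.Analysis"
    "HOL-Library.Poly_Mapping"
    "HOL-Library.FuncSet"
    Jordan_Normal_Form.Matrix
begin

section \<open>Smooth manifolds\<close>

primrec Ck_on :: "nat \<Rightarrow> 'a::real_normed_vector set \<Rightarrow> ('a \<Rightarrow> 'b::real_normed_vector) \<Rightarrow> bool" where
  "Ck_on 0 = (\<lambda>S f. continuous_on S f)"
| "Ck_on (Suc k) = (\<lambda>S f. (\<forall>x\<in>S. f differentiable (at x)) \<and>
      (\<forall>v. Ck_on k S (\<lambda>x. frechet_derivative f (at x) v)))"

text \<open>\<open>C\<^sup>\<infinity>\<close> maps; only used for open subsets \<open>S\<close> of Euclidean spaces.\<close>

definition smooth_on :: "'a::real_normed_vector set \<Rightarrow> ('a \<Rightarrow> 'b::real_normed_vector) \<Rightarrow> bool" where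
  "smooth_on S f \<longleftrightarrow> (\<forall>k. Ck_on k S f)"

text \<open>A chart is a pair (domain, coordinate map); only the values of the coordinate map on the
  domain matter. The dimension of a manifold is that of the model space \<open>'e\<close>.\<close>

type_synonym ('a, 'e) chart = "'a set \<times> ('a \<Rightarrow> 'e)"

definition transition :: "('a, 'e) chart \<Rightarrow> ('a, 'e) chart \<Rightarrow> 'e \<Rightarrow> 'e" where
  "transition c c' = snd c' \<circ> inv_into (fst c) (snd c)"

definition is_chart :: "'a topology \<Rightarrow> ('a, 'e::euclidean_space) chart \<Rightarrow> bool" where
  "is_chart X c \<longleftrightarrow> openin X (fst c) \<and> open (snd c ` fst c) \<and>
     homeomorphic_map (subtopology X (fst c)) (top_of_set (snd c ` fst c)) (snd c)"

definition smoothly_related :: "('a, 'e::euclidean_space) chart \<Rightarrow> ('a, 'e) chart \<Rightarrow> bool" where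
  "smoothly_related c c' \<longleftrightarrow>
     smooth_on (snd c ` (fst c \<inter> fst c')) (transition c c') \<and>
     smooth_on (snd c' ` (fst c \<inter> fst c')) (transition c' c)"

definition smooth_manifold :: "'a topology \<Rightarrow> ('a, 'e::euclidean_space) chart set \<Rightarrow> bool" where
  "smooth_manifold X A \<longleftrightarrow>
     Hausdorff_space X \<and> second_countable X \<and>
     (\<forall>c\<in>A. is_chart X c) \<and> (\<Union>c\<in>A. fst c) = topspace X \<and>
     (\<forall>c\<in>A. \<forall>c'\<in>A. smoothly_related c c')"

text \<open>\<open>g\<close> parametrizes an open piece of the subset \<open>L\<close> of the manifold \<open>(Y, B)\<close>, as a smooth
  immersion of an open subset \<open>W\<close> of \<open>'e\<close> that is a homeomorphism onto its image.\<close>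

definition immersive_at :: "('p, 'f::euclidean_space) chart set \<Rightarrow> ('e::euclidean_space \<Rightarrow> 'p) \<Rightarrow> 'e \<Rightarrow> bool" where
  "immersive_at B g t \<longleftrightarrow>
     (\<forall>c\<in>B. g t \<in> fst c \<longrightarrow> inj (frechet_derivative (snd c \<circ> g) (at t)))"

definition local_param ::
  "'p topology \<Rightarrow> ('p, 'f::euclidean_space) chart set \<Rightarrow> 'p set \<Rightarrow> 'e::euclidean_space set \<Rightarrow> ('e \<Rightarrow> 'p) \<Rightarrow> bool"
where
  "local_param Y B L W g \<longleftrightarrow>
     open W \<and> openin (subtopology Y L) (g ` W) \<and>
     homeomorphic_map (top_of_set W) (subtopology Y (g ` W)) g \<and>
     (\<forall>c\<in>B. smooth_on (W \<inter> g -` fst c) (snd c \<circ> g)) \<and>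
     (\<forall>t\<in>W. immersive_at B g t)"

section \<open>The 1-jet space\<close>

text \<open>A covector at \<open>p\<close> is given by its components in every chart of the atlas around \<open>p\<close>, subject to
  the usual transformation law; the components in chart \<open>c\<close> are packed in a vector \<open>y\<close> of \<open>'e\<close>,
  the covector being \<open>v \<mapsto> inner y v\<close> in these coordinates. At all other arguments the family is 0.\<close>

definition covector ::
  "('a, 'e::euclidean_space) chart set \<Rightarrow> 'a \<Rightarrow> (('a, 'e) chart \<Rightarrow> 'e) \<Rightarrow> bool" where
  "covector A p \<xi> \<longleftrightarrow>
     (\<forall>c. c \<notin> A \<or> p \<notin> fst c \<longrightarrow> \<xi> c = 0) \<and>
     (\<forall>c\<in>A. \<forall>c'\<in>A. p \<in> fst c \<inter> fst c' \<longrightarrow>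
        (\<forall>v. inner (\<xi> c) v = inner (\<xi> c') (frechet_derivative (transition c c') (at (snd c p)) v)))"

type_synonym ('a, 'e) jet = "'a \<times> (('a, 'e) chart \<Rightarrow> 'e) \<times> real"

definition J1 :: "('a, 'e::euclidean_space) chart set \<Rightarrow> ('a, 'e) jet set" where
  "J1 A = {(p, \<xi>, z). p \<in> (\<Union>c\<in>A. fst c) \<and> covector A p \<xi>}"

definition base :: "('a, 'e) jet \<Rightarrow> 'a" where
  "base q = fst q"

definition zcoord :: "('a, 'e) jet \<Rightarrow> real" where
  "zcoord q = snd (snd q)"

definition front :: "('a, 'e) jet \<Rightarrow> 'a \<times> real" where
  "front q = (base q, zcoord q)"

definition jet_chart ::
  "('a, 'e::euclidean_space) chart set \<Rightarrow> ('a, 'e) chart \<Rightarrow> (('a, 'e) jet, 'e \<times> 'e \<times> real) chart" where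
  "jet_chart A c = ({q \<in> J1 A. base q \<in> fst c}, (\<lambda>(p, \<xi>, z). (snd c p, \<xi> c, z)))"

definition jet_atlas :: "('a, 'e::euclidean_space) chart set \<Rightarrow> (('a, 'e) jet, 'e \<times> 'e \<times> real) chart set" where
  "jet_atlas A = jet_chart A ` A"

definition jet_topology :: "('a, 'e::euclidean_space) chart set \<Rightarrow> ('a, 'e) jet topology" where
  "jet_topology A = topology_generated_by
     {fst (jet_chart A c) \<inter> snd (jet_chart A c) -` W | c W. c \<in> A \<and> open W}"

definition front_chart :: "('a, 'e) chart \<Rightarrow> ('a \<times> real, 'e \<times> real) chart" where
  "front_chart c = (fst c \<times> UNIV, (\<lambda>(p, z). (snd c p, z)))"

section \<open>Legendrian submanifolds with mild front singularities\<close>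

text \<open>Closed means compact without boundary. The submanifold has the dimension of \<open>'e\<close>, i.e. of the
  base. The last condition is the vanishing of the contact form \<open>dz - y dx\<close> on tangent vectors.\<close>

definition closed_legendrian :: "('a, 'e::euclidean_space) chart set \<Rightarrow> ('a, 'e) jet set \<Rightarrow> bool" where
  "closed_legendrian A L \<longleftrightarrow>
     compactin (jet_topology A) L \<and>
     (\<forall>q\<in>L. \<exists>(W::'e set) g. local_param (jet_topology A) (jet_atlas A) L W g \<and> q \<in> g ` W) \<and>
     (\<forall>(W::'e set) g. local_param (jet_topology A) (jet_atlas A) L W g \<longrightarrow>
        (\<forall>t\<in>W. \<forall>c\<in>A. base (g t) \<in> fst c \<longrightarrow>
          (\<forall>v. case frechet_derivative (snd (jet_chart A c) \<circ> g) (at t) v of (dx, dy, dz) \<Rightarrow>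
             (case snd (jet_chart A c) (g t) of (x, y, z) \<Rightarrow> dz = inner y dx))))"

text \<open>With \<open>t\<^sub>1 = inner t b\<close> for a basis vector \<open>b\<close>, the map \<open>t \<mapsto> (t + (t\<^sub>1\<^sup>2 - t\<^sub>1) b, t\<^sub>1\<^sup>3)\<close> is
  \<open>(t\<^sub>1, \<dots>, t\<^sub>n) \<mapsto> (t\<^sub>1\<^sup>3, t\<^sub>1\<^sup>2, t\<^sub>2, \<dots>, t\<^sub>n)\<close> with the first coordinate put last. The chart \<open>k\<close> of
  \<open>M \<times> \<real>\<close> is an arbitrary smooth one, not necessarily fibred over a chart of \<open>M\<close>.\<close>

definition standard_cusp ::
  "'a topology \<Rightarrow> ('a, 'e::euclidean_space) chart set \<Rightarrow> ('a, 'e) jet set \<Rightarrow> ('a, 'e) jet set \<Rightarrow> ('a, 'e) jet \<Rightarrow> bool"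
where
  "standard_cusp X A L C q \<longleftrightarrow>
     (\<exists>(W::'e set) g k b.
        local_param (jet_topology A) (jet_atlas A) L W g \<and> q \<in> g ` W \<and>
        is_chart (prod_topology X euclideanreal) k \<and>
        (\<forall>c\<in>A. smoothly_related (front_chart c) k) \<and>
        b \<in> Basis \<and>
        (\<forall>t\<in>W. front (g t) \<in> fst k \<and>
           snd k (front (g t)) = (t + ((inner t b)\<^sup>2 - inner t b) *\<^sub>R b, (inner t b) ^ 3) \<and>
           (g t \<in> C \<longleftrightarrow> inner t b = 0)))"

text \<open>That \<open>C\<close> is a codimension 1 submanifold of \<open>L\<close> is part of \<open>standard_cusp\<close>.\<close>

definition mild_front ::
  "'a topology \<Rightarrow> ('a, 'e::euclidean_space) chart set \<Rightarrow> ('a, 'e) jet set \<Rightarrow> ('a, 'e) jet set \<Rightarrow> bool"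
where
  "mild_front X A L C \<longleftrightarrow>
     C \<subseteq> L \<and>
     (\<forall>(W::'e set) g. local_param (jet_topology A) (jet_atlas A) L W g \<longrightarrow>
        (\<forall>t\<in>W. g t \<notin> C \<longrightarrow> immersive_at (front_chart ` A) (front \<circ> g) t)) \<and>
     (\<forall>q\<in>C. standard_cusp X A L C q)"

definition legendrian_topology :: "('a, 'e::euclidean_space) chart set \<Rightarrow> ('a, 'e) jet set \<Rightarrow> ('a, 'e) jet topology" where
  "legendrian_topology A L = subtopology (jet_topology A) L"

text \<open>In what follows \<open>T\<close> stands for \<open>legendrian_topology A L\<close>. Near a cusp point the base projection
  folds along \<open>C\<close>, so two nearby non-cusp points over the same base point are on the two sides of the
  cusp edge, and the one with the larger \<open>z\<close>-coordinate is on the upper sheet.\<close>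

definition maslov_potential ::
  "('a, 'e) jet topology \<Rightarrow> ('a, 'e) jet set \<Rightarrow> (('a, 'e) jet \<Rightarrow> int) \<Rightarrow> bool" where
  "maslov_potential T C \<mu> \<longleftrightarrow>
     continuous_map (subtopology T (topspace T - C)) (discrete_topology UNIV) \<mu> \<and>
     (\<forall>c\<in>C. \<exists>U. openin T U \<and> c \<in> U \<and>
        (\<forall>q\<in>U - C. \<forall>q'\<in>U - C. base q = base q' \<and> zcoord q > zcoord q' \<longrightarrow> \<mu> q = \<mu> q' + 1))"

section \<open>Simplicial decompositions\<close>

text \<open>Simplices are finite sets of vertex numbers, realized by barycentric coordinates.\<close>

definition closed_simplex :: "nat set \<Rightarrow> (nat \<Rightarrow> real) set" where
  "closed_simplex I = {b. (\<forall>i\<in>I. b i \<ge> 0) \<and> (\<forall>i. i \<notin> I \<longrightarrow> b i = 0) \<and> sum b I = 1}"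

definition open_simplex :: "nat set \<Rightarrow> (nat \<Rightarrow> real) set" where
  "open_simplex I = {b. (\<forall>i\<in>I. b i > 0) \<and> (\<forall>i. i \<notin> I \<longrightarrow> b i = 0) \<and> sum b I = 1}"

definition simplicial_complex_on :: "nat set set \<Rightarrow> bool" where
  "simplicial_complex_on K \<longleftrightarrow>
     (\<forall>I\<in>K. finite I \<and> I \<noteq> {}) \<and> (\<forall>I\<in>K. \<forall>J. J \<subseteq> I \<and> J \<noteq> {} \<longrightarrow> J \<in> K)"

text \<open>The geometric realization with the weak (coherent) topology.\<close>

definition realization :: "nat set set \<Rightarrow> (nat \<Rightarrow> real) topology" where
  "realization K = topology (\<lambda>U. U \<subseteq> (\<Union>I\<in>K. closed_simplex I) \<and>
     (\<forall>I\<in>K. openin (top_of_set (closed_simplex I)) (U \<inter> closed_simplex I)))"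

lemma istopology_realization:
  "istopology (\<lambda>U. U \<subseteq> (\<Union>I\<in>K. closed_simplex I) \<and>
     (\<forall>I\<in>K. openin (top_of_set (closed_simplex I)) (U \<inter> closed_simplex I)))"
proof -
  have 1: "openin (top_of_set (closed_simplex I)) ((S \<inter> T) \<inter> closed_simplex I)"
    if "openin (top_of_set (closed_simplex I)) (S \<inter> closed_simplex I)"
       "openin (top_of_set (closed_simplex I)) (T \<inter> closed_simplex I)" for S T I
    using openin_Int[OF that] by (simp add: Int_ac)
  have 2: "openin (top_of_set (closed_simplex I)) (\<Union>\<K> \<inter> closed_simplex I)"
    if "\<And>U. U \<in> \<K> \<Longrightarrow> openin (top_of_set (closed_simplex I)) (U \<inter> closed_simplex I)" for \<K> I
    unfolding Int_Union2 using that by (intro openin_Union) blast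
  show ?thesis
    unfolding istopology_def using 1 2 by (simp add: le_infI1 Sup_least)
qed

definition simplicial_decomposition :: "'a topology \<Rightarrow> nat set set \<Rightarrow> ((nat \<Rightarrow> real) \<Rightarrow> 'a) \<Rightarrow> bool" where
  "simplicial_decomposition X K h \<longleftrightarrow>
     simplicial_complex_on K \<and> homeomorphic_map (realization K) X h"

definition cell :: "((nat \<Rightarrow> real) \<Rightarrow> 'a) \<Rightarrow> nat set \<Rightarrow> 'a set" where
  "cell h I = h ` open_simplex I"

definition components_above ::
  "('a, 'e) jet topology \<Rightarrow> ((nat \<Rightarrow> real) \<Rightarrow> 'a) \<Rightarrow> nat set \<Rightarrow> ('a, 'e) jet set set" where
  "components_above T h I = connected_components_of (subtopology T {q. base q \<in> cell h I})"

definition sheets ::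
  "('a, 'e) jet topology \<Rightarrow> ('a, 'e) jet set \<Rightarrow> ((nat \<Rightarrow> real) \<Rightarrow> 'a) \<Rightarrow> nat set \<Rightarrow> ('a, 'e) jet set set" where
  "sheets T C h I = {S \<in> components_above T h I. S \<inter> C = {}}"

definition cusp_components ::
  "('a, 'e) jet topology \<Rightarrow> ('a, 'e) jet set \<Rightarrow> ((nat \<Rightarrow> real) \<Rightarrow> 'a) \<Rightarrow> nat set \<Rightarrow> ('a, 'e) jet set set" where
  "cusp_components T C h I = {E \<in> components_above T h I. E \<subseteq> C}"

definition height :: "('a, 'e) jet set \<Rightarrow> 'a \<Rightarrow> real" where
  "height S x = zcoord (THE q. q \<in> S \<and> base q = x)"

definition meet_at_cusp ::
  "('a, 'e) jet topology \<Rightarrow> ('a, 'e) jet set \<Rightarrow> ((nat \<Rightarrow> real) \<Rightarrow> 'a) \<Rightarrow> nat set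
     \<Rightarrow> ('a, 'e) jet set \<Rightarrow> ('a, 'e) jet set \<Rightarrow> bool" where
  "meet_at_cusp T C h J S S' \<longleftrightarrow>
     S \<noteq> S' \<and> (\<exists>E\<in>cusp_components T C h J. E \<subseteq> T closure_of S \<and> E \<subseteq> T closure_of S')"

definition compatible_P1 where
  "compatible_P1 X T C K h \<longleftrightarrow>
     (\<forall>I\<in>K. \<forall>S\<in>components_above T h I.
        homeomorphic_map (subtopology T S) (subtopology X (cell h I)) base \<and>
        (S \<inter> C = {} \<or> S \<subseteq> C))"

definition compatible_P2 where
  "compatible_P2 T C K h \<longleftrightarrow>
     (\<forall>I\<in>K. \<forall>S\<in>sheets T C h I. \<forall>S'\<in>sheets T C h I.
        (\<forall>x\<in>cell h I. height S x > height S' x) \<or>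
        (\<forall>x\<in>cell h I. height S x < height S' x) \<or>
        (\<forall>x\<in>cell h I. height S x = height S' x))"

definition remaining_sheets where
  "remaining_sheets T C h I J =
     {S \<in> sheets T C h I. \<not> (\<exists>R\<in>sheets T C h J. R \<subseteq> T closure_of S)}"

definition compatible_P3 where
  "compatible_P3 X T C K h \<longleftrightarrow>
     (\<forall>I\<in>K. \<forall>J\<in>K. cell h J \<subseteq> X closure_of cell h I \<longrightarrow>
        (\<forall>R\<in>sheets T C h J. \<exists>!S. S \<in> sheets T C h I \<and> R \<subseteq> T closure_of S) \<and>
        (\<forall>S\<in>remaining_sheets T C h I J.
           \<exists>!S'. S' \<in> remaining_sheets T C h I J \<and> meet_at_cusp T C h J S S'))"

definition compatible where
  "compatible X T C K h \<longleftrightarrow>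
     compatible_P1 X T C K h \<and> compatible_P2 T C K h \<and> compatible_P3 X T C K h"

text \<open>\<open>ord I\<close> lists the sheets above \<open>e\<^sub>I\<close> by non-increasing \<open>z\<close>; lists are indexed from 0.\<close>

definition sheet_ordering where
  "sheet_ordering T C K h ord \<longleftrightarrow>
     (\<forall>I\<in>K. distinct (ord I) \<and> set (ord I) = sheets T C h I \<and>
        sorted_wrt (\<lambda>S S'. \<forall>x\<in>cell h I. height S x \<ge> height S' x) (ord I))"

section \<open>Free associative algebras over the integers\<close>

text \<open>The free algebra is the monoid ring of the free monoid of words: \<open>int\<close>-valued finitely
  supported functions on words with the convolution product.\<close>

datatype 'g fword = FWord (letters: "'g list")

instantiation fword :: (type) monoid_add
begin

definition "0 = FWord []"

definition "v + w = FWord (letters v @ letters w)"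

instance
  by standard (auto simp: zero_fword_def plus_fword_def)

end

type_synonym 'g free_alg = "'g fword \<Rightarrow>\<^sub>0 int"

definition letter :: "'g \<Rightarrow> 'g free_alg" where
  "letter g = Poly_Mapping.single (FWord [g]) 1"

definition free_algebra :: "'g set \<Rightarrow> 'g free_alg set" where
  "free_algebra G = {x. \<forall>w\<in>Poly_Mapping.keys x. set (letters w) \<subseteq> G}"

definition homogeneous :: "'g set \<Rightarrow> ('g \<Rightarrow> int) \<Rightarrow> int \<Rightarrow> 'g free_alg set" where
  "homogeneous G deg n =
     {x \<in> free_algebra G. \<forall>w\<in>Poly_Mapping.keys x. sum_list (map deg (letters w)) = n}"

definition sign :: "int \<Rightarrow> 'r::ring_1" where
  "sign n = (if even n then 1 else - 1)"

text \<open>The domain and codomain are the free algebra on \<open>G\<close>; as a total HOL function, \<open>d\<close> is made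
  \<open>undefined\<close> elsewhere so that uniqueness makes sense.\<close>

definition graded_derivation :: "'g set \<Rightarrow> ('g \<Rightarrow> int) \<Rightarrow> ('g free_alg \<Rightarrow> 'g free_alg) \<Rightarrow> bool" where
  "graded_derivation G deg d \<longleftrightarrow>
     d \<in> free_algebra G \<rightarrow>\<^sub>E free_algebra G \<and>
     (\<forall>x\<in>free_algebra G. \<forall>y\<in>free_algebra G. d (x + y) = d x + d y) \<and>
     (\<forall>n. \<forall>x\<in>homogeneous G deg n. d x \<in> homogeneous G deg (n - 1)) \<and>
     (\<forall>n. \<forall>x\<in>homogeneous G deg n. \<forall>y\<in>free_algebra G. d (x * y) = d x * y + sign n * x * d y)"

section \<open>The cellular algebra and its matrices\<close>

type_synonym generator = "nat set \<times> nat \<times> nat"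

definition generators ::
  "nat set set \<Rightarrow> ((nat \<Rightarrow> real) \<Rightarrow> 'a) \<Rightarrow> (nat set \<Rightarrow> ('a, 'e) jet set list) \<Rightarrow> generator set" where
  "generators K h ord =
     {(I, i, j). I \<in> K \<and> i < length (ord I) \<and> j < length (ord I) \<and>
        (\<forall>x\<in>cell h I. height (ord I ! i) x > height (ord I ! j) x)}"

definition sheet_potential :: "(('a, 'e) jet \<Rightarrow> int) \<Rightarrow> ('a, 'e) jet set \<Rightarrow> int" where
  "sheet_potential \<mu> S = (THE k. \<mu> ` S = {k})"

definition generator_degree ::
  "(('a, 'e) jet \<Rightarrow> int) \<Rightarrow> (nat set \<Rightarrow> ('a, 'e) jet set list) \<Rightarrow> generator \<Rightarrow> int" where
  "generator_degree \<mu> ord = (\<lambda>(I, i, j).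
     sheet_potential \<mu> (ord I ! i) - sheet_potential \<mu> (ord I ! j) + (int (card I) - 1) - 1)"

definition cell_matrix ::
  "nat set set \<Rightarrow> ((nat \<Rightarrow> real) \<Rightarrow> 'a) \<Rightarrow> (nat set \<Rightarrow> ('a, 'e) jet set list) \<Rightarrow> nat set \<Rightarrow> generator free_alg mat"
where
  "cell_matrix K h ord I = Matrix.mat (length (ord I)) (length (ord I))
     (\<lambda>(i, j). if (I, i, j) \<in> generators K h ord then letter (I, i, j) else 0)"

text \<open>\<open>face_matrix \<dots> I J\<close> is \<open>M\<^sub>I(e\<^sub>J)\<close>. For a compatible decomposition the sum has at most one term,
  and none if the cusp entry is 1.\<close>

definition face_matrix where
  "face_matrix T C K h ord I J = Matrix.mat (length (ord I)) (length (ord I))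
     (\<lambda>(k, l).
        (\<Sum>(i, j)\<in>{(i, j). (J, i, j) \<in> generators K h ord \<and>
              ord J ! i \<subseteq> T closure_of (ord I ! k) \<and> ord J ! j \<subseteq> T closure_of (ord I ! l)}.
           letter (J, i, j))
        + (if card J = 1 \<and> k < l \<and> meet_at_cusp T C h J (ord I ! k) (ord I ! l) then 1 else 0))"

definition theta_matrix ::
  "(('a, 'e) jet \<Rightarrow> int) \<Rightarrow> (nat set \<Rightarrow> ('a, 'e) jet set list) \<Rightarrow> nat set \<Rightarrow> generator free_alg mat" where
  "theta_matrix \<mu> ord I = Matrix.mat (length (ord I)) (length (ord I))
     (\<lambda>(i, j). if i = j then sign (sheet_potential \<mu> (ord I ! i)) else 0)"

text \<open>\<open>\<Sum>\<^sub>k (-1)\<^sup>k F k\<close> over \<open>k = 0, \<dots>, m\<close> for \<open>N \<times> N\<close> matrices \<open>F k\<close>.\<close>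

definition alternating_sum :: "nat \<Rightarrow> nat \<Rightarrow> (nat \<Rightarrow> 'r::ring_1 mat) \<Rightarrow> 'r mat" where
  "alternating_sum N m F = Matrix.mat N N (\<lambda>ij. \<Sum>k\<le>m. (- 1) ^ k * (F k $$ ij))"

definition boundary_matrix where
  "boundary_matrix T C \<mu> K h ord I =
     (let v = sorted_list_of_set I; m = card I - 1; N = length (ord I);
          M = face_matrix T C K h ord I
      in theta_matrix \<mu> ord I *
           ((if m = 0 then 0\<^sub>m N N else - alternating_sum N m (\<lambda>k. M (I - {v ! k})))
            + alternating_sum N m (\<lambda>k. M (set (take (Suc k) v)) * M (set (drop k v)))))"

definition cellular_differential where
  "cellular_differential T C \<mu> K h ord d \<longleftrightarrow>
     graded_derivation (generators K h ord) (generator_degree \<mu> ord) d \<and>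
     (\<forall>I\<in>K. map_mat d (cell_matrix K h ord I) = boundary_matrix T C \<mu> K h ord I)"

end

theory Submission
  imports Defs "HOL-Library.Function_Algebras"
begin

text \<open>Each component \<open>S\<close> of \<open>\<Lambda>\<close> above a cell \<open>e\<^sub>I\<close> extends continuously over the closed
  cell: (P1) makes the fibres of the base projection totally disconnected, so the connected
  cluster sets at boundary points are single points. Hence \<open>S\<close> has exactly one face above every \<open>e\<^sub>J\<close> in the closure of \<open>e\<^sub>I\<close>, faces of faces are
  faces, and (P3) says that every sheet above \<open>e\<^sub>J\<close> is a face of exactly one sheet above \<open>e\<^sub>I\<close> while the
  remaining sheets above \<open>e\<^sub>I\<close> are matched in pairs by a common cusp face. The two sheets of a pair have
  distinct heights because the front projection is injective near a cusp.

  Consequently \<open>M\<^sub>I(e\<^sub>J)\<close> is the block of \<open>M\<^sub>J(e\<^sub>J)\<close> on the sheets above \<open>e\<^sub>J\<close>, plus (for vertices) a constant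
  nilpotent block on the cusp pairs, and so \<open>\<partial>M\<^sub>I(e\<^sub>J)\<close> is \<open>\<Theta>\<^sub>I\<close> times the value on \<open>e\<^sub>J\<close> of the
  curvature \<open>- \<delta>M + M \<smile> M\<close> of the matrix-valued simplicial cochain \<open>M = M\<^sub>I\<close>.
  Applying \<open>\<partial>\<close> once more gives the Bianchi identity of this curvature, i.e. zero.\<close>

section \<open>Graded derivations of free algebras\<close>

text \<open>The matrix \<open>M_I(e_J)\<close> is indexed by the sheets above \<open>e_I\<close>,
  whereas \<open>\<partial>\<close> is prescribed on matrices indexed by the sheets above
  \<open>e_J\<close>, so the two index sets have to be compared inside matrix products. The
  additional indices do no harm: above faces of \<open>e_J\<close>, a sheet that ends at a cusp over
  \<open>e_J\<close> has only constant entries, linking it to its partner, which ends there too.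
  This constant block is flat: on an edge the two vertex contributions cancel, and a product of two
  constants would need two successive partners. The constants 1 have degree 0 because the Maslov
  potential jumps by 1.

  Signs: moving \<open>\<partial>\<close> past the first factor of a product gives a sign which,
  combined with the entry of \<open>\<Theta>\<close> at the middle index, equals
  \<open>-(-1)^a\<close> times the sign of the row. It absorbs the \<open>(-1)^a\<close> of the
  formula, so the Bianchi identity mixes a signed cup product with an unsigned one.

  Sheets of equal height may be listed in different orders above different cells. Only strict
  inequalities pass from a face to the larger cell, which is why cusp pairs must be strictly
  separated.\<close>

abbreviation word :: "'g list \<Rightarrow> 'g free_alg" where
  "word u \<equiv> Poly_Mapping.single (FWord u) 1"

lemma word_append: "word (u @ v) = word u * word v"
  by (simp add: mult_single plus_fword_def)

lemma word_Nil: "word [] = 1"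
  by (simp add: zero_fword_def[symmetric])

lemma word_Cons: "word (g # u) = letter g * word u"
  by (simp add: letter_def word_append[symmetric])

lemma free_algebra_0 [simp]: "0 \<in> free_algebra G"
  by (simp add: free_algebra_def)

lemma free_algebra_add: "x \<in> free_algebra G \<Longrightarrow> y \<in> free_algebra G \<Longrightarrow> x + y \<in> free_algebra G"
  unfolding free_algebra_def using Poly_Mapping.keys_add[of x y] by blast

lemma free_algebra_uminus: "x \<in> free_algebra G \<Longrightarrow> - x \<in> free_algebra G"
  by (simp add: free_algebra_def)

lemma free_algebra_mult: "x \<in> free_algebra G \<Longrightarrow> y \<in> free_algebra G \<Longrightarrow> x * y \<in> free_algebra G"
  unfolding free_algebra_def using keys_mult[of x y] by (fastforce simp: plus_fword_def)

lemma free_algebra_sum: "(\<And>i. i \<in> S \<Longrightarrow> f i \<in> free_algebra G) \<Longrightarrow> sum f S \<in> free_algebra G"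
  by (induction S rule: infinite_finite_induct) (auto intro: free_algebra_add)

lemma word_in_free_algebra [simp]: "word u \<in> free_algebra G \<longleftrightarrow> set u \<subseteq> G"
  by (simp add: free_algebra_def)

lemma free_algebra_1 [simp]: "1 \<in> free_algebra G"
  by (simp add: word_Nil[symmetric])

text \<open>The underlying additive group is free abelian on the words, so an additive property
  needs checking only on words; closure under differences covers sums and negatives at once.\<close>

lemma free_algebra_induct [consumes 1, case_names zero word diff]:
  assumes "x \<in> free_algebra G"
    and "P 0"
    and "\<And>u. set u \<subseteq> G \<Longrightarrow> P (word u)"
    and "\<And>x y. x \<in> free_algebra G \<Longrightarrow> y \<in> free_algebra G \<Longrightarrow> P x \<Longrightarrow> P y \<Longrightarrow> P (x - y)"
  shows "P x"
proof -
  have "x \<in> free_algebra G \<and> P x"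
  proof (rule frag_induction[of x "{w. set (letters w) \<subseteq> G}"])
    show "Poly_Mapping.keys x \<subseteq> {w. set (letters w) \<subseteq> G}"
      using assms(1) by (auto simp: free_algebra_def)
    show "frag_of w \<in> free_algebra G \<and> P (frag_of w)" if "w \<in> {w. set (letters w) \<subseteq> G}" for w
      using that assms(3)[of "letters w"] by (auto simp: free_algebra_def)
    show "a - b \<in> free_algebra G \<and> P (a - b)"
      if "a \<in> free_algebra G \<and> P a" "b \<in> free_algebra G \<and> P b" for a b
      using that assms(4) free_algebra_add[OF _ free_algebra_uminus, of a G b] by simp
  qed (use assms(2) in auto)
  then show ?thesis by simp
qed

lemma homogeneous_in_free_algebra: "x \<in> homogeneous G deg n \<Longrightarrow> x \<in> free_algebra G"
  by (simp add: homogeneous_def)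

lemma homogeneous_0 [simp]: "0 \<in> homogeneous G deg n"
  by (simp add: homogeneous_def)

lemma homogeneous_add:
  "x \<in> homogeneous G deg n \<Longrightarrow> y \<in> homogeneous G deg n \<Longrightarrow> x + y \<in> homogeneous G deg n"
  unfolding homogeneous_def using Poly_Mapping.keys_add[of x y] by (auto simp: free_algebra_add)

lemma homogeneous_uminus: "x \<in> homogeneous G deg n \<Longrightarrow> - x \<in> homogeneous G deg n"
  by (simp add: homogeneous_def free_algebra_uminus)

lemma homogeneous_sum:
  "(\<And>i. i \<in> S \<Longrightarrow> f i \<in> homogeneous G deg n) \<Longrightarrow> sum f S \<in> homogeneous G deg n"
  by (induction S rule: infinite_finite_induct) (auto intro: homogeneous_add)

lemma homogeneous_mult:
  assumes "x \<in> homogeneous G deg m" "y \<in> homogeneous G deg n" "k = m + n"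
  shows "x * y \<in> homogeneous G deg k"
  using assms keys_mult[of x y] unfolding homogeneous_def
  by (fastforce simp: free_algebra_mult plus_fword_def)

lemma homogeneous_1 [simp]: "1 \<in> homogeneous G deg 0"
  by (simp add: homogeneous_def word_Nil[symmetric])

lemma homogeneous_word: "set u \<subseteq> G \<Longrightarrow> word u \<in> homogeneous G deg (sum_list (map deg u))"
  by (simp add: homogeneous_def)

lemma homogeneous_letter: "g \<in> G \<Longrightarrow> letter g \<in> homogeneous G deg (deg g)"
  by (simp add: homogeneous_def letter_def)

lemma homogeneous_sign_mult [simp]:
  "x \<in> homogeneous G deg n \<Longrightarrow> sign k * x \<in> homogeneous G deg n"
  by (simp add: sign_def homogeneous_uminus)

lemma free_algebra_sign_mult [simp]: "x \<in> free_algebra G \<Longrightarrow> sign k * x \<in> free_algebra G"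
  by (simp add: sign_def free_algebra_uminus)

lemma sign_add: "sign (m + n) = (sign m * sign n :: 'r::ring_1)"
  by (auto simp: sign_def)

lemma sign_diff_1: "sign (n - 1) = (- sign n :: 'r::ring_1)"
  by (auto simp: sign_def)

lemma sign_commute: "x * sign n = sign n * (x :: 'r::ring_1)"
  by (auto simp: sign_def)

lemma sign_left_commute: "sign m * (sign n * x) = sign n * (sign m * (x :: 'r::ring_1))"
  by (auto simp: sign_def)

locale graded_derivation_on =
  fixes G :: "'g set" and deg d
  assumes graded_derivation: "graded_derivation G deg d"
begin

lemma d_extensional: "x \<notin> free_algebra G \<Longrightarrow> d x = undefined"
  and d_closed: "x \<in> free_algebra G \<Longrightarrow> d x \<in> free_algebra G"
  and d_add: "x \<in> free_algebra G \<Longrightarrow> y \<in> free_algebra G \<Longrightarrow> d (x + y) = d x + d y"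
  and d_homogeneous: "x \<in> homogeneous G deg n \<Longrightarrow> d x \<in> homogeneous G deg (n - 1)"
  and d_mult: "x \<in> homogeneous G deg n \<Longrightarrow> y \<in> free_algebra G \<Longrightarrow> d (x * y) = d x * y + sign n * x * d y"
  using graded_derivation unfolding graded_derivation_def PiE_iff extensional_def by blast+

lemma d_0 [simp]: "d 0 = 0"
  using d_add[of 0 0] by simp

lemma d_1 [simp]: "d 1 = 0"
  using d_mult[of 1 0 1] by (simp add: sign_def)

lemma d_uminus: "x \<in> free_algebra G \<Longrightarrow> d (- x) = - d x"
  using d_add[of x "- x"] by (simp add: free_algebra_uminus minus_unique)

lemma d_diff: "x \<in> free_algebra G \<Longrightarrow> y \<in> free_algebra G \<Longrightarrow> d (x - y) = d x - d y"
  using d_add[of x "- y"] by (simp add: free_algebra_uminus d_uminus)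

lemma d_sum: "(\<And>i. i \<in> S \<Longrightarrow> f i \<in> free_algebra G) \<Longrightarrow> d (sum f S) = (\<Sum>i\<in>S. d (f i))"
  by (induction S rule: infinite_finite_induct) (auto simp: d_add free_algebra_sum)

lemma d_sign_mult: "x \<in> free_algebra G \<Longrightarrow> d (sign k * x) = sign k * d x"
  by (simp add: sign_def d_uminus)

text \<open>On a product the mixed terms of \<open>d (d (x * y))\<close> cancel, because
  \<open>d x\<close> has degree one less than \<open>x\<close> and so the Leibniz sign flips.
  Vanishing on letters thus propagates to words and, by additivity, to the whole algebra.\<close>

lemma d_d_eq_0:
  assumes "\<And>g. g \<in> G \<Longrightarrow> d (d (letter g)) = 0" "x \<in> free_algebra G"
  shows "d (d x) = 0"
  using assms(2)
proof (induction rule: free_algebra_induct)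
  case (word u)
  then show ?case
  proof (induction u)
    case Nil
    then show ?case by (simp add: word_Nil)
  next
    case (Cons g u)
    let ?x = "letter g :: 'g free_alg" and ?y = "word u :: 'g free_alg"
    have x: "?x \<in> homogeneous G deg (deg g)" and y: "?y \<in> free_algebra G"
      using Cons.prems by (auto intro: homogeneous_letter)
    note x' = homogeneous_in_free_algebra[OF x]
    have "d (d (?x * ?y)) = d (d ?x * ?y + sign (deg g) * (?x * d ?y))"
      by (simp add: d_mult[OF x y] mult.assoc)
    also have "\<dots> = d (d ?x * ?y) + sign (deg g) * d (?x * d ?y)"
      using x' y by (simp add: d_add d_sign_mult free_algebra_mult d_closed)
    also have "d (d ?x * ?y) = d (d ?x) * ?y - sign (deg g) * d ?x * d ?y"
      by (simp add: d_mult[OF d_homogeneous[OF x] y] sign_diff_1)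
    also have "d (?x * d ?y) = d ?x * d ?y + sign (deg g) * ?x * d (d ?y)"
      by (simp add: d_mult[OF x d_closed[OF y]])
    finally show ?case
      using Cons assms(1)[of g] by (simp add: word_Cons algebra_simps)
  qed
qed (auto simp: d_diff d_closed)

end

text \<open>The Leibniz rule reduces words to letters. Off the free algebra both maps are
  \<open>undefined\<close>, so they agree as total functions.\<close>

lemma graded_derivation_unique:
  assumes "graded_derivation G deg d" "graded_derivation G deg d'"
    and "\<And>g. g \<in> G \<Longrightarrow> d (letter g) = d' (letter g)"
  shows "d = d'"
proof
  interpret d: graded_derivation_on G deg d by standard fact
  interpret d': graded_derivation_on G deg d' by standard fact
  fix x
  show "d x = d' x"
  proof (cases "x \<in> free_algebra G")
    case True
    then show ?thesis
    proof (induction rule: free_algebra_induct)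
      case (word u)
      then show ?case
      proof (induction u)
        case (Cons g u)
        then show ?case
          using assms(3)[of g] d.d_mult[OF homogeneous_letter[of g G deg], of "word u"]
            d'.d_mult[OF homogeneous_letter[of g G deg], of "word u"]
          by (simp add: word_Cons)
      qed (simp add: word_Nil)
    qed (auto simp: d.d_diff d'.d_diff)
  qed (simp add: d.d_extensional d'.d_extensional)
qed

section \<open>Existence of derivations with prescribed values on letters\<close>

primrec word_derivative :: "('g \<Rightarrow> int) \<Rightarrow> ('g \<Rightarrow> 'g free_alg) \<Rightarrow> 'g list \<Rightarrow> 'g free_alg" where
  "word_derivative deg \<delta> [] = 0"
| "word_derivative deg \<delta> (g # u) = \<delta> g * word u + sign (deg g) * letter g * word_derivative deg \<delta> u"

text \<open>Both sides of the Leibniz rule are additive in each factor, so concatenated words are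
  the only case with content. Signs are central and move past letters.\<close>

lemma word_derivative_append:
  "word_derivative deg \<delta> (u @ v) =
     word_derivative deg \<delta> u * word v + sign (sum_list (map deg u)) * word u * word_derivative deg \<delta> v"
proof (induction u)
  case Nil
  then show ?case by (simp add: word_Nil sign_def)
next
  case (Cons g u)
  have "sign (deg g) * letter g * (sign s * word u * x) =
      sign (deg g + s) * word (g # u) * x" for s x
    unfolding word_Cons sign_add by (metis (no_types, opaque_lifting) mult.assoc sign_commute)
  then show ?case
    using Cons by (simp add: word_append distrib_left distrib_right mult.assoc)
qed

lemma word_derivative_homogeneous:
  assumes "\<And>g. g \<in> G \<Longrightarrow> \<delta> g \<in> homogeneous G deg (deg g - 1)" "set u \<subseteq> G"
  shows "word_derivative deg \<delta> u \<in> homogeneous G deg (sum_list (map deg u) - 1)"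
  using assms(2)
proof (induction u)
  case (Cons g u)
  then have "\<delta> g * word u \<in> homogeneous G deg (sum_list (map deg (g # u)) - 1)"
    by (intro homogeneous_mult[OF assms(1) homogeneous_word]) auto
  moreover have "letter g * word_derivative deg \<delta> u \<in> homogeneous G deg (sum_list (map deg (g # u)) - 1)"
    using Cons by (intro homogeneous_mult[OF homogeneous_letter]) auto
  ultimately show ?case
    by (auto simp: mult.assoc intro: homogeneous_add)
qed simp

lemma frag_cmul_conv_mult: "frag_cmul c x = of_int c * (x :: 'g free_alg)"
proof (induction c rule: int_induct[where k = 0])
  case (step1 i)
  then show ?case by (simp add: frag_cmul_distrib algebra_simps)
next
  case (step2 i)
  then show ?case by (simp add: frag_cmul_diff_distrib frag_cmul_distrib algebra_simps)
qed simp

text \<open>Words form a basis of the free algebra, so the Leibniz expansion of each word extends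
  additively with no relation to check.\<close>

lemma ex_graded_derivation:
  assumes \<delta>: "\<And>g. g \<in> G \<Longrightarrow> \<delta> g \<in> homogeneous G deg (deg g - 1)"
  shows "\<exists>d. graded_derivation G deg d \<and> (\<forall>g\<in>G. d (letter g) = \<delta> g)"
proof -
  define D where "D = frag_extend (\<lambda>w. word_derivative deg \<delta> (letters w))"
  have D_word: "D (word u) = word_derivative deg \<delta> u" for u
    by (simp add: D_def)
  have D_add: "D (x + y) = D x + D y" and D_diff: "D (x - y) = D x - D y" and D_0: "D 0 = 0" for x y
    by (simp_all add: D_def frag_extend_add frag_extend_diff)
  have D_hom: "D x \<in> homogeneous G deg (n - 1)" if "x \<in> homogeneous G deg n" for x n
    unfolding D_def frag_extend_def frag_cmul_conv_mult
  proof (rule homogeneous_sum)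
    fix w assume "w \<in> Poly_Mapping.keys x"
    then have "word_derivative deg \<delta> (letters w) \<in> homogeneous G deg (n - 1)"
      using that word_derivative_homogeneous[OF \<delta>, where u = "letters w"]
      by (auto simp: homogeneous_def free_algebra_def)
    then show "of_int (Poly_Mapping.lookup x w) * word_derivative deg \<delta> (letters w)
        \<in> homogeneous G deg (n - 1)"
      using keys_cmul[of "Poly_Mapping.lookup x w" "word_derivative deg \<delta> (letters w)"]
      unfolding frag_cmul_conv_mult[symmetric] homogeneous_def free_algebra_def by blast
  qed
  have D_closed: "D x \<in> free_algebra G" if "x \<in> free_algebra G" for x
    using that
  proof (induction rule: free_algebra_induct)
    case (word u)
    then show ?case
      using D_hom[OF homogeneous_word] homogeneous_in_free_algebra by blast
  next
    case (diff x y)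
    then show ?case
      using free_algebra_add[OF _ free_algebra_uminus] by (fastforce simp: D_diff)
  qed (simp add: D_0)
  have D_mult: "D (x * y) = D x * y + sign n * x * D y"
    if x: "x \<in> homogeneous G deg n" and y: "y \<in> free_algebra G" for x y n
    using y
  proof (induction rule: free_algebra_induct)
    case (word v)
    \<comment> \<open>As \<open>x\<close> is homogeneous, every word in its support has degree
      \<open>n\<close> and produces the same sign; this permits a second induction, over the support
      of \<open>x\<close>.\<close>
    have "Poly_Mapping.keys x \<subseteq> {w. sum_list (map deg (letters w)) = n}"
      using x by (auto simp: homogeneous_def)
    then show ?case
    proof (induction x rule: frag_induction)
      case (one w)
      obtain u where w: "w = FWord u"
        by (cases w)
      show ?case
        using one unfolding w word_append[symmetric] D_word word_derivative_append by simp
    qed (simp_all add: D_0 D_diff algebra_simps)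
  qed (simp_all add: D_0 D_diff algebra_simps)
  define d where "d = restrict D (free_algebra G)"
  have d: "d x = D x" if "x \<in> free_algebra G" for x
    using that by (simp add: d_def)
  have "graded_derivation G deg d"
    unfolding graded_derivation_def
  proof (intro conjI ballI allI)
    show "d \<in> free_algebra G \<rightarrow>\<^sub>E free_algebra G"
      using D_closed by (auto simp: d_def)
    show "d (x + y) = d x + d y" if "x \<in> free_algebra G" "y \<in> free_algebra G" for x y
      using that by (simp add: d free_algebra_add D_add)
    show "d x \<in> homogeneous G deg (n - 1)" if "x \<in> homogeneous G deg n" for n x
      using D_hom[OF that] homogeneous_in_free_algebra[OF that] by (simp add: d)
    show "d (x * y) = d x * y + sign n * x * d y"
      if "x \<in> homogeneous G deg n" "y \<in> free_algebra G" for n x y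
      using D_mult[OF that] homogeneous_in_free_algebra[OF that(1)] that(2)
      by (simp add: d free_algebra_mult)
  qed
  moreover have "d (letter g) = \<delta> g" if "g \<in> G" for g
    using that D_word[of "[g]"] by (simp add: d letter_def word_Nil)
  ultimately show ?thesis by blast
qed

section \<open>The Bianchi identity for simplicial cochains\<close>

definition omit_nth :: "nat \<Rightarrow> 'v list \<Rightarrow> 'v list" where
  "omit_nth a v = take a v @ drop (Suc a) v"

text \<open>Powers of -1 acting on a bare abelian group, so that signs make sense before any product
  of coefficients is chosen.\<close>

definition alt :: "nat \<Rightarrow> 'b::ab_group_add \<Rightarrow> 'b" where
  "alt a x = (if even a then x else - x)"

lemma alt_simps [simp]: "alt a 0 = 0" "alt 0 x = x" "alt (Suc a) x = - alt a x"
  "alt a (- x) = - alt a x" "alt a (x + y) = alt a x + alt a y" "alt a (x - y) = alt a x - alt a y"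
  "alt a (alt b x) = alt (a + b) x"
  by (auto simp: alt_def)

lemma alt_sum: "alt a (sum f S) = (\<Sum>i\<in>S. alt a (f i))"
  by (induction S rule: infinite_finite_induct) auto

lemma omit_nth_Nil [simp]: "omit_nth a [] = []"
  and omit_nth_0_Cons [simp]: "omit_nth 0 (x # v) = v"
  and omit_nth_Suc_Cons [simp]: "omit_nth (Suc a) (x # v) = x # omit_nth a v"
  by (simp_all add: omit_nth_def)

lemma length_omit_nth [simp]: "a < length v \<Longrightarrow> length (omit_nth a v) = length v - 1"
  by (simp add: omit_nth_def)

text \<open>This is the simplicial identity \<open>d_i d_j = d_{j-1} d_i\<close> for
  \<open>i < j\<close>, with \<open>j = Suc b\<close>.\<close>

lemma omit_nth_omit_nth: "a \<le> b \<Longrightarrow> omit_nth a (omit_nth (Suc b) v) = omit_nth b (omit_nth a v)"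
proof (induction v arbitrary: a b)
  case (Cons x v)
  then show ?case by (cases a; cases b) simp_all
qed simp

lemma take_omit_nth_le: "a \<le> b \<Longrightarrow> take b (omit_nth a v) = omit_nth a (take (Suc b) v)"
proof (induction v arbitrary: a b)
  case (Cons x v)
  then show ?case by (cases a; cases b) simp_all
qed simp

lemma drop_omit_nth_le: "a \<le> b \<Longrightarrow> drop b (omit_nth a v) = drop (Suc b) v"
proof (induction v arbitrary: a b)
  case (Cons x v)
  then show ?case by (cases a; cases b) simp_all
qed simp

lemma take_omit_nth_ge: "b \<le> a \<Longrightarrow> take b (omit_nth a v) = take b v"
proof (induction v arbitrary: a b)
  case (Cons x v)
  then show ?case by (cases a; cases b) simp_all
qed simp

lemma drop_omit_nth_ge: "b \<le> a \<Longrightarrow> drop b (omit_nth a v) = omit_nth (a - b) (drop b v)"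
proof (induction v arbitrary: a b)
  case (Cons x v)
  then show ?case by (cases a; cases b) simp_all
qed simp

lemma omit_last_take: "a < length v \<Longrightarrow> omit_nth a (take (Suc a) v) = take a v"
  by (simp add: omit_nth_def min_def)

lemma omit_nth_0: "omit_nth 0 v = drop 1 v"
  by (simp add: omit_nth_def)

text \<open>The coboundary of the augmented complex of an ordered simplex: on a one-vertex list its
  value is \<open>F []\<close>, so it agrees with the usual coboundary once
  \<open>F [] = 0\<close>.\<close>

definition delta :: "('v list \<Rightarrow> 'b::ab_group_add) \<Rightarrow> 'v list \<Rightarrow> 'b" where
  "delta F v = (\<Sum>a<length v. alt a (F (omit_nth a v)))"

lemma finite_index_pairs:
  "finite {(k, l). k \<le> l \<and> l < (m::nat)}" "finite {(k, l). l < k \<and> k < (m::nat)}"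
  by (rule finite_subset[of _ "{..<m} \<times> {..<m}"]; auto)+

lemma delta_delta: "delta (delta F) v = 0"
proof -
  define n where "n = length v"
  define t where "t k l = alt (k + l) (F (omit_nth l (omit_nth k v)))" for k l
  \<comment> \<open>Omitting two vertices in either order gives the same list, but one of the two
    indices shifts by one, so the two terms have opposite signs.\<close>
  have flip: "t k l = - t l (k - Suc 0)" if "l < k" for k l
    using that by (cases k) (simp_all add: t_def omit_nth_omit_nth add.commute)
  have "delta (delta F) v = (\<Sum>(k, l)\<in>{..<n} \<times> {..<n - 1}. t k l)"
    unfolding delta_def n_def t_def by (simp add: alt_sum sum.cartesian_product)
  also have "{..<n} \<times> {..<n - 1} = {(k, l). k \<le> l \<and> l < n - 1} \<union> {(k, l). l < k \<and> k < n}"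
    by auto
  also have "(\<Sum>(k, l)\<in>\<dots>. t k l) =
      (\<Sum>(k, l)\<in>{(k, l). k \<le> l \<and> l < n - 1}. t k l) + (\<Sum>(k, l)\<in>{(k, l). l < k \<and> k < n}. t k l)"
    by (intro sum.union_disjoint finite_index_pairs) auto
  also have "(\<Sum>(k, l)\<in>{(k, l). l < k \<and> k < n}. t k l) = (\<Sum>(k, l)\<in>{(k, l). k \<le> l \<and> l < n - 1}. - t k l)"
    by (rule sum.reindex_bij_witness[where i = "\<lambda>(k, l). (Suc l, k)" and j = "\<lambda>(k, l). (l, k - 1)"])
      (auto simp: flip)
  finally show ?thesis
    by (simp add: case_prod_unfold sum_negf)
qed

text \<open>Abstract coefficients, to be instantiated by matrices given as functions: on those,
  \<open>*\<close> would be the pointwise product, so the matrix product is a separate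
  operation.\<close>

locale biadditive_assoc =
  fixes mul :: "'b::ab_group_add \<Rightarrow> 'b \<Rightarrow> 'b" (infixl \<open>\<star>\<close> 70)
  assumes mul_add_left: "(x + y) \<star> z = x \<star> z + y \<star> z"
    and mul_add_right: "x \<star> (y + z) = x \<star> y + x \<star> z"
    and mul_assoc: "x \<star> y \<star> z = x \<star> (y \<star> z)"
begin

lemma mul_0_left [simp]: "0 \<star> x = 0" and mul_0_right [simp]: "x \<star> 0 = 0"
  using mul_add_left[of 0 0 x] mul_add_right[of x 0 0] by simp_all

lemma mul_uminus_left: "(- x) \<star> y = - (x \<star> y)" and mul_uminus_right: "x \<star> (- y) = - (x \<star> y)"
  using mul_add_left[of "- x" x y] mul_add_right[of x "- y" y] by (simp_all add: eq_neg_iff_add_eq_0)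

lemma mul_alt_left: "alt a x \<star> y = alt a (x \<star> y)" and mul_alt_right: "x \<star> alt a y = alt a (x \<star> y)"
  by (simp_all add: alt_def mul_uminus_left mul_uminus_right)

lemma mul_sum_left: "sum f S \<star> y = (\<Sum>i\<in>S. f i \<star> y)"
  by (induction S rule: infinite_finite_induct) (auto simp: mul_add_left)

lemma mul_sum_right: "y \<star> sum f S = (\<Sum>i\<in>S. y \<star> f i)"
  by (induction S rule: infinite_finite_induct) (auto simp: mul_add_right)

text \<open>The product in the boundary formula: \<open>a\<close> is the dimension of the front
  face, and the vertex at index \<open>a\<close> belongs to both factors. Without the sign,
  \<open>unsigned_cup\<close> is the usual Alexander-Whitney product.\<close>

definition cup :: "('v list \<Rightarrow> 'b) \<Rightarrow> ('v list \<Rightarrow> 'b) \<Rightarrow> 'v list \<Rightarrow> 'b" where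
  "cup F G v = (\<Sum>a<length v. alt a (F (take (Suc a) v) \<star> G (drop a v)))"

definition unsigned_cup :: "('v list \<Rightarrow> 'b) \<Rightarrow> ('v list \<Rightarrow> 'b) \<Rightarrow> 'v list \<Rightarrow> 'b" where
  "unsigned_cup F G v = (\<Sum>a<length v. F (take (Suc a) v) \<star> G (drop a v))"

text \<open>A vertex is omitted either before or after the splitting vertex. The terms
  \<open>u a\<close>, where the front face loses its last vertex or the back face its first, occur
  on both sides of the right-hand side and cancel after an index shift; \<open>F [] = 0\<close> and
  \<open>G [] = 0\<close> remove the two ends of that shift.\<close>

lemma delta_cup:
  assumes "F [] = 0" "G [] = 0"
  shows "delta (cup F G) v = - cup (delta F) G v + unsigned_cup F (delta G) v"
proof -
  define n where "n = length v"
  define t where "t k l = alt (k + l) (F (take (Suc l) (omit_nth k v)) \<star> G (drop l (omit_nth k v)))" for k l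
  define p where "p a k = alt (a + k) (F (omit_nth k (take (Suc a) v)) \<star> G (drop a v))" for a k
  define q where "q a b = alt b (F (take (Suc a) v) \<star> G (omit_nth b (drop a v)))" for a b
  define u where "u a = F (take a v) \<star> G (drop a v)" for a
  have "delta (cup F G) v = (\<Sum>(k, l)\<in>{..<n} \<times> {..<n - 1}. t k l)"
    unfolding delta_def cup_def n_def t_def by (simp add: alt_sum sum.cartesian_product)
  also have "{..<n} \<times> {..<n - 1} = {(k, l). k \<le> l \<and> l < n - 1} \<union> {(k, l). l < k \<and> k < n}"
    by auto
  also have "(\<Sum>(k, l)\<in>\<dots>. t k l) =
      (\<Sum>(k, l)\<in>{(k, l). k \<le> l \<and> l < n - 1}. t k l) + (\<Sum>(k, l)\<in>{(k, l). l < k \<and> k < n}. t k l)"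
    by (intro sum.union_disjoint finite_index_pairs) auto
  also have "(\<Sum>(k, l)\<in>{(k, l). k \<le> l \<and> l < n - 1}. t k l) = (\<Sum>(a, k)\<in>Sigma {..<n} lessThan. - p a k)"
    by (rule sum.reindex_bij_witness[where i = "\<lambda>(a, k). (k, a - 1)" and j = "\<lambda>(k, l). (Suc l, k)"])
      (auto simp: t_def p_def take_omit_nth_le drop_omit_nth_le add.commute)
  also have "\<dots> = - (\<Sum>a<n. sum (p a) {..<a})"
    by (simp add: case_prod_unfold sum_negf sum.Sigma)
  also have "(\<Sum>(k, l)\<in>{(k, l). l < k \<and> k < n}. t k l) =
      (\<Sum>(a, b)\<in>Sigma {..<n} (\<lambda>a. {1..<n - a}). q a b)"
    by (rule sum.reindex_bij_witness[where i = "\<lambda>(a, b). (a + b, a)" and j = "\<lambda>(k, l). (l, k - l)"])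
      (auto simp: t_def q_def take_omit_nth_ge drop_omit_nth_ge alt_def)
  also have "\<dots> = (\<Sum>a<n. sum (q a) {1..<n - a})"
    by (simp add: sum.Sigma)
  finally have lhs: "delta (cup F G) v = - (\<Sum>a<n. sum (p a) {..<a}) + (\<Sum>a<n. sum (q a) {1..<n - a})" .
  have "cup (delta F) G v = (\<Sum>a<n. \<Sum>k<Suc a. p a k)"
    unfolding cup_def delta_def n_def p_def
    by (intro sum.cong) (auto simp: min_absorb2 Suc_le_eq mul_sum_left mul_add_left alt_sum mul_alt_left)
  also have "\<dots> = (\<Sum>a<n. sum (p a) {..<a}) + (\<Sum>a<n. u a)"
    by (simp add: sum.distrib p_def u_def n_def omit_last_take alt_def)
  finally have cup: "cup (delta F) G v = (\<Sum>a<n. sum (p a) {..<a}) + (\<Sum>a<n. u a)" .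
  have "unsigned_cup F (delta G) v = (\<Sum>a<n. \<Sum>b<n - a. q a b)"
    unfolding unsigned_cup_def delta_def n_def q_def
    by (intro sum.cong) (auto simp: mul_sum_right mul_alt_right)
  also have "\<dots> = (\<Sum>a<n. q a 0 + sum (q a) {1..<n - a})"
    using sum.atLeast_Suc_lessThan[of 0 "n - a" "q a" for a] by (intro sum.cong) (auto simp: atLeast0LessThan)
  also have "\<dots> = (\<Sum>a<n. u (Suc a)) + (\<Sum>a<n. sum (q a) {1..<n - a})"
    by (simp add: sum.distrib q_def u_def omit_nth_0)
  also have "(\<Sum>a<n. u (Suc a)) = (\<Sum>a<n. u a)"
    using sum.lessThan_Suc[of u n] sum.lessThan_Suc_shift[of u n] assms by (simp add: u_def n_def)
  finally show ?thesis
    unfolding lhs cup by simp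
qed

text \<open>Associativity for splitting vertices \<open>b \<le> a\<close>: the sign is
  \<open>(-1)^(a + b)\<close> on the left and \<open>(-1)^(a - b)\<close> on the right, which
  agree.\<close>

lemma cup_cup: "cup (cup F G) H v = unsigned_cup F (cup G H) v"
proof -
  define n where "n = length v"
  define t where "t a b = alt (a + b) (F (take (Suc b) v) \<star> (G (drop b (take (Suc a) v)) \<star> H (drop a v)))" for a b
  have "cup (cup F G) H v = (\<Sum>a<n. \<Sum>b<Suc a. t a b)"
    unfolding cup_def n_def t_def
    by (intro sum.cong)
      (auto simp: min_absorb2 Suc_le_eq mul_sum_left mul_add_left alt_sum mul_alt_left mul_assoc intro!: sum.cong)
  also have "\<dots> = (\<Sum>(a, b)\<in>Sigma {..<n} (\<lambda>a. {..<Suc a}). t a b)"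
    by (rule sum.Sigma) auto
  also have "\<dots> = (\<Sum>(b, c)\<in>Sigma {..<n} (\<lambda>b. {..<n - b}). t (b + c) b)"
    by (rule sum.reindex_bij_witness[where i = "\<lambda>(b, c). (b + c, b)" and j = "\<lambda>(a, b). (b, a - b)"])
      auto
  also have "\<dots> = (\<Sum>b<n. \<Sum>c<n - b. t (b + c) b)"
    by (rule sum.Sigma[symmetric]) auto
  also have "\<dots> = unsigned_cup F (cup G H) v"
    unfolding cup_def unsigned_cup_def n_def t_def
    by (intro sum.cong) (auto simp: mul_sum_right mul_alt_right mul_uminus_right drop_take alt_def add.commute
        Suc_diff_le intro!: sum.cong)
  finally show ?thesis .
qed

text \<open>After expansion, the terms with one \<open>delta M\<close> cancel in pairs and the
  triple products cancel by \<open>cup_cup\<close>. The unsigned last term is the one that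
  \<open>d_curvature\<close> produces.\<close>

lemma bianchi:
  assumes "M [] = 0"
  defines "D \<equiv> \<lambda>v. - delta M v + cup M M v"
  shows "- delta D v + cup D M v - unsigned_cup M D v = 0"
proof -
  have "delta D v = - delta (delta M) v + delta (cup M M) v"
    by (simp add: delta_def D_def sum.distrib sum_negf sum_subtractf)
  moreover have "cup D M v = - cup (delta M) M v + cup (cup M M) M v"
    unfolding D_def cup_def[of _ M v]
    by (simp only: mul_add_left mul_uminus_left alt_simps sum.distrib sum_negf)
  moreover have "unsigned_cup M D v = - unsigned_cup M (delta M) v + unsigned_cup M (cup M M) v"
    unfolding D_def unsigned_cup_def
    by (simp only: mul_add_right mul_uminus_right sum.distrib sum_negf)
  ultimately show ?thesis
    using delta_delta[of M v] delta_cup[of M M v] cup_cup[of M M M v] assms(1) by simp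
qed

end

lemma sum_fun_apply: "sum f S x = (\<Sum>i\<in>S. f i x)"
  by (induction S rule: infinite_finite_induct) auto

lemma alt_apply: "alt a f x = alt a (f x)"
  by (simp add: alt_def)

lemma bianchi_entries:
  fixes M :: "'v list \<Rightarrow> nat \<Rightarrow> nat \<Rightarrow> 'r::ring_1" and N :: nat
  assumes "\<And>i j. M [] i j = 0"
  defines "D \<equiv> \<lambda>v i j. - (\<Sum>a<length v. (- 1) ^ a * M (omit_nth a v) i j)
      + (\<Sum>a<length v. (- 1) ^ a * (\<Sum>p<N. M (take (Suc a) v) i p * M (drop a v) p j))"
  shows "- (\<Sum>a<length v. (- 1) ^ a * D (omit_nth a v) i j)
      + (\<Sum>a<length v. (- 1) ^ a * (\<Sum>p<N. D (take (Suc a) v) i p * M (drop a v) p j))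
      - (\<Sum>a<length v. \<Sum>p<N. M (take (Suc a) v) i p * D (drop a v) p j) = 0"
proof -
  \<comment> \<open>Only the middle index is bounded by \<open>N\<close>. Rows and columns stay
    arbitrary, so all such functions form an abelian group under pointwise addition and no
    dimensions have to be carried along.\<close>
  define mul where "mul = (\<lambda>(A :: nat \<Rightarrow> nat \<Rightarrow> 'r) (B :: nat \<Rightarrow> nat \<Rightarrow> 'r) i j. \<Sum>p<N. A i p * B p j)"
  interpret biadditive_assoc mul
  proof
    show "mul (mul x y) z = mul x (mul y z)" for x y z
      unfolding mul_def
      by (intro ext, simp add: sum_distrib_left sum_distrib_right mult.assoc, rule sum.swap)
  qed (auto simp: mul_def fun_eq_iff distrib_left distrib_right sum.distrib)
  have 0: "M [] = 0"
    using assms(1) by (simp add: fun_eq_iff)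
  have mul: "mul A B i j = (\<Sum>p<N. A i p * B p j)" for A B i j
    by (simp add: mul_def)
  have alt: "alt a x = (- 1) ^ a * x" for a and x :: 'r
    by (simp add: alt_def)
  have D: "D v = - delta M v + cup M M v" for v
    by (intro ext) (simp add: D_def delta_def cup_def mul sum_fun_apply alt_apply alt)
  have "(- delta D v + cup D M v - unsigned_cup M D v) i j = 0"
    unfolding D using bianchi[of M v, OF 0] by simp
  then show ?thesis
    by (simp add: delta_def cup_def unsigned_cup_def mul sum_fun_apply alt_apply alt)
qed

section \<open>From sheet combinatorics to a differential\<close>

lemma set_omit_nth_subset: "set (omit_nth a v) \<subseteq> set v"
  using set_take_subset[of a v] set_drop_subset[of "Suc a" v] by (auto simp: omit_nth_def)

lemma sorted_omit_nth: "sorted v \<Longrightarrow> sorted (omit_nth a v)"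
proof (induction v arbitrary: a)
  case (Cons x v)
  then show ?case
    using set_omit_nth_subset[of "a - 1" v] by (cases a) auto
qed simp

lemma distinct_omit_nth: "distinct v \<Longrightarrow> distinct (omit_nth a v)"
proof (induction v arbitrary: a)
  case (Cons x v)
  then show ?case
    using set_omit_nth_subset[of "a - 1" v] by (cases a) auto
qed simp

lemma card_set_omit_nth: "distinct v \<Longrightarrow> a < length v \<Longrightarrow> card (set (omit_nth a v)) = length v - 1"
  by (simp add: distinct_card distinct_omit_nth)

text \<open>Sheets are represented by their positions: \<open>N I\<close> is the number of sheets above \<open>e\<^sub>I\<close>,
  \<open>gen I i j\<close> means that sheet \<open>i\<close> lies strictly above sheet \<open>j\<close>, \<open>sub J i I k\<close> that sheet \<open>i\<close> above \<open>e\<^sub>J\<close> is in the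
  closure of sheet \<open>k\<close> above \<open>e\<^sub>I\<close>, and \<open>cusp J I k l\<close> that sheets \<open>k\<close> and \<open>l\<close> above \<open>e\<^sub>I\<close> meet at a cusp
  above \<open>e\<^sub>J\<close>.\<close>

locale sheet_combinatorics =
  fixes K :: "nat set set" and N :: "nat set \<Rightarrow> nat" and gen :: "nat set \<Rightarrow> nat \<Rightarrow> nat \<Rightarrow> bool"
    and sub :: "nat set \<Rightarrow> nat \<Rightarrow> nat set \<Rightarrow> nat \<Rightarrow> bool"
    and cusp :: "nat set \<Rightarrow> nat set \<Rightarrow> nat \<Rightarrow> nat \<Rightarrow> bool"
    and pot :: "nat set \<Rightarrow> nat \<Rightarrow> int"
  assumes finite_simplex: "I \<in> K \<Longrightarrow> finite I" and nonempty_simplex: "I \<in> K \<Longrightarrow> I \<noteq> {}"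
    and face_simplex: "I \<in> K \<Longrightarrow> J \<subseteq> I \<Longrightarrow> J \<noteq> {} \<Longrightarrow> J \<in> K"
    and gen_dom: "gen I i j \<Longrightarrow> I \<in> K \<and> i < j \<and> j < N I"
    and gen_trans: "gen I i j \<Longrightarrow> gen I j k \<Longrightarrow> gen I i k"
    and sub_dom: "sub J i I k \<Longrightarrow> I \<in> K \<and> J \<subseteq> I \<and> J \<noteq> {} \<and> i < N J \<and> k < N I"
    and sub_ex: "I \<in> K \<Longrightarrow> J \<subseteq> I \<Longrightarrow> J \<noteq> {} \<Longrightarrow> i < N J \<Longrightarrow> \<exists>k. sub J i I k"
    and sub_unique_upper: "sub J i I k \<Longrightarrow> sub J i I k' \<Longrightarrow> k = k'"
    and sub_unique_lower: "sub J i I k \<Longrightarrow> sub J i' I k \<Longrightarrow> i = i'"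
    and sub_trans: "sub H a J b \<Longrightarrow> sub J b I k \<Longrightarrow> sub H a I k"
    and cusp_sym: "cusp J I k l \<Longrightarrow> cusp J I l k"
    and cusp_unique: "cusp J I k l \<Longrightarrow> cusp J I k l' \<Longrightarrow> l = l'"
    and cusp_not_sub: "cusp J I k l \<Longrightarrow> \<not> sub J i I k"
    and cusp_face: "cusp J I k l \<Longrightarrow> H \<subseteq> J \<Longrightarrow> H \<noteq> {} \<Longrightarrow> cusp H I k l"
    and cusp_coface: "cusp H I k l \<Longrightarrow> H \<subseteq> J \<Longrightarrow> J \<subseteq> I \<Longrightarrow> (\<And>i. \<not> sub J i I k) \<Longrightarrow> cusp J I k l"
    and cusp_sub: "sub J i I k \<Longrightarrow> sub J j I l \<Longrightarrow> H \<subseteq> J \<Longrightarrow> cusp H J i j \<longleftrightarrow> cusp H I k l"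
    and gen_sub: "gen J i j \<Longrightarrow> sub J i I k \<Longrightarrow> sub J j I l \<Longrightarrow> gen I k l"
    and gen_cusp: "cusp J I k l \<Longrightarrow> k < l \<Longrightarrow> gen I k l"
    and pot_sub: "sub J i I k \<Longrightarrow> pot J i = pot I k"
    and pot_cusp: "cusp J I k l \<Longrightarrow> k < l \<Longrightarrow> pot I k = pot I l + 1"
begin

definition gens :: "generator set" where
  "gens = {(I, i, j). gen I i j}"

definition deg :: "generator \<Rightarrow> int" where
  "deg = (\<lambda>(I, i, j). pot I i - pot I j + (int (card I) - 1) - 1)"

lemma deg_apply: "deg (I, i, j) = pot I i - pot I j + int (card I) - 2"
  by (simp add: deg_def)

definition cell_entry :: "nat set \<Rightarrow> nat \<Rightarrow> nat \<Rightarrow> generator free_alg" where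
  "cell_entry I i j = (if gen I i j then letter (I, i, j) else 0)"

definition face_entry :: "nat set \<Rightarrow> nat set \<Rightarrow> nat \<Rightarrow> nat \<Rightarrow> generator free_alg" where
  "face_entry I J k l =
     (\<Sum>(i, j)\<in>{(i, j). gen J i j \<and> sub J i I k \<and> sub J j I l}. letter (J, i, j))
     + (if card J = 1 \<and> k < l \<and> cusp J I k l then 1 else 0)"

text \<open>The vertex list \<open>v\<close> is independent of \<open>I\<close>: values on faces of
  \<open>e_I\<close> are needed with rows and columns still indexed by the sheets above
  \<open>e_I\<close>. The empty face contributes 0, so a single vertex is not a special
  case.\<close>

definition curvature :: "nat set \<Rightarrow> nat list \<Rightarrow> nat \<Rightarrow> nat \<Rightarrow> generator free_alg" where
  "curvature I v k l =
     - (\<Sum>a<length v. (- 1) ^ a * face_entry I (set (omit_nth a v)) k l)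
     + (\<Sum>a<length v. (- 1) ^ a *
          (\<Sum>p<N I. face_entry I (set (take (Suc a) v)) k p * face_entry I (set (drop a v)) p l))"

definition boundary_entry :: "nat set \<Rightarrow> nat \<Rightarrow> nat \<Rightarrow> generator free_alg" where
  "boundary_entry I i j = sign (pot I i) * curvature I (sorted_list_of_set I) i j"

definition is_sub :: "nat set \<Rightarrow> nat set \<Rightarrow> nat \<Rightarrow> bool" where
  "is_sub J I k \<longleftrightarrow> (\<exists>i. sub J i I k)"

section \<open>Shape and degree of the matrix entries\<close>

lemma not_gen_empty [simp]: "\<not> gen {} i j"
  using gen_dom nonempty_simplex by blast

lemma face_entry_empty [simp]: "face_entry I {} k l = 0"
  by (simp add: face_entry_def)

lemma face_entry_sub:
  assumes "sub J i I k" "sub J j I l"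
  shows "face_entry I J k l = cell_entry J i j"
proof -
  have *: "{(i', j'). gen J i' j' \<and> sub J i' I k \<and> sub J j' I l} = (if gen J i j then {(i, j)} else {})"
    using assms sub_unique_lower by (auto dest: sub_unique_lower)
  have "\<not> cusp J I k l"
    using cusp_not_sub assms by blast
  then show ?thesis
    unfolding face_entry_def cell_entry_def * by simp
qed

lemma face_entry_not_sub:
  assumes "\<not> is_sub J I k \<or> \<not> is_sub J I l"
  shows "face_entry I J k l = (if card J = 1 \<and> k < l \<and> cusp J I k l then 1 else 0)"
proof -
  have *: "{(i', j'). gen J i' j' \<and> sub J i' I k \<and> sub J j' I l} = {}"
    using assms by (auto simp: is_sub_def)
  show ?thesis
    unfolding face_entry_def * by simp
qed

lemma face_entry_eq_0_or_gen: "face_entry I J k l = 0 \<or> gen I k l"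
proof (cases "is_sub J I k \<and> is_sub J I l")
  case True
  then obtain i j where "sub J i I k" "sub J j I l"
    by (auto simp: is_sub_def)
  then show ?thesis
    using gen_sub[of J i j I k l] by (auto simp: face_entry_sub cell_entry_def)
next
  case False
  then show ?thesis
    using gen_cusp[of J I k l] by (auto simp: face_entry_not_sub)
qed

text \<open>Every non-zero face entry respects the strict height order, and that order is
  transitive, so products respect it too.\<close>

lemma curvature_eq_0_or_gen: "curvature I v k l = 0 \<or> gen I k l"
proof (cases "gen I k l")
  case False
  then have 1: "face_entry I J k l = 0" for J
    using face_entry_eq_0_or_gen by blast
  have 2: "face_entry I J k p * face_entry I J' p l = 0" for J J' p
    using False gen_trans[of I k p l] face_entry_eq_0_or_gen[of I J k p] face_entry_eq_0_or_gen[of I J' p l]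
    by auto
  show ?thesis
    by (simp add: curvature_def 1 2)
qed simp

lemma homogeneous_cell_entry: "cell_entry I i j \<in> homogeneous gens deg (pot I i - pot I j + int (card I) - 2)"
  using homogeneous_letter[of "(I, i, j)" gens deg] by (simp add: cell_entry_def gens_def deg_apply)

text \<open>For a constant 1 the Maslov jump contributes 1 and the vertex has cardinality 1, so the
  degree is 1 + 1 - 2 = 0, as it must be.\<close>

lemma homogeneous_face_entry: "face_entry I J k l \<in> homogeneous gens deg (pot I k - pot I l + int (card J) - 2)"
proof (cases "is_sub J I k \<and> is_sub J I l")
  case True
  then obtain i j where "sub J i I k" "sub J j I l"
    by (auto simp: is_sub_def)
  then show ?thesis
    using homogeneous_cell_entry[of J i j] by (simp add: face_entry_sub pot_sub)
next
  case False
  then show ?thesis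
    using pot_cusp[of J I k l] by (auto simp: face_entry_not_sub)
qed

lemma neg_one_power: "(- 1) ^ a = sign (int a)"
  by (simp add: sign_def)

text \<open>Omitting a vertex lowers the cardinality by one. In a product the two cardinalities add
  up to \<open>length v + 1\<close>, since a vertex is shared, and each factor subtracts 2; both
  cases give \<open>length v - 3\<close>.\<close>

lemma homogeneous_curvature:
  assumes "distinct v"
  shows "curvature I v k l \<in> homogeneous gens deg (pot I k - pot I l + int (length v) - 3)"
proof -
  have len: "int (card (set (omit_nth a v))) = int (length v) - 1" if "a < length v" for a
    using assms that by (simp add: card_set_omit_nth)
  have "face_entry I (set (omit_nth a v)) k l \<in> homogeneous gens deg (pot I k - pot I l + int (length v) - 3)"
    if "a < length v" for a
    using homogeneous_face_entry[of I "set (omit_nth a v)" k l] len[OF that] by (simp add: algebra_simps)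
  moreover have "face_entry I (set (take (Suc a) v)) k p * face_entry I (set (drop a v)) p l
      \<in> homogeneous gens deg (pot I k - pot I l + int (length v) - 3)" if "a < length v" for a p
    by (rule homogeneous_mult[OF homogeneous_face_entry homogeneous_face_entry])
      (use assms that in \<open>simp add: distinct_card\<close>)
  ultimately show ?thesis
    unfolding curvature_def neg_one_power
    by (intro homogeneous_add homogeneous_uminus homogeneous_sum homogeneous_sign_mult) auto
qed

text \<open>The sheet above \<open>e_H\<close> extends to one above \<open>e_J\<close> and from
  there to one above \<open>e_I\<close>; uniqueness of extensions identifies the latter with
  \<open>k\<close>.\<close>

lemma is_sub_face: "is_sub H I k \<Longrightarrow> H \<subseteq> J \<Longrightarrow> J \<subseteq> I \<Longrightarrow> \<exists>i a. sub J i I k \<and> sub H a J i"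
proof -
  assume "is_sub H I k" and HJ: "H \<subseteq> J" and JI: "J \<subseteq> I"
  then obtain a where a: "sub H a I k"
    by (auto simp: is_sub_def)
  then have "I \<in> K" "H \<noteq> {}" "a < N H"
    using sub_dom by blast+
  then obtain i where i: "sub H a J i"
    using sub_ex[of J H a] face_simplex[of I J] HJ JI by blast
  moreover obtain k' where k': "sub J i I k'"
    using sub_ex[of I J i] \<open>I \<in> K\<close> JI sub_dom[OF i] HJ by blast
  ultimately show ?thesis
    using sub_trans sub_unique_upper a by blast
qed

text \<open>Closures compose, so \<open>M_J(e_H)\<close> is the submatrix of \<open>M_I(e_H)\<close>
  on the sheets above \<open>e_J\<close>. The delicate point is the condition \<open>k < l\<close>
  on cusp entries.\<close>

lemma face_entry_restrict:
  assumes i: "sub J i I k" and j: "sub J j I l" and "H \<subseteq> J"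
  shows "face_entry J H i j = face_entry I H k l"
proof (cases "is_sub H J i \<and> is_sub H J j")
  case True
  then obtain a b where "sub H a J i" "sub H b J j"
    by (auto simp: is_sub_def)
  then show ?thesis
    using sub_trans i j by (metis face_entry_sub)
next
  case False
  have JI: "J \<subseteq> I"
    using sub_dom[OF i] by blast
  have "is_sub H J i" if "is_sub H I k" "sub J i I k" for i k
    using is_sub_face[OF that(1) \<open>H \<subseteq> J\<close> JI] that(2) sub_unique_lower unfolding is_sub_def by metis
  with False i j have "\<not> is_sub H I k \<or> \<not> is_sub H I l"
    by blast
  \<comment> \<open>The two orderings need not agree on sheets of equal height, but a cusp pair is
    strictly separated and strict height order passes from \<open>J\<close> to
    \<open>I\<close>.\<close>
  moreover have "i < j \<longleftrightarrow> k < l" if "cusp H J i j" "cusp H I k l"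
  proof
    assume "i < j"
    then show "k < l"
      using gen_cusp that gen_sub i j gen_dom by metis
  next
    assume "k < l"
    then have "i \<noteq> j"
      using sub_unique_upper i j by blast
    moreover have False if "j < i"
      using gen_cusp[OF cusp_sym[OF \<open>cusp H J i j\<close>] that] gen_sub[OF _ j i] gen_dom \<open>k < l\<close>
      by fastforce
    ultimately show "i < j"
      by fastforce
  qed
  ultimately show ?thesis
    using False cusp_sub[OF i j \<open>H \<subseteq> J\<close>] by (auto simp: face_entry_not_sub)
qed

text \<open>An index that ends at a cusp above \<open>e_J\<close> keeps its partner above every face
  of \<open>e_J\<close>, so the entry is the same for all vertices \<open>H\<close> of
  \<open>J\<close>. If it is \<open>l\<close> rather than \<open>k\<close> that ends there, symmetry
  of \<open>cusp\<close> is used.\<close>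

lemma face_entry_not_sub_coface:
  assumes "\<not> is_sub J I k \<or> \<not> is_sub J I l" "H \<subseteq> J" "J \<subseteq> I"
  shows "face_entry I H k l = (if card H = 1 \<and> k < l \<and> cusp J I k l then 1 else 0)"
proof -
  have "\<not> is_sub H I k \<or> \<not> is_sub H I l"
    using assms is_sub_face[of H I _ J] unfolding is_sub_def by blast
  moreover have "cusp H I k l \<longleftrightarrow> cusp J I k l" if "card H = 1"
  proof
    have "H \<noteq> {}"
      using that by auto
    then show "cusp J I k l \<Longrightarrow> cusp H I k l"
      using cusp_face assms by blast
    show "cusp J I k l" if "cusp H I k l"
      using assms that cusp_coface[of H I k l J] cusp_coface[of H I l k J] cusp_sym
      unfolding is_sub_def by blast
  qed
  ultimately show ?thesis
    by (auto simp: face_entry_not_sub)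
qed

text \<open>An index \<open>p\<close> that does not come from a sheet above \<open>e_J\<close>
  contributes nothing: a non-zero entry at \<open>(k, p)\<close> would make \<open>k\<close> its
  cusp partner above \<open>e_J\<close>, but \<open>k\<close> continues to a sheet there.\<close>

lemma sum_restrict:
  assumes k: "sub J i I k" and l: "sub J j I l" and "H \<subseteq> J" "H' \<subseteq> J"
  shows "(\<Sum>p<N J. face_entry J H i p * face_entry J H' p j) =
      (\<Sum>p<N I. face_entry I H k p * face_entry I H' p l)"
proof -
  have dom: "I \<in> K" "J \<subseteq> I" "J \<noteq> {}"
    using sub_dom[OF k] by auto
  then obtain \<phi> where \<phi>: "sub J p I (\<phi> p)" if "p < N J" for p
    using sub_ex by metis
  have "inj_on \<phi> {..<N J}"
    using \<phi> sub_unique_lower by (metis inj_onI lessThan_iff)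
  have "(\<Sum>p<N J. face_entry J H i p * face_entry J H' p j) =
      (\<Sum>p<N J. face_entry I H k (\<phi> p) * face_entry I H' (\<phi> p) l)"
    using face_entry_restrict[OF k \<phi> \<open>H \<subseteq> J\<close>] face_entry_restrict[OF \<phi> l \<open>H' \<subseteq> J\<close>]
    by (intro sum.cong) auto
  also have "\<dots> = (\<Sum>p\<in>\<phi> ` {..<N J}. face_entry I H k p * face_entry I H' p l)"
    using \<open>inj_on \<phi> {..<N J}\<close> by (simp add: sum.reindex)
  also have "\<dots> = (\<Sum>p<N I. face_entry I H k p * face_entry I H' p l)"
  proof (rule sum.mono_neutral_left)
    show "\<phi> ` {..<N J} \<subseteq> {..<N I}"
      using \<phi> sub_dom by blast
    show "\<forall>p\<in>{..<N I} - \<phi> ` {..<N J}. face_entry I H k p * face_entry I H' p l = 0"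
    proof
      fix p assume p: "p \<in> {..<N I} - \<phi> ` {..<N J}"
      then have "\<not> is_sub J I p"
        using \<phi> sub_dom sub_unique_upper unfolding is_sub_def by (metis Diff_iff imageI lessThan_iff)
      then have "face_entry I H k p = 0"
        using face_entry_not_sub_coface[of J I k p H] \<open>H \<subseteq> J\<close> dom cusp_not_sub k by auto
      then show "face_entry I H k p * face_entry I H' p l = 0"
        by simp
    qed
  qed simp
  finally show ?thesis .
qed

lemma curvature_restrict:
  assumes "sub J i I k" "sub J j I l" "set v \<subseteq> J"
  shows "curvature J v i j = curvature I v k l"
proof -
  have "set (omit_nth a v) \<subseteq> J" "set (take (Suc a) v) \<subseteq> J" "set (drop a v) \<subseteq> J" for a
    using assms(3) set_take_subset[of _ v] set_drop_subset[of _ v] set_omit_nth_subset[of a v] by force+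
  then show ?thesis
    by (simp add: curvature_def sum_restrict[OF assms(1,2)] face_entry_restrict[OF assms(1,2)])
qed

text \<open>Flatness of the constant block: this makes the derivative of the constant entries,
  namely 0, consistent with the curvature formula.\<close>

lemma curvature_not_sub:
  assumes not_sub: "\<not> is_sub J I k \<or> \<not> is_sub J I l" and "set v \<subseteq> J" "J \<subseteq> I" "distinct v"
  shows "curvature I v k l = 0"
proof -
  have sets: "set (omit_nth a v) \<subseteq> J" "set (take (Suc a) v) \<subseteq> J" "set (drop a v) \<subseteq> J" for a
    using assms(2) set_take_subset[of _ v] set_drop_subset[of _ v] set_omit_nth_subset[of a v] by force+
  have card: "card (set (omit_nth a v)) = length v - 1" if "a < length v" for a
    using assms that by (simp add: card_set_omit_nth)
  \<comment> \<open>Omitting one vertex of \<open>v\<close> leaves a single vertex only if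
    \<open>length v = 2\<close>; then both faces contribute the same constant with opposite
    signs.\<close>
  let ?c = "if length v = 2 \<and> k < l \<and> cusp J I k l then 1 else 0 :: generator free_alg"
  have "(\<Sum>a<length v. (- 1) ^ a * face_entry I (set (omit_nth a v)) k l) = (\<Sum>a<length v. (- 1) ^ a * ?c)"
    using face_entry_not_sub_coface[OF not_sub sets(1) \<open>J \<subseteq> I\<close>] card by (intro sum.cong) auto
  also have "\<dots> = 0"
    by (auto simp: numeral_2_eq_2)
  finally have 1: "(\<Sum>a<length v. (- 1) ^ a * face_entry I (set (omit_nth a v)) k l) = 0" .
  \<comment> \<open>An outer index that ends at a cusp above \<open>e_J\<close> forces
    \<open>p\<close> to be its partner, which ends there as well; so the other factor is constant
    too. Then \<open>k\<close> and \<open>l\<close> are both partners of \<open>p\<close>, against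
    \<open>k < p < l\<close>.\<close>
  have 2: "face_entry I H k p * face_entry I H' p l = 0" if "H \<subseteq> J" "H' \<subseteq> J" for H H' p
  proof (rule ccontr)
    assume "\<not> ?thesis"
    then have nz: "face_entry I H k p \<noteq> 0" "face_entry I H' p l \<noteq> 0"
      by auto
    have not_sub_partner: "\<not> is_sub J I b" if "cusp J I a b" for a b
      using that cusp_sym cusp_not_sub unfolding is_sub_def by blast
    note left = face_entry_not_sub_coface[OF _ \<open>H \<subseteq> J\<close> \<open>J \<subseteq> I\<close>, of k p]
      and right = face_entry_not_sub_coface[OF _ \<open>H' \<subseteq> J\<close> \<open>J \<subseteq> I\<close>, of p l]
    have "k < p \<and> cusp J I k p \<and> p < l \<and> cusp J I p l"
      using not_sub
    proof
      assume "\<not> is_sub J I k"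
      then have "k < p \<and> cusp J I k p"
        using left nz(1) by (auto split: if_splits)
      then show ?thesis
        using not_sub_partner right nz(2) by (auto split: if_splits)
    next
      assume "\<not> is_sub J I l"
      then have "p < l \<and> cusp J I p l"
        using right nz(2) by (auto split: if_splits)
      then show ?thesis
        using not_sub_partner[OF cusp_sym] left nz(1) by (auto split: if_splits)
    qed
    then show False
      using cusp_sym[of J I k p] cusp_unique[of J I p k l] by simp
  qed
  show ?thesis
    by (simp add: curvature_def 1 2[OF sets(2,3)])
qed

end

locale sheet_differential = sheet_combinatorics +
  fixes d
  assumes graded_derivation: "graded_derivation gens deg d"
    and d_cell_entry: "I \<in> K \<Longrightarrow> i < N I \<Longrightarrow> j < N I \<Longrightarrow> d (cell_entry I i j) = boundary_entry I i j"

sublocale sheet_differential \<subseteq> graded_derivation_on gens deg d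
  by standard (rule graded_derivation)

context sheet_differential
begin

lemmas face_entry_in [simp] = homogeneous_in_free_algebra[OF homogeneous_face_entry]

text \<open>Positions coming from sheets above the face reduce to the prescribed value on that
  smaller cell; elsewhere the entry is constant and the curvature vanishes. The sign may be read off
  row \<open>k\<close> because a sheet and its sheet faces have the same potential.\<close>

lemma d_face_entry:
  assumes I: "I \<in> K" and J: "set v \<subseteq> I" and kl: "k < N I" "l < N I"
    and v: "sorted v" "distinct v"
  shows "d (face_entry I (set v) k l) = sign (pot I k) * curvature I v k l"
proof (cases "v = []")
  case True
  then show ?thesis by (simp add: curvature_def)
next
  case False
  show ?thesis
  proof (cases "is_sub (set v) I k \<and> is_sub (set v) I l")
    case True
    then obtain i j where ij: "sub (set v) i I k" "sub (set v) j I l"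
      by (auto simp: is_sub_def)
    have "set v \<in> K"
      using face_simplex I J False by auto
    then have "d (cell_entry (set v) i j) = boundary_entry (set v) i j"
      using d_cell_entry sub_dom ij by blast
    also have "sorted_list_of_set (set v) = v"
      using v by (simp add: sorted_list_of_set_sort_remdups distinct_remdups_id sort_key_id_if_sorted)
    then have "boundary_entry (set v) i j = sign (pot I k) * curvature I v k l"
      using curvature_restrict[OF ij, of v] by (simp add: boundary_entry_def pot_sub[OF ij(1)])
    finally show ?thesis
      by (simp add: face_entry_sub[OF ij])
  next
    case not_sub: False
    then have "curvature I v k l = 0"
      using curvature_not_sub[of "set v" I k l v] J v by auto
    moreover have "d (face_entry I (set v) k l) = 0"
      using not_sub face_entry_not_sub[of "set v" I k l] by auto
    ultimately show ?thesis by simp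
  qed
qed

lemma d_curvature:
  assumes I: "I \<in> K" and J: "set v \<subseteq> I" and kl: "k < N I" "l < N I"
    and v: "sorted v" "distinct v"
  shows "d (curvature I v k l) = 0"
proof -
  let ?M = "\<lambda>w. face_entry I (set w)" and ?D = "curvature I"
  have omit: "d (?M (omit_nth a v) k l) = sign (pot I k) * ?D (omit_nth a v) k l" for a
  proof (rule d_face_entry[OF I _ kl])
    show "set (omit_nth a v) \<subseteq> I" "sorted (omit_nth a v)" "distinct (omit_nth a v)"
      using J v set_omit_nth_subset[of a v] by (auto simp: sorted_omit_nth distinct_omit_nth)
  qed
  have take: "d (?M (take b v) k p) = sign (pot I k) * ?D (take b v) k p"
    and drop: "d (?M (drop b v) p l) = sign (pot I p) * ?D (drop b v) p l" if "p < N I" for b p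
    using J set_take_subset[of b v] set_drop_subset[of b v] v that kl
    by (intro d_face_entry[OF I]; force simp: sorted_wrt_take sorted_wrt_drop)+
  \<comment> \<open>The first factor has degree \<open>pot I k - pot I p + a - 1\<close>. Its sign
    times \<open>sign (pot I p)\<close>, coming from the derivative of the second factor, is
    \<open>- sign (pot I k) * (-1)^a\<close>, independent of \<open>p\<close>.\<close>
  have prod: "d (?M (take (Suc a) v) k p * ?M (drop a v) p l) =
      sign (pot I k) * (?D (take (Suc a) v) k p * ?M (drop a v) p l
        - sign (int a) * (?M (take (Suc a) v) k p * ?D (drop a v) p l))"
    if "a < length v" "p < N I" for a p
  proof -
    have "card (set (take (Suc a) v)) = Suc a"
      using that v by (simp add: distinct_card)
    then have "d (?M (take (Suc a) v) k p * ?M (drop a v) p l) =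
        d (?M (take (Suc a) v) k p) * ?M (drop a v) p l
        + sign (pot I k - pot I p + int a - 1) * ?M (take (Suc a) v) k p * d (?M (drop a v) p l)"
      using d_mult[OF homogeneous_face_entry[of I "set (take (Suc a) v)" k p] face_entry_in[of I "set (drop a v)" p l]]
      by (simp add: algebra_simps)
    then show ?thesis
      unfolding take[OF that(2)] drop[OF that(2)]
      by (auto simp: sign_def algebra_simps)
  qed
  have "d (curvature I v k l) =
      - (\<Sum>a<length v. sign (int a) * d (?M (omit_nth a v) k l))
      + (\<Sum>a<length v. sign (int a) * (\<Sum>p<N I. d (?M (take (Suc a) v) k p * ?M (drop a v) p l)))"
    unfolding curvature_def neg_one_power
    by (simp add: d_add d_diff d_uminus d_sum d_sign_mult free_algebra_sum free_algebra_uminus free_algebra_mult)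
  also have "\<dots> = sign (pot I k) *
     (- (\<Sum>a<length v. (- 1) ^ a * ?D (omit_nth a v) k l)
      + (\<Sum>a<length v. (- 1) ^ a * (\<Sum>p<N I. ?D (take (Suc a) v) k p * ?M (drop a v) p l))
      - (\<Sum>a<length v. \<Sum>p<N I. ?M (take (Suc a) v) k p * ?D (drop a v) p l))"
  proof -
    have "(\<Sum>a<length v. sign (int a) * (\<Sum>p<N I. d (?M (take (Suc a) v) k p * ?M (drop a v) p l))) =
      (\<Sum>a<length v. sign (int a) * (\<Sum>p<N I. sign (pot I k) * (?D (take (Suc a) v) k p * ?M (drop a v) p l
        - sign (int a) * (?M (take (Suc a) v) k p * ?D (drop a v) p l))))"
      by (simp add: prod)
    also have "\<dots> = (\<Sum>a<length v. sign (pot I k) *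
         (sign (int a) * (\<Sum>p<N I. ?D (take (Suc a) v) k p * ?M (drop a v) p l)
          - (\<Sum>p<N I. ?M (take (Suc a) v) k p * ?D (drop a v) p l)))"
      by (intro sum.cong refl)
        (auto simp: sign_def sum_distrib_left sum_subtractf sum_negf sum.distrib)
    finally show ?thesis
      unfolding omit neg_one_power
      by (simp add: sum_distrib_left sum_subtractf right_diff_distrib sign_left_commute)
  qed
  also have "- (\<Sum>a<length v. (- 1) ^ a * ?D (omit_nth a v) k l)
      + (\<Sum>a<length v. (- 1) ^ a * (\<Sum>p<N I. ?D (take (Suc a) v) k p * ?M (drop a v) p l))
      - (\<Sum>a<length v. \<Sum>p<N I. ?M (take (Suc a) v) k p * ?D (drop a v) p l) = 0"
    unfolding curvature_def by (rule bianchi_entries[where M = ?M]) simp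
  finally show ?thesis by simp
qed

lemma d_d: "x \<in> free_algebra gens \<Longrightarrow> d (d x) = 0"
proof (erule d_d_eq_0[rotated])
  fix g assume "g \<in> gens"
  then obtain I i j where g: "g = (I, i, j)" "gen I i j"
    by (auto simp: gens_def)
  then have dom: "I \<in> K" "i < N I" "j < N I"
    using gen_dom by force+
  have "d (letter g) = sign (pot I i) * curvature I (sorted_list_of_set I) i j"
    using d_cell_entry[OF dom] g by (simp add: cell_entry_def boundary_entry_def)
  moreover have "curvature I (sorted_list_of_set I) i j \<in> free_algebra gens"
    by (rule homogeneous_in_free_algebra[OF homogeneous_curvature]) simp
  moreover have "d (curvature I (sorted_list_of_set I) i j) = 0"
    using d_curvature[OF dom(1) _ dom(2,3)] finite_simplex[OF dom(1)] by simp
  ultimately show "d (d (letter g)) = 0"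
    by (simp add: d_sign_mult)
qed

end

context sheet_combinatorics
begin

lemma ex1_sheet_differential:
  "\<exists>!d. graded_derivation gens deg d \<and>
     (\<forall>I\<in>K. \<forall>i<N I. \<forall>j<N I. d (cell_entry I i j) = boundary_entry I i j)"
proof -
  define \<delta> where "\<delta> = (\<lambda>(I, i, j). boundary_entry I i j)"
  have "\<delta> g \<in> homogeneous gens deg (deg g - 1)" if "g \<in> gens" for g
  proof -
    obtain I i j where g: "g = (I, i, j)"
      by (cases g)
    then have "finite I"
      using that gen_dom finite_simplex by (auto simp: gens_def)
    then have "boundary_entry I i j \<in> homogeneous gens deg (pot I i - pot I j + int (card I) - 3)"
      using homogeneous_curvature[of "sorted_list_of_set I" I i j] by (simp add: boundary_entry_def)
    moreover have "deg g - 1 = pot I i - pot I j + int (card I) - 3"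
      by (simp add: g deg_apply)
    ultimately show ?thesis
      by (simp only: g \<delta>_def case_prod_conv)
  qed
  then obtain d where d: "graded_derivation gens deg d" "\<And>g. g \<in> gens \<Longrightarrow> d (letter g) = \<delta> g"
    using ex_graded_derivation[of gens \<delta> deg] by blast
  interpret d: graded_derivation_on gens deg d
    by standard fact
  show ?thesis
  proof (rule ex1I[of _ d])
    \<comment> \<open>Where no generator exists the equation reads
      \<open>d 0 = boundary_entry I i j\<close>, and the right-hand side vanishes by
      \<open>curvature_eq_0_or_gen\<close>.\<close>
    have "d (cell_entry I i j) = boundary_entry I i j" for I i j
      using d(2)[of "(I, i, j)"] curvature_eq_0_or_gen[of I "sorted_list_of_set I" i j]
      by (auto simp: cell_entry_def boundary_entry_def gens_def \<delta>_def)
    then show "graded_derivation gens deg d \<and>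
        (\<forall>I\<in>K. \<forall>i<N I. \<forall>j<N I. d (cell_entry I i j) = boundary_entry I i j)"
      using d(1) by blast
    fix d' assume d': "graded_derivation gens deg d' \<and>
        (\<forall>I\<in>K. \<forall>i<N I. \<forall>j<N I. d' (cell_entry I i j) = boundary_entry I i j)"
    show "d' = d"
    proof (rule graded_derivation_unique)
      fix g assume "g \<in> gens"
      then obtain I i j where g: "g = (I, i, j)" "gen I i j"
        by (auto simp: gens_def)
      then have "I \<in> K" "i < N I" "j < N I"
        using gen_dom by force+
      then have "d' (cell_entry I i j) = boundary_entry I i j"
        using d' by blast
      then show "d' (letter g) = d (letter g)"
        using d(2)[OF \<open>g \<in> gens\<close>] g by (simp add: \<delta>_def cell_entry_def)
    qed (use d' d in auto)
  qed
qed

end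

section \<open>The 1-jet space and simplices\<close>

lemma openin_jet_topology_basis:
  assumes "c \<in> A" "open W"
  shows "openin (jet_topology A) {q \<in> J1 A. base q \<in> fst c \<and> snd (jet_chart A c) q \<in> W}"
proof -
  have "{q \<in> J1 A. base q \<in> fst c \<and> snd (jet_chart A c) q \<in> W}
      = fst (jet_chart A c) \<inter> snd (jet_chart A c) -` W"
    by (auto simp: jet_chart_def)
  then show ?thesis
    unfolding jet_topology_def by (intro topology_generated_by_Basis) (use assms in blast)
qed

lemma base_in_chart: "q \<in> J1 A \<Longrightarrow> \<exists>c\<in>A. base q \<in> fst c"
  by (simp add: J1_def base_def case_prod_unfold)

lemma topspace_jet_topology [simp]: "topspace (jet_topology A) = J1 A"
proof
  show "topspace (jet_topology A) \<subseteq> J1 A"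
    by (auto simp: jet_topology_def jet_chart_def)
  show "J1 A \<subseteq> topspace (jet_topology A)"
  proof
    fix q assume "q \<in> J1 A"
    then obtain c where c: "c \<in> A" "base q \<in> fst c"
      using base_in_chart by blast
    then show "q \<in> topspace (jet_topology A)"
      using openin_subset[OF openin_jet_topology_basis[OF c(1) open_UNIV]] \<open>q \<in> J1 A\<close> by blast
  qed
qed

lemma openin_jet_topologyI:
  assumes "\<And>q. q \<in> U \<Longrightarrow> \<exists>c\<in>A. \<exists>W. open W \<and> q \<in> J1 A \<and> base q \<in> fst c \<and> snd (jet_chart A c) q \<in> W \<and>
     (\<forall>q'\<in>J1 A. base q' \<in> fst c \<longrightarrow> snd (jet_chart A c) q' \<in> W \<longrightarrow> q' \<in> U)"
  shows "openin (jet_topology A) U"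
proof (subst openin_subopen, intro ballI)
  fix q assume "q \<in> U"
  then obtain c W where cW: "c \<in> A" "open W" "q \<in> J1 A" "base q \<in> fst c" "snd (jet_chart A c) q \<in> W"
     "\<forall>q'\<in>J1 A. base q' \<in> fst c \<longrightarrow> snd (jet_chart A c) q' \<in> W \<longrightarrow> q' \<in> U"
    using assms by blast
  then show "\<exists>V. openin (jet_topology A) V \<and> q \<in> V \<and> V \<subseteq> U"
    by (intro exI[of _ "{q \<in> J1 A. base q \<in> fst c \<and> snd (jet_chart A c) q \<in> W}"])
      (auto intro: openin_jet_topology_basis)
qed

lemma snd_jet_chart: "snd (jet_chart A c) q = (snd c (base q), fst (snd q) c, zcoord q)"
  by (simp add: jet_chart_def base_def zcoord_def case_prod_unfold)

lemma continuous_map_zcoord: "continuous_map (jet_topology A) euclideanreal zcoord"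
  unfolding continuous_map_def
proof (intro conjI allI impI)
  fix V :: "real set" assume "openin euclideanreal V"
  then have "open V" by simp
  show "openin (jet_topology A) {q \<in> topspace (jet_topology A). zcoord q \<in> V}"
  proof (rule openin_jet_topologyI)
    fix q assume q: "q \<in> {q \<in> topspace (jet_topology A). zcoord q \<in> V}"
    then have "q \<in> J1 A" by simp
    then obtain c where "c \<in> A" "base q \<in> fst c"
      using base_in_chart by blast
    then show "\<exists>c\<in>A. \<exists>W. open W \<and> q \<in> J1 A \<and> base q \<in> fst c \<and> snd (jet_chart A c) q \<in> W \<and>
        (\<forall>q'\<in>J1 A. base q' \<in> fst c \<longrightarrow> snd (jet_chart A c) q' \<in> W \<longrightarrow>
           q' \<in> {q \<in> topspace (jet_topology A). zcoord q \<in> V})"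
      using q \<open>open V\<close>
      by (intro bexI[of _ c] exI[of _ "UNIV \<times> UNIV \<times> V"]) (auto simp: snd_jet_chart open_Times)
  qed
qed auto

lemma continuous_map_base:
  assumes "smooth_manifold X A"
  shows "continuous_map (jet_topology A) X base"
  unfolding continuous_map_def
proof (intro conjI allI impI)
  have charts: "is_chart X c" if "c \<in> A" for c
    using assms that by (auto simp: smooth_manifold_def)
  have cover: "(\<Union>c\<in>A. fst c) = topspace X"
    using assms by (auto simp: smooth_manifold_def)
  then show "base \<in> topspace (jet_topology A) \<rightarrow> topspace X"
    using base_in_chart by fastforce
  fix U assume "openin X U"
  show "openin (jet_topology A) {q \<in> topspace (jet_topology A). base q \<in> U}"
  proof (rule openin_jet_topologyI)
    fix q assume q: "q \<in> {q \<in> topspace (jet_topology A). base q \<in> U}"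
    then have "q \<in> J1 A" by simp
    then obtain c where c: "c \<in> A" "base q \<in> fst c"
      using base_in_chart by blast
    have op: "open (snd c ` fst c)" "openin X (fst c)"
      and hm: "homeomorphic_map (subtopology X (fst c)) (top_of_set (snd c ` fst c)) (snd c)"
      using charts[OF c(1)] by (auto simp: is_chart_def)
    have "inj_on (snd c) (fst c)"
      using homeomorphic_imp_injective_map[OF hm] openin_subset[OF op(2)] by (simp add: Int_absorb1)
    have "openin (top_of_set (snd c ` fst c)) (snd c ` (fst c \<inter> U))"
      using homeomorphic_imp_open_map[OF hm] \<open>openin X U\<close>
      by (simp add: open_map_def openin_subtopology_Int2)
    then have "open (snd c ` (fst c \<inter> U))"
      using op(1) openin_open_trans by blast
    then show "\<exists>c\<in>A. \<exists>W. open W \<and> q \<in> J1 A \<and> base q \<in> fst c \<and> snd (jet_chart A c) q \<in> W \<and>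
        (\<forall>q'\<in>J1 A. base q' \<in> fst c \<longrightarrow> snd (jet_chart A c) q' \<in> W \<longrightarrow>
           q' \<in> {q \<in> topspace (jet_topology A). base q \<in> U})"
      using q c \<open>inj_on (snd c) (fst c)\<close>
      by (intro bexI[of _ c] exI[of _ "snd c ` (fst c \<inter> U) \<times> UNIV"])
        (auto simp: snd_jet_chart open_Times inj_on_def)
  qed
qed

text \<open>A covector is determined by its components in a single chart.\<close>

lemma jet_eqI:
  assumes "q \<in> J1 A" "q' \<in> J1 A" "base q = base q'" "c \<in> A" "base q \<in> fst c"
    and "snd (jet_chart A c) q = snd (jet_chart A c) q'"
  shows "q = q'"
proof -
  obtain p \<xi> z where q: "q = (p, \<xi>, z)" by (cases q)
  obtain p' \<xi>' z' where q': "q' = (p', \<xi>', z')" by (cases q')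
  have eq: "p' = p" "\<xi>' c = \<xi> c" "z' = z" "p \<in> fst c"
    using assms by (auto simp: q q' snd_jet_chart base_def zcoord_def)
  have cov: "covector A p \<xi>" "covector A p \<xi>'"
    using assms eq by (auto simp: J1_def q q')
  have "\<xi> c' = \<xi>' c'" for c'
  proof (cases "c' \<in> A \<and> p \<in> fst c'")
    case True
    have transform: "inner (\<zeta> c') v = inner (\<zeta> c) (frechet_derivative (transition c' c) (at (snd c' p)) v)"
      if "covector A p \<zeta>" for \<zeta> v
      using that True eq(4) assms(4) unfolding covector_def by blast
    have "inner (\<xi> c') v = inner (\<xi>' c') v" for v
      using transform[OF cov(1), of v] transform[OF cov(2), of v] eq(2) by simp
    then show ?thesis
      using vector_eq_rdot by blast
  next
    case False
    have zero: "\<zeta> c' = 0" if "covector A p \<zeta>" for \<zeta>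
      using that False unfolding covector_def by blast
    show ?thesis
      using zero[OF cov(1)] zero[OF cov(2)] by simp
  qed
  then show ?thesis
    using eq by (auto simp: q q')
qed

text \<open>Points over one base point lie in a common chart, whose coordinates determine the whole
  covector and hence separate them; points over different base points are separated by preimages of
  open sets of \<open>X\<close>.\<close>

lemma Hausdorff_jet_topology:
  assumes "smooth_manifold X A"
  shows "Hausdorff_space (jet_topology A)"
  unfolding Hausdorff_space_def
proof (intro allI impI)
  fix q q' assume qq: "q \<in> topspace (jet_topology A) \<and> q' \<in> topspace (jet_topology A) \<and> q \<noteq> q'"
  show "\<exists>U V. openin (jet_topology A) U \<and> openin (jet_topology A) V \<and> q \<in> U \<and> q' \<in> V \<and> disjnt U V"
  proof (cases "base q = base q'")
    case True
    have in_J1: "q \<in> J1 A" "q' \<in> J1 A"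
      using qq by simp_all
    then obtain c where c: "c \<in> A" "base q \<in> fst c"
      using base_in_chart by blast
    then have neq: "snd (jet_chart A c) q \<noteq> snd (jet_chart A c) q'"
      using jet_eqI[OF in_J1 True] qq by blast
    obtain U V where UV: "open U" "open V" "snd (jet_chart A c) q \<in> U" "snd (jet_chart A c) q' \<in> V" "U \<inter> V = {}"
      using hausdorff[OF neq] by blast
    then show ?thesis
      using openin_jet_topology_basis[OF c(1) UV(1)] openin_jet_topology_basis[OF c(1) UV(2)] c in_J1 True
      by (intro exI[of _ "{r \<in> J1 A. base r \<in> fst c \<and> snd (jet_chart A c) r \<in> U}"]
          exI[of _ "{r \<in> J1 A. base r \<in> fst c \<and> snd (jet_chart A c) r \<in> V}"])
        (auto simp del: split_paired_All split_paired_Ex simp: disjnt_iff)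
  next
    case False
    have cont: "continuous_map (jet_topology A) X base"
      by (rule continuous_map_base) fact
    have "Hausdorff_space X"
      using assms by (simp add: smooth_manifold_def)
    moreover have "base q \<in> topspace X" "base q' \<in> topspace X"
      using cont qq by (auto simp: continuous_map_def)
    ultimately obtain U V where UV: "openin X U" "openin X V" "base q \<in> U" "base q' \<in> V" "disjnt U V"
      using False unfolding Hausdorff_space_def by blast
    then show ?thesis
      using openin_continuous_map_preimage[OF cont UV(1)] openin_continuous_map_preimage[OF cont UV(2)] qq
      by (intro exI[of _ "{r \<in> topspace (jet_topology A). base r \<in> U}"]
          exI[of _ "{r \<in> topspace (jet_topology A). base r \<in> V}"])
        (simp add: disjnt_iff)
  qed
qed

section \<open>Open and closed simplices in barycentric coordinates\<close>

lemma open_simplex_subset_closed: "open_simplex I \<subseteq> closed_simplex I"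
  by (auto simp: open_simplex_def closed_simplex_def less_imp_le)

lemma compact_closed_simplex:
  assumes "finite I"
  shows "compact (closed_simplex I)"
proof -
  have cont: "continuous_on UNIV (\<lambda>b :: nat \<Rightarrow> real. sum b I)"
    by (intro continuous_intros continuous_on_product_coordinates)
  have "compact (PiE UNIV (\<lambda>i. if i \<in> I then {0..1::real} else {0}))"
    using compactin_PiE[of "\<lambda>i. euclideanreal" UNIV "\<lambda>i. if i \<in> I then {0..1::real} else {0}"]
    by (simp add: euclidean_product_topology)
  moreover have "closed {b :: nat \<Rightarrow> real. sum b I = 1}"
    using cont by (intro closed_Collect_eq) auto
  moreover have "b i \<le> 1" if "\<forall>i\<in>I. b i \<ge> 0" "sum b I = 1" "i \<in> I" for b :: "nat \<Rightarrow> real" and i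
    using member_le_sum[of i I b] that assms by auto
  then have "closed_simplex I = PiE UNIV (\<lambda>i. if i \<in> I then {0..1} else {0}) \<inter> {b. sum b I = 1}"
    by (fastforce simp: closed_simplex_def PiE_iff split: if_splits)
  ultimately show ?thesis
    by (simp add: compact_Int_closed)
qed

lemma continuous_on_segment:
  "continuous_on S (\<lambda>t i. (1 - t) * (b :: nat \<Rightarrow> real) i + t * b' i)"
  by (intro continuous_on_coordinatewise_then_product continuous_intros)

lemma segment_in_open_simplex:
  assumes "b \<in> closed_simplex I" "b' \<in> open_simplex I" "0 < t" "t \<le> 1"
  shows "(\<lambda>i. (1 - t) * b i + t * b' i) \<in> open_simplex I"
proof -
  have "(\<Sum>i\<in>I. (1 - t) * b i + t * b' i) = 1"
    using assms by (simp add: sum.distrib sum_distrib_left[symmetric] closed_simplex_def open_simplex_def)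
  then show ?thesis
    using assms by (auto simp: closed_simplex_def open_simplex_def intro!: add_nonneg_pos)
qed

lemma segment_in_open_simplex':
  "b \<in> open_simplex I \<Longrightarrow> b' \<in> open_simplex I \<Longrightarrow> 0 \<le> t \<Longrightarrow> t \<le> 1 \<Longrightarrow>
     (\<lambda>i. (1 - t) * b i + t * b' i) \<in> open_simplex I"
  using segment_in_open_simplex[of b I b' t] open_simplex_subset_closed[of I] by (cases "t = 0") auto

lemma connected_if_segments:
  fixes S :: "(nat \<Rightarrow> real) set"
  assumes "\<And>x y t. x \<in> S \<Longrightarrow> y \<in> S \<Longrightarrow> 0 \<le> t \<Longrightarrow> t \<le> 1 \<Longrightarrow> (\<lambda>i. (1 - t) * x i + t * y i) \<in> S"
  shows "connected S"
proof (rule path_connected_imp_connected, unfold path_connected_def, intro ballI)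
  fix x y assume "x \<in> S" "y \<in> S"
  then show "\<exists>g. path g \<and> path_image g \<subseteq> S \<and> pathstart g = x \<and> pathfinish g = y"
    using assms by (intro exI[of _ "\<lambda>t i. (1 - t) * x i + t * y i"])
      (auto simp: path_def path_image_def pathstart_def pathfinish_def intro: continuous_on_segment)
qed

lemma open_simplex_nonempty: "finite I \<Longrightarrow> I \<noteq> {} \<Longrightarrow> open_simplex I \<noteq> {}"
proof -
  assume "finite I" "I \<noteq> {}"
  then have "(\<lambda>i. if i \<in> I then 1 / real (card I) else 0) \<in> open_simplex I"
    by (auto simp: open_simplex_def card_gt_0_iff)
  then show ?thesis by blast
qed

text \<open>A segment from \<open>b\<close> to an interior point lies in the open simplex for
  \<open>t > 0\<close>; let \<open>t\<close> tend to 0.\<close>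

lemma closed_simplex_subset_closure:
  assumes "finite I" "I \<noteq> {}"
  shows "closed_simplex I \<subseteq> closure (open_simplex I)"
proof
  fix b assume b: "b \<in> closed_simplex I"
  obtain b' where b': "b' \<in> open_simplex I"
    using open_simplex_nonempty assms by blast
  let ?g = "\<lambda>t i. (1 - t) * b i + t * b' i"
  have "?g ` closure {0<..1::real} \<subseteq> closure (open_simplex I)"
    by (rule image_closure_subset)
      (use segment_in_open_simplex[OF b b'] in \<open>auto intro: continuous_on_segment subsetD[OF closure_subset]\<close>)
  moreover have "0 \<in> closure {0<..1::real}"
    by simp
  ultimately have "?g 0 \<in> closure (open_simplex I)"
    by blast
  then show "b \<in> closure (open_simplex I)"
    by simp
qed

text \<open>Convexity of small boxes makes the open simplex locally connected at its boundary.\<close>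

lemma simplex_neighbourhood:
  assumes "finite I" "b \<in> closed_simplex I" "open U" "b \<in> U"
  obtains B where "open B" "b \<in> B" "B \<inter> closed_simplex I \<subseteq> U" "connected (B \<inter> open_simplex I)"
proof -
  have "openin (product_topology (\<lambda>i. euclideanreal) UNIV) U"
    using assms(3) by (simp add: euclidean_product_topology)
  then obtain Y where Y: "b \<in> PiE UNIV Y" "\<And>i. open (Y i)" "PiE UNIV Y \<subseteq> U"
    using product_topology_open_contains_basis[OF _ assms(4)] by (metis open_openin)
  have "\<exists>e>0. \<forall>i\<in>I. ball (b i) e \<subseteq> Y i"
    using assms(1)
  proof induction
    case (insert j J)
    then obtain e where "e > 0" "\<forall>i\<in>J. ball (b i) e \<subseteq> Y i" by blast
    moreover obtain e' where "e' > 0" "ball (b j) e' \<subseteq> Y j"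
      using Y(1,2) by (meson PiE_mem UNIV_I openE)
    ultimately show ?case
      by (intro exI[of _ "min e e'"]) (auto simp: subset_iff)
  qed (auto intro: exI[of _ 1])
  then obtain e where e: "e > 0" "\<And>i. i \<in> I \<Longrightarrow> ball (b i) e \<subseteq> Y i" by blast
  \<comment> \<open>Only the finitely many coordinates in \<open>I\<close> are constrained, which
    makes \<open>B\<close> open in the product topology; the others vanish on the closed
    simplex.\<close>
  define B where "B = {b'. \<forall>i\<in>I. \<bar>b' i - b i\<bar> < e}"
  show thesis
  proof
    have "B = (\<Inter>i\<in>I. {b'. \<bar>b' i - b i\<bar> < e})"
      by (auto simp: B_def)
    moreover have "open {b' :: nat \<Rightarrow> real. \<bar>b' i - b i\<bar> < e}" for i
      by (intro open_Collect_less continuous_intros continuous_on_product_coordinates)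
    ultimately show "open B"
      using assms(1) by (simp add: open_INT)
    show "b \<in> B"
      using e by (simp add: B_def)
    show "B \<inter> closed_simplex I \<subseteq> U"
    proof
      fix b' assume b': "b' \<in> B \<inter> closed_simplex I"
      have "b' i \<in> Y i" for i
      proof (cases "i \<in> I")
        case True
        then show ?thesis
          using b' e(2)[OF True] by (auto simp: B_def dist_real_def abs_minus_commute subset_iff)
      next
        case False
        then have "b' i = b i"
          using b' assms(2) by (auto simp: closed_simplex_def)
        then show ?thesis
          using Y(1) by (metis PiE_mem UNIV_I)
      qed
      then show "b' \<in> U"
        using Y(3) by (auto simp: PiE_iff)
    qed
    show "connected (B \<inter> open_simplex I)"
    proof (rule connected_if_segments)
      fix x y and t :: real assume x: "x \<in> B \<inter> open_simplex I" and y: "y \<in> B \<inter> open_simplex I" and t: "0 \<le> t" "t \<le> 1"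
      show "(\<lambda>i. (1 - t) * x i + t * y i) \<in> B \<inter> open_simplex I"
      proof
        show "(\<lambda>i. (1 - t) * x i + t * y i) \<in> B"
          unfolding B_def
        proof (intro CollectI ballI)
          fix i assume "i \<in> I"
          then have "(1 - t) * x i + t * y i \<in> ball (b i) e"
            using convexD_alt[OF convex_ball[of "b i" e], of "x i" "y i" t] x y t
            by (auto simp: B_def dist_real_def abs_minus_commute)
          then show "\<bar>((1 - t) * x i + t * y i) - b i\<bar> < e"
            by (simp add: dist_real_def abs_minus_commute)
        qed
        show "(\<lambda>i. (1 - t) * x i + t * y i) \<in> open_simplex I"
          using segment_in_open_simplex' x y t by simp
      qed
    qed
  qed
qed

section \<open>Closures of components above cells\<close>

locale decomposed_legendrian =
  fixes X :: "'a topology"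
    and A :: "('a, 'e::euclidean_space) chart set"
    and L C :: "('a, 'e) jet set"
    and \<mu> :: "('a, 'e) jet \<Rightarrow> int"
    and K :: "nat set set"
    and h :: "(nat \<Rightarrow> real) \<Rightarrow> 'a"
    and ord :: "nat set \<Rightarrow> ('a, 'e) jet set list"
  assumes manifold: "smooth_manifold X A"
    and legendrian: "closed_legendrian A L"
    and mild: "mild_front X A L C"
    and maslov: "maslov_potential (legendrian_topology A L) C \<mu>"
    and decomposition: "simplicial_decomposition X K h"
    and compatible: "compatible X (legendrian_topology A L) C K h"
    and ordering: "sheet_ordering (legendrian_topology A L) C K h ord"
begin

abbreviation "T \<equiv> legendrian_topology A L"
abbreviation "comps \<equiv> components_above T h"
abbreviation "shs \<equiv> sheets T C h"
abbreviation "closed_cell I \<equiv> h ` closed_simplex I"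

lemma L_subset_J1: "L \<subseteq> J1 A"
  using legendrian compactin_subset_topspace[of "jet_topology A" L] by (simp add: closed_legendrian_def)

lemma topspace_T [simp]: "topspace T = L"
  using L_subset_J1 by (auto simp: legendrian_topology_def)

lemma compact_T: "compact_space T"
  using legendrian by (simp add: closed_legendrian_def legendrian_topology_def compact_space_subtopology)

lemma Hausdorff_T: "Hausdorff_space T"
  using Hausdorff_jet_topology[OF manifold] by (simp add: legendrian_topology_def Hausdorff_space_subtopology)

lemma Hausdorff_X: "Hausdorff_space X"
  using manifold by (simp add: smooth_manifold_def)

lemma continuous_base: "continuous_map T X base"
  using continuous_map_base[OF manifold] by (simp add: legendrian_topology_def continuous_map_from_subtopology)

lemma continuous_zcoord: "continuous_map T euclideanreal zcoord"
  unfolding legendrian_topology_def by (rule continuous_map_from_subtopology[OF continuous_map_zcoord])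

lemma base_in_X: "q \<in> L \<Longrightarrow> base q \<in> topspace X"
  using continuous_base by (auto simp: continuous_map_def)

lemma closed_map_base: "closed_map T X base"
  using continuous_imp_closed_map continuous_base compact_T Hausdorff_X by blast

section \<open>Closed cells as compact images of closed simplices\<close>

lemma finite_simplex: "I \<in> K \<Longrightarrow> finite I"
  and simplex_nonempty: "I \<in> K \<Longrightarrow> I \<noteq> {}"
  and face_in_K: "I \<in> K \<Longrightarrow> J \<subseteq> I \<Longrightarrow> J \<noteq> {} \<Longrightarrow> J \<in> K"
  using decomposition unfolding simplicial_decomposition_def simplicial_complex_on_def by blast+

lemma openin_realization:
  "openin (realization K) U \<longleftrightarrow> U \<subseteq> (\<Union>I\<in>K. closed_simplex I) \<and>
     (\<forall>I\<in>K. openin (top_of_set (closed_simplex I)) (U \<inter> closed_simplex I))"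
  unfolding realization_def using topology_inverse'[OF istopology_realization[of K]] by simp

lemma topspace_realization: "topspace (realization K) = (\<Union>I\<in>K. closed_simplex I)"
proof
  show "topspace (realization K) \<subseteq> (\<Union>I\<in>K. closed_simplex I)"
    using openin_realization[of "topspace (realization K)"] openin_topspace by blast
  have "openin (top_of_set (closed_simplex I)) ((\<Union>I\<in>K. closed_simplex I) \<inter> closed_simplex I)" if "I \<in> K" for I
  proof -
    have "(\<Union>I\<in>K. closed_simplex I) \<inter> closed_simplex I = closed_simplex I"
      using that by blast
    then show ?thesis by simp
  qed
  then show "(\<Union>I\<in>K. closed_simplex I) \<subseteq> topspace (realization K)"
    by (intro openin_subset) (simp add: openin_realization)
qed

text \<open>The weak topology is defined so that each closed simplex includes continuously.\<close>

lemma continuous_h: "I \<in> K \<Longrightarrow> continuous_map (top_of_set (closed_simplex I)) X h"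
proof -
  assume I: "I \<in> K"
  have "continuous_map (top_of_set (closed_simplex I)) (realization K) id"
    unfolding continuous_map_def
  proof (intro conjI allI impI)
    show "id \<in> topspace (top_of_set (closed_simplex I)) \<rightarrow> topspace (realization K)"
      using I by (auto simp: topspace_realization)
    fix U assume "openin (realization K) U"
    then have "openin (top_of_set (closed_simplex I)) (U \<inter> closed_simplex I)"
      using I by (simp add: openin_realization)
    moreover have "{x \<in> topspace (top_of_set (closed_simplex I)). id x \<in> U} = U \<inter> closed_simplex I"
      by auto
    ultimately show "openin (top_of_set (closed_simplex I)) {x \<in> topspace (top_of_set (closed_simplex I)). id x \<in> U}"
      by simp
  qed
  moreover have "continuous_map (realization K) X h"
    using decomposition homeomorphic_imp_continuous_map by (auto simp: simplicial_decomposition_def)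
  ultimately show ?thesis
    using continuous_map_compose by fastforce
qed

lemma inj_h: "inj_on h (\<Union>I\<in>K. closed_simplex I)"
  using decomposition homeomorphic_imp_injective_map[of "realization K" X h]
  by (simp add: simplicial_decomposition_def topspace_realization)

lemma cell_subset_closed_cell: "cell h I \<subseteq> closed_cell I"
  unfolding cell_def using open_simplex_subset_closed by blast

lemma closed_cell_subset: "I \<in> K \<Longrightarrow> closed_cell I \<subseteq> topspace X"
  using continuous_map_image_subset_topspace[OF continuous_h] by simp

lemma cell_subset: "I \<in> K \<Longrightarrow> cell h I \<subseteq> topspace X"
  using closed_cell_subset cell_subset_closed_cell by blast

lemma cell_nonempty: "I \<in> K \<Longrightarrow> cell h I \<noteq> {}"
  using open_simplex_nonempty finite_simplex simplex_nonempty by (auto simp: cell_def)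

lemma compactin_h_image: "I \<in> K \<Longrightarrow> compact S \<Longrightarrow> S \<subseteq> closed_simplex I \<Longrightarrow> compactin X (h ` S)"
  by (rule image_compactin[OF _ continuous_h]) (auto simp: compactin_subtopology)

lemma closedin_closed_cell: "I \<in> K \<Longrightarrow> closedin X (closed_cell I)"
  using compactin_imp_closedin[OF Hausdorff_X compactin_h_image] compact_closed_simplex finite_simplex by blast

lemma closed_cell_subset_closure: "I \<in> K \<Longrightarrow> closed_cell I \<subseteq> X closure_of cell h I"
proof -
  assume I: "I \<in> K"
  have "closed_simplex I \<subseteq> top_of_set (closed_simplex I) closure_of open_simplex I"
    using closed_simplex_subset_closure[OF finite_simplex[OF I] simplex_nonempty[OF I]] open_simplex_subset_closed[of I]
    by (simp add: closure_of_subtopology Int_absorb1)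
  then show ?thesis
    unfolding cell_def using continuous_map_image_closure_subset[OF continuous_h[OF I], of "open_simplex I"] by blast
qed

lemma closure_cell: "I \<in> K \<Longrightarrow> X closure_of cell h I = closed_cell I"
  using closed_cell_subset_closure closure_of_minimal[OF cell_subset_closed_cell closedin_closed_cell] by blast

lemma face_cell_subset: "I \<in> K \<Longrightarrow> J \<subseteq> I \<Longrightarrow> cell h J \<subseteq> closed_cell I"
proof -
  assume I: "I \<in> K" and J: "J \<subseteq> I"
  have "b \<in> closed_simplex I" if b: "b \<in> open_simplex J" for b
  proof -
    have 0: "b i = 0" if "i \<notin> J" for i
      using b that by (simp add: open_simplex_def)
    have "sum b J = sum b I"
      by (rule sum.mono_neutral_left[OF finite_simplex[OF I] J]) (simp add: 0)
    moreover have "b i \<ge> 0" for i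
      using b 0[of i] by (cases "i \<in> J") (auto simp: open_simplex_def less_imp_le)
    moreover have "\<forall>i. i \<notin> I \<longrightarrow> b i = 0"
      using J 0 by blast
    ultimately show ?thesis
      using b by (simp add: closed_simplex_def open_simplex_def)
  qed
  then show ?thesis
    by (auto simp: cell_def)
qed

lemma closed_cell_cases: "I \<in> K \<Longrightarrow> x \<in> closed_cell I \<Longrightarrow> \<exists>J\<in>K. x \<in> cell h J"
proof -
  assume I: "I \<in> K" and "x \<in> closed_cell I"
  then obtain b where b: "b \<in> closed_simplex I" "x = h b" by blast
  \<comment> \<open>The carrier of the point: the support of its barycentric coordinates.\<close>
  define J where "J = {i \<in> I. b i > 0}"
  have pos: "b i \<ge> 0" and out: "i \<notin> I \<Longrightarrow> b i = 0" for i
    using b(1) by (cases "i \<in> I"; simp add: closed_simplex_def)+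
  have 0: "b i = 0" if "i \<notin> J" for i
    using that pos[of i] out[of i] by (auto simp: J_def)
  have "sum b J = sum b I"
  proof (rule sum.mono_neutral_left[OF finite_simplex[OF I]])
    show "J \<subseteq> I"
      by (auto simp: J_def)
    show "\<forall>i\<in>I - J. b i = 0"
      using 0 by blast
  qed
  then have "sum b J = 1"
    using b(1) by (simp add: closed_simplex_def)
  moreover have "b i > 0" if "i \<in> J" for i
    using that by (simp add: J_def)
  ultimately have "b \<in> open_simplex J"
    unfolding open_simplex_def using 0 by blast
  have "J \<noteq> {}"
    using \<open>sum b J = 1\<close> by force
  then have "J \<in> K"
    using face_in_K[OF I] by (simp add: J_def)
  then show ?thesis
    using b(2) \<open>b \<in> open_simplex J\<close> by (auto simp: cell_def)
qed

section \<open>Components above cells\<close>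

lemma P1: "I \<in> K \<Longrightarrow> S \<in> comps I \<Longrightarrow> homeomorphic_map (subtopology T S) (subtopology X (cell h I)) base"
  "I \<in> K \<Longrightarrow> S \<in> comps I \<Longrightarrow> S \<inter> C = {} \<or> S \<subseteq> C"
  using compatible by (auto simp: compatible_def compatible_P1_def)

lemma comps_subset: "S \<in> comps I \<Longrightarrow> S \<subseteq> L \<inter> {q. base q \<in> cell h I}"
  using connected_components_of_subset[of S "subtopology T {q. base q \<in> cell h I}"]
  by (simp add: components_above_def)

lemma comps_connected: "S \<in> comps I \<Longrightarrow> connectedin T S"
  using connectedin_connected_components_of[of S "subtopology T {q. base q \<in> cell h I}"]
  by (simp add: components_above_def connectedin_subtopology)

lemma comps_nonempty: "S \<in> comps I \<Longrightarrow> S \<noteq> {}"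
  using nonempty_connected_components_of by (auto simp: components_above_def)

lemma comps_overlap: "S \<in> comps I \<Longrightarrow> S' \<in> comps I \<Longrightarrow> q \<in> S \<Longrightarrow> q \<in> S' \<Longrightarrow> S = S'"
  using connected_components_of_overlap[of S "subtopology T {q. base q \<in> cell h I}" S']
  unfolding components_above_def by blast

lemma ex_component_superset:
  assumes "connectedin T Z" "Z \<noteq> {}" "base ` Z \<subseteq> cell h J"
  shows "\<exists>R\<in>comps J. Z \<subseteq> R"
proof -
  have Z: "connectedin (subtopology T {q. base q \<in> cell h J}) Z"
    using assms by (auto simp: connectedin_subtopology)
  moreover have "subtopology T {q. base q \<in> cell h J} \<noteq> trivial_topology"
    using assms(2) connectedin_subset_topspace[OF Z] by fastforce
  ultimately show ?thesis
    unfolding components_above_def using exists_connected_component_of_superset by blast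
qed

lemma comps_base_image: "I \<in> K \<Longrightarrow> S \<in> comps I \<Longrightarrow> base ` S = cell h I"
proof -
  assume I: "I \<in> K" and S: "S \<in> comps I"
  have "L \<inter> S = S" "topspace X \<inter> cell h I = cell h I"
    using comps_subset[OF S] cell_subset[OF I] by blast+
  then show ?thesis
    using homeomorphic_imp_surjective_map[OF P1(1)[OF I S]] by simp
qed

lemma comps_inj: "I \<in> K \<Longrightarrow> S \<in> comps I \<Longrightarrow> inj_on base S"
proof -
  assume I: "I \<in> K" and S: "S \<in> comps I"
  have "L \<inter> S = S"
    using comps_subset[OF S] by blast
  then show ?thesis
    using homeomorphic_imp_injective_map[OF P1(1)[OF I S]] by simp
qed

text \<open>A connected subset of a fibre lies in a single component above the cell containing
  \<open>x\<close>, and on that component (P1) makes \<open>base\<close> injective.\<close>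

lemma connected_fibre_trivial:
  assumes "J \<in> K" "x \<in> cell h J" "connectedin T F" "base ` F \<subseteq> {x}" "q \<in> F" "q' \<in> F"
  shows "q = q'"
proof -
  obtain R where R: "R \<in> comps J" "F \<subseteq> R"
    using ex_component_superset[of F J] assms by blast
  then show ?thesis
    using inj_onD[OF comps_inj[OF assms(1) R(1)], of q q'] assms(4-6) by blast
qed

text \<open>The cluster set of a component over a boundary point of its cell would otherwise be split by a
  clopen partition of the fibre, which is totally disconnected by (P1).\<close>

lemma closure_inj:
  assumes I: "I \<in> K" and S: "S \<in> comps I"
    and q: "q1 \<in> T closure_of S" "q2 \<in> T closure_of S" "base q1 = base q2"
  shows "q1 = q2"
proof (rule ccontr)
  assume "q1 \<noteq> q2"
  define x where "x = base q1"
  have qL: "q1 \<in> L" "q2 \<in> L"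
    using q closure_of_subset_topspace[of T S] by auto
  have "base ` (T closure_of S) \<subseteq> X closure_of (base ` S)"
    by (rule continuous_map_image_closure_subset[OF continuous_base])
  then have x: "x \<in> closed_cell I"
    using q(1) comps_base_image[OF I S] closure_cell[OF I] by (auto simp: x_def)
  then obtain b where b: "b \<in> closed_simplex I" "x = h b" by blast
  obtain J where J: "J \<in> K" "x \<in> cell h J"
    using closed_cell_cases[OF I x] by blast
  define F where "F = {q \<in> topspace T. base q \<in> {x}}"
  define FT where "FT = subtopology T F"
  have "closedin T F"
    unfolding F_def using closedin_Hausdorff_singleton[OF Hausdorff_X] base_in_X[OF qL(1)]
    by (intro closedin_continuous_map_preimage[OF continuous_base]) (simp add: x_def)
  have topFT: "topspace FT = F"
    by (auto simp: FT_def F_def)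
  have qF: "q1 \<in> F" "q2 \<in> F"
    using q(3) qL by (auto simp: F_def x_def)
  have "compact_space FT" "Hausdorff_space FT"
    unfolding FT_def using closedin_compact_space[OF compact_T \<open>closedin T F\<close>] Hausdorff_T
    by (auto simp: compact_space_subtopology Hausdorff_space_subtopology)
  have "\<not> connected_component_of FT q1 q2"
  proof
    assume "connected_component_of FT q1 q2"
    then obtain Z where Z: "connectedin T Z" "Z \<subseteq> F" "q1 \<in> Z" "q2 \<in> Z"
      by (auto simp: connected_component_of_def FT_def connectedin_subtopology)
    then have "base ` Z \<subseteq> {x}"
      by (auto simp: F_def)
    then have "q1 = q2"
      by (rule connected_fibre_trivial[OF J Z(1) _ Z(3,4)])
    with \<open>q1 \<noteq> q2\<close> show False ..
  qed
  \<comment> \<open>In a compact Hausdorff space components and quasi-components agree, so points in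
    different components are separated by a clopen partition of the fibre.\<close>
  moreover have "quasi_component_of FT q1 = connected_component_of FT q1"
    using \<open>compact_space FT\<close> \<open>Hausdorff_space FT\<close> by (intro quasi_eq_connected_component_of) simp
  ultimately have "\<not> quasi_component_of FT q1 q2"
    by simp
  then have "separated_between FT {q1} {q2}"
    using separated_between_singletons[of FT q1 q2] topFT qF by simp
  then obtain F1 F2 where F12: "closedin FT F1" "closedin FT F2" "F1 \<union> F2 = F" "disjnt F1 F2" "q1 \<in> F1" "q2 \<in> F2"
    unfolding separated_between_alt topFT by auto
  then have closed: "closedin T F1" "closedin T F2"
    using closedin_trans_full[OF _ \<open>closedin T F\<close>] unfolding FT_def by blast+
  have "normal_space T"
    by (rule compact_Hausdorff_or_regular_imp_normal_space[OF compact_T disjI1[OF Hausdorff_T]])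
  from this[unfolded normal_space_def, rule_format, of F1 F2]
  obtain U1 U2 where U: "openin T U1" "openin T U2" "F1 \<subseteq> U1" "F2 \<subseteq> U2" "disjnt U1 U2"
    using closed F12(4) by blast
  have fib: "{q \<in> topspace T. base q = x} \<subseteq> U1 \<union> U2"
    using F12(3) U(3,4) by (auto simp: F_def)
  \<comment> \<open>A tube lemma for the closed map \<open>base\<close>: an open set containing the
    fibre over \<open>x\<close> contains the preimage of a neighbourhood of
    \<open>x\<close>.\<close>
  have "\<forall>U y. openin T U \<and> y \<in> topspace X \<and> {q \<in> topspace T. base q = y} \<subseteq> U \<longrightarrow>
      (\<exists>V. openin X V \<and> y \<in> V \<and> {q \<in> topspace T. base q \<in> V} \<subseteq> U)"
    using closed_map_base unfolding closed_map_fibre_neighbourhood by (rule conjunct2)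
  from this[rule_format, of "U1 \<union> U2" x]
  obtain V where V: "openin X V" "x \<in> V" "{q \<in> topspace T. base q \<in> V} \<subseteq> U1 \<union> U2"
    using fib base_in_X[OF qL(1)] openin_Un[OF U(1,2)] unfolding x_def by blast
  have "openin (top_of_set (closed_simplex I)) {b \<in> closed_simplex I. h b \<in> V}"
    using openin_continuous_map_preimage[OF continuous_h[OF I] V(1)] by simp
  then obtain G where G: "open G" "{b \<in> closed_simplex I. h b \<in> V} = closed_simplex I \<inter> G"
    by (auto simp: openin_open)
  then have "b \<in> G"
    using b V(2) by blast
  then obtain B where B: "open B" "b \<in> B" "B \<inter> closed_simplex I \<subseteq> G" "connected (B \<inter> open_simplex I)"
    using simplex_neighbourhood[OF finite_simplex[OF I] b(1) G(1)] by metis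
  have hB: "h ` (B \<inter> closed_simplex I) \<subseteq> V"
    using B(3) G(2) by blast
  \<comment> \<open>Removing the compact image of \<open>closed_simplex I - B\<close> yields a
    neighbourhood of \<open>x\<close> in \<open>X\<close> whose points in the closed cell all have
    coordinates in \<open>B\<close>.\<close>
  define V1 where "V1 = V - h ` (closed_simplex I - B)"
  have "compact (closed_simplex I - B)"
    by (rule compact_diff[OF compact_closed_simplex[OF finite_simplex[OF I]] B(1)])
  then have "closedin X (h ` (closed_simplex I - B))"
    by (intro compactin_imp_closedin[OF Hausdorff_X] compactin_h_image[OF I] Diff_subset)
  then have "openin X V1"
    using V(1) by (simp add: V1_def openin_diff)
  have "x \<notin> h ` (closed_simplex I - B)"
  proof
    assume "x \<in> h ` (closed_simplex I - B)"
    then obtain b' where "b' \<in> closed_simplex I" "b' \<notin> B" "h b = h b'"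
      unfolding b(2) by blast
    then show False
      using inj_onD[OF inj_h, of b b'] I b(1) B(2) by blast
  qed
  then have "x \<in> V1"
    using V(2) by (simp add: V1_def)
  \<comment> \<open>(P1) identifies this part of \<open>S\<close> with a connected piece of the open
    cell. It is therefore connected, yet it will be covered by the disjoint open sets
    \<open>U1\<close> and \<open>U2\<close> and meet both, since \<open>q1\<close> and
    \<open>q2\<close> are limits of it.\<close>
  define S' where "S' = {q \<in> S. base q \<in> h ` (B \<inter> open_simplex I)}"
  have SL: "S \<subseteq> L"
    using comps_subset[OF S] by blast
  have "base ` S' = h ` (B \<inter> open_simplex I)"
    using comps_base_image[OF I S] by (force simp: S'_def cell_def)
  moreover have "connectedin X (h ` (B \<inter> open_simplex I))"
    using B(4) open_simplex_subset_closed[of I]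
    by (intro connectedin_continuous_map_image[OF continuous_h[OF I]]) (auto simp: connectedin_subtopology)
  moreover have "h ` (B \<inter> open_simplex I) \<subseteq> cell h I"
    by (auto simp: cell_def)
  ultimately have "connectedin (subtopology X (cell h I)) (base ` S')"
    by (simp add: connectedin_subtopology)
  moreover have "S' \<subseteq> topspace (subtopology T S)"
    using SL by (auto simp: S'_def)
  ultimately have "connectedin (subtopology T S) S'"
    using homeomorphic_map_connectedness[OF P1(1)[OF I S]] by blast
  then have S'_conn: "connectedin T S'"
    by (simp add: connectedin_subtopology)
  have S'_sub: "S' \<subseteq> U1 \<union> U2"
  proof
    fix q assume "q \<in> S'"
    then have "q \<in> topspace T" "base q \<in> V"
      using SL hB open_simplex_subset_closed[of I] by (auto simp: S'_def)
    then show "q \<in> U1 \<union> U2"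
      using V(3) by blast
  qed
  have meets: "U \<inter> S' \<noteq> {}" if U: "openin T U" and q: "q \<in> U" "q \<in> T closure_of S" "base q = x" for U q
  proof -
    define G where "G = U \<inter> {q \<in> topspace T. base q \<in> V1}"
    have "openin T G"
      unfolding G_def by (rule openin_Int[OF U openin_continuous_map_preimage[OF continuous_base \<open>openin X V1\<close>]])
    moreover have "q \<in> G"
      using q(1,3) \<open>x \<in> V1\<close> openin_subset[OF U] unfolding G_def by blast
    moreover have "\<forall>G. q \<in> G \<and> openin T G \<longrightarrow> (\<exists>r. r \<in> S \<and> r \<in> G)"
      using q(2) unfolding in_closure_of by (rule conjunct2)
    ultimately have "\<exists>r. r \<in> S \<and> r \<in> G"
      by blast
    then obtain r where r: "r \<in> S" "r \<in> U" "base r \<in> V1"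
      unfolding G_def by blast
    moreover have "base r \<in> cell h I"
      using r(1) comps_subset[OF S] by blast
    ultimately have "r \<in> S'"
      using open_simplex_subset_closed[of I] by (auto simp: S'_def V1_def cell_def)
    then show ?thesis
      using r by blast
  qed
  have "U1 \<inter> S' \<noteq> {}"
    using meets[OF U(1) _ q(1)] F12(5) U(3) by (auto simp: x_def)
  moreover have "U2 \<inter> S' \<noteq> {}"
    using meets[OF U(2) _ q(2)] F12(6) U(4) q(3) by (auto simp: x_def)
  ultimately show False
    using connectedinD[OF S'_conn U(1,2) S'_sub] U(5) by (auto simp: disjnt_def)
qed

text \<open>A continuous bijection from a compact space to a Hausdorff space:
  \<open>closure_inj\<close> gives injectivity, and surjectivity holds because the continuous closed
  map \<open>base\<close> commutes with closures.\<close>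

lemma closure_homeomorphic:
  assumes I: "I \<in> K" and S: "S \<in> comps I"
  shows "homeomorphic_map (subtopology T (T closure_of S)) (subtopology X (closed_cell I)) base"
proof (rule continuous_imp_homeomorphic_map)
  have top: "topspace (subtopology T (T closure_of S)) = T closure_of S"
    using closure_of_subset_topspace[of T S] by auto
  have "base ` (T closure_of S) = X closure_of (base ` S)"
  proof
    show "base ` (T closure_of S) \<subseteq> X closure_of (base ` S)"
      by (rule continuous_map_image_closure_subset[OF continuous_base])
    have "S \<subseteq> topspace T"
      using comps_subset[OF S] by auto
    then show "X closure_of (base ` S) \<subseteq> base ` (T closure_of S)"
      using closed_map_base unfolding closed_map_closure_of_image by blast
  qed
  then have img: "base ` (T closure_of S) = closed_cell I"
    using comps_base_image[OF I S] closure_cell[OF I] by simp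
  show "continuous_map (subtopology T (T closure_of S)) (subtopology X (closed_cell I)) base"
    using continuous_base img by (auto simp: continuous_map_in_subtopology continuous_map_from_subtopology top)
  show "compact_space (subtopology T (T closure_of S))"
    by (rule compact_space_subtopology[OF closedin_compact_space[OF compact_T closedin_closure_of]])
  show "Hausdorff_space (subtopology X (closed_cell I))"
    using Hausdorff_X by (simp add: Hausdorff_space_subtopology)
  show "base ` topspace (subtopology T (T closure_of S)) = topspace (subtopology X (closed_cell I))"
    unfolding top using img closed_cell_subset[OF I] by (simp add: Int_absorb1)
  show "inj_on base (topspace (subtopology T (T closure_of S)))"
    unfolding top by (rule inj_onI) (rule closure_inj[OF I S])
qed

end

section \<open>Faces, heights and cusp pairs\<close>

text \<open>The last coordinate of the normal form is the cube of \<open>inner t b\<close>, so a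
  real cube root recovers \<open>inner t b\<close>, and then the first component recovers
  \<open>t\<close>.\<close>

lemma standard_cusp_front_inj:
  fixes A :: "('a, 'e::euclidean_space) chart set"
  assumes "standard_cusp X A L C q"
  shows "\<exists>(W :: 'e set) g.
    local_param (jet_topology A) (jet_atlas A) L W g \<and> q \<in> g ` W \<and> inj_on (front \<circ> g) W"
  using assms unfolding standard_cusp_def
proof (elim exE conjE)
  fix W :: "'e set" and g k b
  assume W: "local_param (jet_topology A) (jet_atlas A) L W g" "q \<in> g ` W"
    and k: "\<forall>t\<in>W. front (g t) \<in> fst k \<and>
           snd k (front (g t)) = (t + ((inner t b)\<^sup>2 - inner t b) *\<^sub>R b, (inner t b) ^ 3) \<and>
           (g t \<in> C \<longleftrightarrow> inner t b = 0)"
  have "inj_on (front \<circ> g) W"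
  proof (rule inj_onI)
    fix t t' assume t: "t \<in> W" "t' \<in> W" "(front \<circ> g) t = (front \<circ> g) t'"
    have eq: "t + ((inner t b)\<^sup>2 - inner t b) *\<^sub>R b = t' + ((inner t' b)\<^sup>2 - inner t' b) *\<^sub>R b"
        "(inner t b) ^ 3 = (inner t' b) ^ 3"
      using bspec[OF k t(1)] bspec[OF k t(2)] t(3) by simp_all
    have "inner t b = inner t' b"
      using arg_cong[OF eq(2), of "root 3"] by (simp add: odd_real_root_power_cancel)
    then show "t = t'"
      using eq(1) by simp
  qed
  with W show ?thesis by blast
qed

context decomposed_legendrian
begin

definition face :: "nat set \<Rightarrow> ('a, 'e) jet set \<Rightarrow> ('a, 'e) jet set" where
  "face J S = {q \<in> T closure_of S. base q \<in> cell h J}"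

lemma closure_base_image: "I \<in> K \<Longrightarrow> S \<in> comps I \<Longrightarrow> base ` (T closure_of S) = closed_cell I"
proof -
  assume I: "I \<in> K" and S: "S \<in> comps I"
  have "L \<inter> T closure_of S = T closure_of S" "topspace X \<inter> closed_cell I = closed_cell I"
    using closure_of_subset_topspace[of T S] closed_cell_subset[OF I] by auto
  then show ?thesis
    using homeomorphic_imp_surjective_map[OF closure_homeomorphic[OF I S]] by simp
qed

lemma comps_subset_closure: "S \<in> comps I \<Longrightarrow> S \<subseteq> T closure_of S"
  using closure_of_subset[of S T] comps_subset[of S I] by simp

lemma comp_eq_of_subset:
  assumes "J \<in> K" "R \<in> comps J" "Z \<subseteq> R" "base ` Z = cell h J"
  shows "Z = R"
proof
  show "R \<subseteq> Z"
  proof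
    fix q assume q: "q \<in> R"
    then have "base q \<in> base ` Z"
      using assms(4) comps_subset[OF assms(2)] by blast
    then obtain q' where "q' \<in> Z" "base q = base q'" by blast
    then show "q \<in> Z"
      using inj_onD[OF comps_inj[OF assms(1,2)], of q q'] q assms(3) by blast
  qed
qed fact

lemma base_face: "I \<in> K \<Longrightarrow> S \<in> comps I \<Longrightarrow> J \<subseteq> I \<Longrightarrow> base ` face J S = cell h J"
  using closure_base_image[of I S] face_cell_subset[of I J] by (auto simp: face_def image_iff subset_iff)

text \<open>The closure of \<open>S\<close> is homeomorphic to the closed cell, so its part over the
  connected cell \<open>e_J\<close> is connected and covers \<open>e_J\<close>; by injectivity of
  \<open>base\<close> it fills the component containing it.\<close>

lemma face_component:
  assumes I: "I \<in> K" and S: "S \<in> comps I" and J: "J \<subseteq> I" "J \<noteq> {}"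
  shows "face J S \<in> comps J"
proof -
  have JK: "J \<in> K"
    using face_in_K[OF I J] .
  have sub: "face J S \<subseteq> topspace (subtopology T (T closure_of S))"
    using closure_of_subset_topspace[of T S] by (auto simp: face_def)
  have "connectedin X (cell h J)"
    unfolding cell_def
  proof (rule connectedin_continuous_map_image[OF continuous_h[OF JK]])
    have "connected (open_simplex J)"
      using segment_in_open_simplex'[of _ J] by (rule connected_if_segments)
    then show "connectedin (top_of_set (closed_simplex J)) (open_simplex J)"
      using open_simplex_subset_closed[of J]
      by (auto simp: connectedin_subtopology)
  qed
  then have "connectedin (subtopology X (closed_cell I)) (base ` face J S)"
    using base_face[OF I S J(1)] face_cell_subset[OF I J(1)] by (simp add: connectedin_subtopology)
  then have "connectedin (subtopology T (T closure_of S)) (face J S)"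
    using homeomorphic_map_connectedness[OF closure_homeomorphic[OF I S] sub] by simp
  then have conn: "connectedin T (face J S)"
    by (simp add: connectedin_subtopology)
  have "face J S \<noteq> {}"
    using base_face[OF I S J(1)] cell_nonempty[OF JK] by auto
  then obtain R where R: "R \<in> comps J" "face J S \<subseteq> R"
    using ex_component_superset[OF conn, of J] base_face[OF I S J(1)] by auto
  then show ?thesis
    using comp_eq_of_subset[OF JK R base_face[OF I S J(1)]] by simp
qed

text \<open>Turns the closure conditions in (P3) and in the face matrices into equations between
  faces.\<close>

lemma subset_closure_iff:
  assumes "I \<in> K" "S \<in> comps I" "J \<subseteq> I" "J \<noteq> {}" "R \<in> comps J"
  shows "R \<subseteq> T closure_of S \<longleftrightarrow> R = face J S"
proof
  assume "R \<subseteq> T closure_of S"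
  then have "R \<subseteq> face J S"
    using comps_subset[OF assms(5)] by (auto simp: face_def)
  then show "R = face J S"
    using comp_eq_of_subset[OF face_in_K[OF assms(1,3,4)] face_component[OF assms(1-4)]]
      comps_base_image[OF face_in_K[OF assms(1,3,4)] assms(5)] by blast
qed (auto simp: face_def)

lemma face_face:
  assumes I: "I \<in> K" and S: "S \<in> comps I" and J: "J \<subseteq> I" and H: "H \<subseteq> J" "H \<noteq> {}"
  shows "face H (face J S) = face H S"
proof (rule comp_eq_of_subset)
  have ne: "J \<noteq> {}"
    using H by auto
  show HK: "H \<in> K"
    using face_in_K[OF I _ H(2)] H(1) J by auto
  show "face H S \<in> comps H"
    using face_component[OF I S _ H(2)] H(1) J by auto
  have "face J S \<subseteq> T closure_of S"
    by (auto simp: face_def)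
  then have "T closure_of (face J S) \<subseteq> T closure_of S"
    by (rule closure_of_minimal[OF _ closedin_closure_of])
  then show "face H (face J S) \<subseteq> face H S"
    by (auto simp: face_def)
  show "base ` face H (face J S) = cell h H"
    using base_face[OF face_in_K[OF I J ne] face_component[OF I S J ne] H(1)] .
qed

lemma face_self: "I \<in> K \<Longrightarrow> S \<in> comps I \<Longrightarrow> face I S = S"
  using subset_closure_iff[of I S I S] comps_subset_closure simplex_nonempty by simp

section \<open>Property (P3) in terms of faces\<close>

lemma sheets_comps: "S \<in> shs I \<Longrightarrow> S \<in> comps I"
  by (simp add: sheets_def)

lemma cusp_components_iff: "J \<in> K \<Longrightarrow> R \<in> comps J \<Longrightarrow> R \<in> cusp_components T C h J \<longleftrightarrow> R \<notin> shs J"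
  using P1(2)[of J R] comps_nonempty[of R J] by (auto simp: cusp_components_def sheets_def)

lemma meet_at_cusp_iff:
  assumes "I \<in> K" "S \<in> comps I" "S' \<in> comps I" "J \<subseteq> I" "J \<noteq> {}"
  shows "meet_at_cusp T C h J S S' \<longleftrightarrow> S \<noteq> S' \<and> face J S = face J S' \<and> face J S \<notin> shs J"
proof -
  have JK: "J \<in> K"
    using face_in_K assms by blast
  have sub: "E \<subseteq> T closure_of Z \<longleftrightarrow> E = face J Z"
    if "E \<in> cusp_components T C h J" "Z \<in> comps I" for E Z
    using subset_closure_iff[OF assms(1) that(2) assms(4,5)] that(1) by (simp add: cusp_components_def)
  have "face J S \<in> cusp_components T C h J \<longleftrightarrow> face J S \<notin> shs J"
    using cusp_components_iff[OF JK face_component[OF assms(1,2,4,5)]] .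
  then show ?thesis
    unfolding meet_at_cusp_def using sub assms(2,3) by auto
qed

lemma face_closure_cell: "I \<in> K \<Longrightarrow> J \<subseteq> I \<Longrightarrow> cell h J \<subseteq> X closure_of cell h I"
  by (simp add: closure_cell face_cell_subset)

lemma sheet_extends:
  assumes "I \<in> K" "J \<subseteq> I" "J \<noteq> {}" "R \<in> shs J"
  shows "\<exists>!S. S \<in> shs I \<and> face J S = R"
proof -
  have "\<forall>R\<in>shs J. \<exists>!S. S \<in> shs I \<and> R \<subseteq> T closure_of S"
    using compatible face_in_K[OF assms(1-3)] face_closure_cell[OF assms(1,2)] assms(1)
    unfolding compatible_def compatible_P3_def by simp
  then have "\<exists>!S. S \<in> shs I \<and> R \<subseteq> T closure_of S"
    using assms(4) by blast
  moreover have "S \<in> shs I \<and> R \<subseteq> T closure_of S \<longleftrightarrow> S \<in> shs I \<and> face J S = R" for S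
    using subset_closure_iff[OF assms(1) sheets_comps assms(2,3) sheets_comps[OF assms(4)]] by auto
  ultimately show ?thesis by simp
qed

lemma cusp_partner:
  assumes "I \<in> K" "J \<subseteq> I" "J \<noteq> {}" "S \<in> shs I" "face J S \<notin> shs J"
  shows "\<exists>!S'. S' \<in> shs I \<and> S' \<noteq> S \<and> face J S' = face J S"
proof -
  \<comment> \<open>The only component above \<open>e_J\<close> inside the closure of
    \<open>S\<close> is \<open>face J S\<close>, so \<open>S\<close> remains exactly when this face
    is not a sheet.\<close>
  have rem: "S \<in> remaining_sheets T C h I J \<longleftrightarrow> S \<in> shs I \<and> face J S \<notin> shs J" for S
  proof (cases "S \<in> shs I")
    case True
    then have "R \<subseteq> T closure_of S \<longleftrightarrow> R = face J S" if "R \<in> shs J" for R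
      using subset_closure_iff[OF assms(1) sheets_comps assms(2,3) sheets_comps[OF that]] by blast
    then show ?thesis
      by (auto simp: remaining_sheets_def True)
  qed (simp add: remaining_sheets_def)
  have "\<forall>S\<in>remaining_sheets T C h I J. \<exists>!S'. S' \<in> remaining_sheets T C h I J \<and> meet_at_cusp T C h J S S'"
    using compatible face_in_K[OF assms(1-3)] face_closure_cell[OF assms(1,2)] assms(1)
    unfolding compatible_def compatible_P3_def by simp
  then have "\<exists>!S'. S' \<in> remaining_sheets T C h I J \<and> meet_at_cusp T C h J S S'"
    using rem assms(4,5) by blast
  moreover have "S' \<in> remaining_sheets T C h I J \<and> meet_at_cusp T C h J S S' \<longleftrightarrow>
      S' \<in> shs I \<and> S' \<noteq> S \<and> face J S' = face J S" for S'
    unfolding rem using meet_at_cusp_iff[OF assms(1) sheets_comps[OF assms(4)] sheets_comps assms(2,3)] assms(5)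
    by auto
  ultimately show ?thesis by simp
qed

text \<open>Extending \<open>face H S\<close> first to \<open>e_J\<close> and then to
  \<open>e_I\<close> must end at \<open>S\<close> by uniqueness, so the intermediate sheet is
  \<open>face J S\<close>. Contrapositively, a cusp face above \<open>e_J\<close> stays a cusp face
  above all smaller cells.\<close>

lemma sheet_face_sheet:
  assumes I: "I \<in> K" and S: "S \<in> shs I" and J: "J \<subseteq> I" and H: "H \<subseteq> J" "H \<noteq> {}" and "face H S \<in> shs H"
  shows "face J S \<in> shs J"
proof -
  have ne: "J \<noteq> {}"
    using H by auto
  obtain Q where Q: "Q \<in> shs J" "face H Q = face H S"
    using sheet_extends[OF face_in_K[OF I J ne] H assms(6)] by blast
  obtain S' where S': "S' \<in> shs I" "face J S' = Q"
    using sheet_extends[OF I J ne Q(1)] by blast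
  have "face H S' = face H S"
    using face_face[OF I sheets_comps[OF S'(1)] J H] S'(2) Q(2) by simp
  then have "S' = S"
    using sheet_extends[OF I order.trans[OF H(1) J] H(2) assms(6)] S S'(1) by blast
  then show ?thesis
    using S' Q by simp
qed

section \<open>Heights over closed cells\<close>

definition lift :: "nat set \<Rightarrow> ('a, 'e) jet set \<Rightarrow> 'a \<Rightarrow> ('a, 'e) jet" where
  "lift I S = inv_into (T closure_of S) base"

text \<open>By \<open>closure_homeomorphic\<close> the inverse of the base projection is a
  continuous section over the closed cell, through which heights extend continuously to its
  boundary.\<close>

lemma lift:
  assumes I: "I \<in> K" and S: "S \<in> comps I"
  shows lift_base: "q \<in> T closure_of S \<Longrightarrow> lift I S (base q) = q"
    and base_lift: "x \<in> closed_cell I \<Longrightarrow> base (lift I S x) = x"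
    and lift_closure: "x \<in> closed_cell I \<Longrightarrow> lift I S x \<in> T closure_of S"
    and continuous_lift: "continuous_map (subtopology X (closed_cell I)) T (lift I S)"
proof -
  have inj: "inj_on base (T closure_of S)"
    by (rule inj_onI) (rule closure_inj[OF I S])
  show 1: "lift I S (base q) = q" if "q \<in> T closure_of S" for q
    using inv_into_f_f[OF inj that] by (simp add: lift_def)
  show "base (lift I S x) = x" "lift I S x \<in> T closure_of S" if "x \<in> closed_cell I" for x
    using that closure_base_image[OF I S] f_inv_into_f[of x base "T closure_of S"]
      inv_into_into[of x base "T closure_of S"] by (auto simp: lift_def)
  obtain g where g: "homeomorphic_maps (subtopology T (T closure_of S)) (subtopology X (closed_cell I)) base g"
    using closure_homeomorphic[OF I S] homeomorphic_map_maps by blast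
  then have "continuous_map (subtopology X (closed_cell I)) (subtopology T (T closure_of S)) g"
    by (simp add: homeomorphic_maps_def)
  moreover have "g x = lift I S x" if "x \<in> topspace (subtopology X (closed_cell I))" for x
  proof -
    have "g x \<in> T closure_of S" "base (g x) = x"
      using g that continuous_map_image_subset_topspace[of "subtopology X (closed_cell I)" _ g]
      unfolding homeomorphic_maps_def by (force simp: continuous_map_in_subtopology)+
    then show ?thesis
      using 1[of "g x"] by simp
  qed
  ultimately have "continuous_map (subtopology X (closed_cell I)) (subtopology T (T closure_of S)) (lift I S)"
    by (rule continuous_map_eq) 
  then show "continuous_map (subtopology X (closed_cell I)) T (lift I S)"
    by (simp add: continuous_map_in_subtopology)
qed

lemma height_face:
  assumes I: "I \<in> K" and S: "S \<in> comps I" and J: "J \<subseteq> I" "x \<in> cell h J"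
  shows "height (face J S) x = zcoord (lift I S x)"
proof -
  have x: "x \<in> closed_cell I"
    using J face_cell_subset[OF I] by blast
  have "(THE q. q \<in> face J S \<and> base q = x) = lift I S x"
  proof (rule the_equality)
    show "lift I S x \<in> face J S \<and> base (lift I S x) = x"
      using lift_closure[OF I S x] base_lift[OF I S x] J(2) by (simp add: face_def)
    show "q = lift I S x" if "q \<in> face J S \<and> base q = x" for q
      using that lift_base[OF I S, of q] by (auto simp: face_def)
  qed
  then show ?thesis
    by (simp add: height_def)
qed

lemma height_eq: "I \<in> K \<Longrightarrow> S \<in> comps I \<Longrightarrow> x \<in> cell h I \<Longrightarrow> height S x = zcoord (lift I S x)"
  using height_face[of I S I x] face_self[of I S] by simp

lemma lift_in: "I \<in> K \<Longrightarrow> S \<in> comps I \<Longrightarrow> x \<in> cell h I \<Longrightarrow> lift I S x \<in> S"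
proof -
  assume I: "I \<in> K" and S: "S \<in> comps I" and x: "x \<in> cell h I"
  have xI: "x \<in> closed_cell I"
    using x cell_subset_closed_cell by blast
  have "lift I S x \<in> face I S"
    using lift_closure[OF I S xI] base_lift[OF I S xI] x by (simp add: face_def)
  then show ?thesis
    using face_self[OF I S] by simp
qed

lemma continuous_zcoord_lift:
  "I \<in> K \<Longrightarrow> S \<in> comps I \<Longrightarrow> continuous_map (subtopology X (closed_cell I)) euclideanreal (\<lambda>x. zcoord (lift I S x))"
  using continuous_map_compose[OF continuous_lift continuous_zcoord] by (simp add: comp_def)

lemma cell_dense:
  assumes "I \<in> K" "x \<in> closed_cell I"
  shows "x \<in> subtopology X (closed_cell I) closure_of cell h I"
  using assms closure_cell[OF assms(1)] cell_subset_closed_cell[of I]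
  by (simp add: closure_of_subtopology Int_absorb1)

text \<open>The height difference is continuous on the closed cell and the open cell is dense in it,
  so a weak inequality persists on the boundary.\<close>

lemma height_face_le:
  assumes I: "I \<in> K" and S: "S \<in> comps I" "S' \<in> comps I" and J: "J \<subseteq> I"
    and le: "\<forall>x\<in>cell h I. height S x \<le> height S' x" and x: "x \<in> cell h J"
  shows "height (face J S) x \<le> height (face J S') x"
proof -
  let ?Y = "subtopology X (closed_cell I)"
  define f where "f x = zcoord (lift I S' x) - zcoord (lift I S x)" for x
  have "continuous_map ?Y euclideanreal f"
    unfolding f_def by (intro continuous_map_diff continuous_zcoord_lift I S)
  then have "closedin ?Y {x \<in> topspace ?Y. f x \<in> {0..}}"
    by (rule closedin_continuous_map_preimage) simp
  moreover have xI: "x \<in> closed_cell I"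
    using x face_cell_subset[OF I J] by blast
  moreover have "f x \<in> {0..}" if "x \<in> cell h I" for x
    using bspec[OF le that] height_eq[OF I S(1) that] height_eq[OF I S(2) that] by (simp add: f_def)
  ultimately have "f x \<in> {0..}"
    using forall_in_closure_of[OF cell_dense[OF I xI], of "\<lambda>x. f x \<in> {0..}"] by blast
  then show ?thesis
    using height_face[OF I S(1) J x] height_face[OF I S(2) J x] by (simp add: f_def)
qed

lemma P2:
  assumes "I \<in> K" "S \<in> shs I" "S' \<in> shs I"
  shows "(\<forall>x\<in>cell h I. height S x > height S' x) \<or> (\<forall>x\<in>cell h I. height S x < height S' x) \<or>
    (\<forall>x\<in>cell h I. height S x = height S' x)"
  using compatible assms unfolding compatible_def compatible_P2_def by simp

text \<open>By (P2) the only alternative is a weak reverse inequality on all of \<open>e_I\<close>,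
  and that would pass to the faces above \<open>e_J\<close>.\<close>

lemma height_extends:
  assumes I: "I \<in> K" and S: "S \<in> shs I" "S' \<in> shs I" and J: "J \<subseteq> I" "J \<noteq> {}"
    and gt: "\<forall>x\<in>cell h J. height (face J S) x > height (face J S') x"
  shows "\<forall>x\<in>cell h I. height S x > height S' x"
proof (rule ccontr)
  assume "\<not> ?thesis"
  then have le: "\<forall>x\<in>cell h I. height S x \<le> height S' x"
    using P2[OF I S] by force
  obtain x where x: "x \<in> cell h J"
    using cell_nonempty[OF face_in_K[OF I J]] by blast
  then show False
    using height_face_le[OF I sheets_comps[OF S(1)] sheets_comps[OF S(2)] J(1) le x] gt by force
qed

section \<open>The Maslov potential along sheets and at cusps\<close>

lemma mu_constant:
  assumes "connectedin T Z" "Z \<inter> C = {}" "q \<in> Z" "q' \<in> Z"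
  shows "\<mu> q = \<mu> q'"
proof -
  have "connectedin (subtopology T (topspace T - C)) Z"
    using assms(1,2) connectedin_subset_topspace[OF assms(1)] by (auto simp: connectedin_subtopology)
  moreover have "continuous_map (subtopology T (topspace T - C)) (discrete_topology UNIV) \<mu>"
    using maslov by (simp add: maslov_potential_def)
  ultimately have "connectedin (discrete_topology UNIV) (\<mu> ` Z)"
    using connectedin_continuous_map_image by blast
  then obtain a where "\<mu> ` Z \<subseteq> {a}"
    by (auto simp: connectedin_discrete_topology)
  then show ?thesis
    using assms(3,4) by blast
qed

lemma sheet_potential: "S \<in> shs I \<Longrightarrow> q \<in> S \<Longrightarrow> sheet_potential \<mu> S = \<mu> q"
proof -
  assume S: "S \<in> shs I" and q: "q \<in> S"
  have const: "\<mu> q' = \<mu> q" if "q' \<in> S" for q'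
    using mu_constant[OF comps_connected[OF sheets_comps[OF S]] _ that q] S by (simp add: sheets_def)
  have "\<mu> ` S \<subseteq> {\<mu> q}"
    using const by blast
  then have "\<mu> ` S = {\<mu> q}"
    using q by blast
  then show ?thesis
    by (simp add: sheet_potential_def)
qed

text \<open>The union of \<open>S\<close> and its face lies between \<open>S\<close> and its
  closure, hence is connected; it avoids \<open>C\<close>, so \<open>\<mu>\<close> is constant on
  it.\<close>

lemma sheet_potential_face:
  assumes I: "I \<in> K" and S: "S \<in> shs I" and J: "J \<subseteq> I" "J \<noteq> {}" and face: "face J S \<in> shs J"
  shows "sheet_potential \<mu> (face J S) = sheet_potential \<mu> S"
proof -
  obtain q r where qr: "q \<in> S" "r \<in> face J S"
    using comps_nonempty[OF sheets_comps[OF S]] comps_nonempty[OF sheets_comps[OF face]] by blast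
  have "connectedin T (S \<union> face J S)"
    using comps_subset_closure[OF sheets_comps[OF S]]
    by (intro connectedin_intermediate_closure_of[OF comps_connected[OF sheets_comps[OF S]]])
      (auto simp: face_def)
  moreover have "(S \<union> face J S) \<inter> C = {}"
    using S face by (auto simp: sheets_def)
  ultimately have "\<mu> q = \<mu> r"
    using mu_constant[of "S \<union> face J S" q r] qr by blast
  then show ?thesis
    using sheet_potential[OF S qr(1)] sheet_potential[OF face qr(2)] by simp
qed

text \<open>Both lifts converge to the same cusp point, and the front projection is injective near it.\<close>

lemma cusp_pair_separated:
  assumes I: "I \<in> K" and S: "S \<in> shs I" "S' \<in> shs I" "S \<noteq> S'" and J: "J \<subseteq> I" "J \<noteq> {}"
    and face: "face J S = face J S'" "face J S \<notin> shs J"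
  shows "\<exists>x\<in>cell h I. height S x \<noteq> height S' x \<and>
    (height S x > height S' x \<longrightarrow> sheet_potential \<mu> S = sheet_potential \<mu> S' + 1)"
proof -
  note comps = sheets_comps[OF S(1)] sheets_comps[OF S(2)]
  have comp: "face J S \<in> comps J"
    using face_component[OF I comps(1) J] .
  then have "face J S \<subseteq> C"
    using cusp_components_iff[OF face_in_K[OF I J] comp] face(2) by (simp add: cusp_components_def)
  then obtain q where q: "q \<in> face J S" "q \<in> C"
    using comps_nonempty[OF comp] by blast
  have "standard_cusp X A L C q"
    using mild q(2) by (simp add: mild_front_def)
  then obtain W :: "'e set" and g where W: "local_param (jet_topology A) (jet_atlas A) L W g" "q \<in> g ` W"
    and front_inj: "inj_on (front \<circ> g) W"
    using standard_cusp_front_inj[of X A L C q] by blast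
  have gW: "openin T (g ` W)"
    using W(1) by (simp add: local_param_def legendrian_topology_def)
  obtain U where U: "openin T U" "q \<in> U"
    "\<forall>r\<in>U - C. \<forall>r'\<in>U - C. base r = base r' \<and> zcoord r > zcoord r' \<longrightarrow> \<mu> r = \<mu> r' + 1"
    using maslov q(2) unfolding maslov_potential_def by blast
  let ?Y = "subtopology X (closed_cell I)"
  define G where "G = U \<inter> g ` W"
  have G: "openin T G" "q \<in> G"
    using U gW W(2) by (auto simp: G_def)
  have q_cl: "q \<in> T closure_of S" "q \<in> T closure_of S'" and "base q \<in> cell h J"
    using q(1) face(1) by (auto simp: face_def)
  then have xq: "base q \<in> closed_cell I"
    using face_cell_subset[OF I J(1)] by blast
  \<comment> \<open>Both lifts take the value \<open>q\<close> at \<open>base q\<close>, so by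
    continuity both stay in \<open>G\<close> nearby, and density supplies such a point in the open
    cell.\<close>
  define O1 where "O1 = {x \<in> topspace ?Y. lift I S x \<in> G} \<inter> {x \<in> topspace ?Y. lift I S' x \<in> G}"
  have "openin ?Y O1"
    unfolding O1_def
    by (intro openin_Int openin_continuous_map_preimage[OF continuous_lift[OF I comps(1)]]
        openin_continuous_map_preimage[OF continuous_lift[OF I comps(2)]] G)
  moreover have "base q \<in> O1"
    using xq closed_cell_subset[OF I] G(2) lift_base[OF I comps(1) q_cl(1)] lift_base[OF I comps(2) q_cl(2)]
    by (auto simp: O1_def)
  moreover have "\<forall>N. base q \<in> N \<and> openin ?Y N \<longrightarrow> (\<exists>y. y \<in> cell h I \<and> y \<in> N)"
    using cell_dense[OF I xq] unfolding in_closure_of by (rule conjunct2)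
  ultimately obtain x where x: "x \<in> cell h I" "x \<in> O1"
    by blast
  define r r' where "r = lift I S x" and "r' = lift I S' x"
  have r: "r \<in> S" "r' \<in> S'" "r \<in> G" "r' \<in> G"
    using lift_in[OF I comps(1) x(1)] lift_in[OF I comps(2) x(1)] x(2) by (auto simp: r_def r'_def O1_def)
  have notC: "r \<notin> C" "r' \<notin> C"
    using S r by (auto simp: sheets_def)
  have base: "base r = base r'"
    using base_lift[OF I comps(1)] base_lift[OF I comps(2)] x(1) cell_subset_closed_cell[of I]
    by (auto simp: r_def r'_def)
  have "r \<noteq> r'"
    using comps_overlap[OF comps] r(1,2) S(3) by blast
  have "zcoord r \<noteq> zcoord r'"
  proof
    assume "zcoord r = zcoord r'"
    then have "front r = front r'"
      using base by (simp add: front_def)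
    moreover obtain t t' where "t \<in> W" "t' \<in> W" "r = g t" "r' = g t'"
      using r by (auto simp: G_def)
    ultimately show False
      using inj_onD[OF front_inj, of t t'] \<open>r \<noteq> r'\<close> by auto
  qed
  moreover have "\<mu> r = \<mu> r' + 1" if "zcoord r > zcoord r'"
    using U(3) r notC base that by (auto simp: G_def)
  ultimately show ?thesis
    using height_eq[OF I comps(1) x(1)] height_eq[OF I comps(2) x(1)]
      sheet_potential[OF S(1) r(1)] sheet_potential[OF S(2) r(2)] x(1)
    by (intro bexI[of _ x]) (auto simp: r_def r'_def)
qed

end

section \<open>The cellular differential\<close>

lemma set_omit_nth: "distinct v \<Longrightarrow> a < length v \<Longrightarrow> set (omit_nth a v) = set v - {v ! a}"
proof (induction v arbitrary: a)
  case (Cons x v)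
  show ?case
  proof (cases a)
    case (Suc b)
    then have "b < length v"
      using Cons.prems(2) by simp
    then have "x \<noteq> v ! b"
      using Cons.prems(1) nth_mem[of b v] by auto
    then show ?thesis
      using Suc Cons.IH[OF _ \<open>b < length v\<close>] Cons.prems(1) by auto
  qed (use Cons.prems(1) in auto)
qed simp

context decomposed_legendrian
begin

section \<open>Combinatorial data of the ordered sheets\<close>

lemma ord_sheets: "I \<in> K \<Longrightarrow> set (ord I) = shs I"
  and ord_distinct: "I \<in> K \<Longrightarrow> distinct (ord I)"
  and ord_sorted: "I \<in> K \<Longrightarrow> sorted_wrt (\<lambda>S S'. \<forall>x\<in>cell h I. height S x \<ge> height S' x) (ord I)"
  using ordering unfolding sheet_ordering_def by simp_all

lemma ord_nth: "I \<in> K \<Longrightarrow> k < length (ord I) \<Longrightarrow> ord I ! k \<in> shs I"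
  using ord_sheets nth_mem by blast

lemma ord_nth_eq: "I \<in> K \<Longrightarrow> k < length (ord I) \<Longrightarrow> l < length (ord I) \<Longrightarrow> ord I ! k = ord I ! l \<longleftrightarrow> k = l"
  using nth_eq_iff_index_eq[OF ord_distinct] .

lemma ord_index: "I \<in> K \<Longrightarrow> S \<in> shs I \<Longrightarrow> \<exists>k<length (ord I). ord I ! k = S"
  using ord_sheets[of I] by (simp add: in_set_conv_nth[symmetric])

definition gen :: "nat set \<Rightarrow> nat \<Rightarrow> nat \<Rightarrow> bool" where
  "gen I i j \<longleftrightarrow> (I, i, j) \<in> generators K h ord"

definition sub :: "nat set \<Rightarrow> nat \<Rightarrow> nat set \<Rightarrow> nat \<Rightarrow> bool" where
  "sub J i I k \<longleftrightarrow> I \<in> K \<and> J \<subseteq> I \<and> J \<noteq> {} \<and> i < length (ord J) \<and> k < length (ord I) \<and>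
     face J (ord I ! k) = ord J ! i"

definition cusp :: "nat set \<Rightarrow> nat set \<Rightarrow> nat \<Rightarrow> nat \<Rightarrow> bool" where
  "cusp J I k l \<longleftrightarrow> I \<in> K \<and> J \<subseteq> I \<and> J \<noteq> {} \<and> k < length (ord I) \<and> l < length (ord I) \<and> k \<noteq> l \<and>
     face J (ord I ! k) = face J (ord I ! l) \<and> face J (ord I ! k) \<notin> shs J"

definition pot :: "nat set \<Rightarrow> nat \<Rightarrow> int" where
  "pot I i = sheet_potential \<mu> (ord I ! i)"

lemma gen_iff: "gen I i j \<longleftrightarrow> I \<in> K \<and> i < length (ord I) \<and> j < length (ord I) \<and>
    (\<forall>x\<in>cell h I. height (ord I ! i) x > height (ord I ! j) x)"
  by (simp add: gen_def generators_def)

lemma ord_height_le: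
  "I \<in> K \<Longrightarrow> i < j \<Longrightarrow> j < length (ord I) \<Longrightarrow> x \<in> cell h I \<Longrightarrow> height (ord I ! j) x \<le> height (ord I ! i) x"
  using sorted_wrt_nth_less[OF ord_sorted] by blast

lemma gen_less: "gen I i j \<Longrightarrow> i < j"
proof (rule ccontr)
  assume gen: "gen I i j" and "\<not> i < j"
  then have I: "I \<in> K" and ij: "i < length (ord I)"
    by (simp_all add: gen_iff)
  obtain x where x: "x \<in> cell h I"
    using cell_nonempty[OF I] by blast
  have "height (ord I ! i) x \<le> height (ord I ! j) x"
    using ord_height_le[OF I _ ij x, of j] \<open>\<not> i < j\<close> by (cases "i = j") auto
  then show False
    using gen x by (force simp: gen_iff)
qed

text \<open>The heights differ at one point; the ordering makes the difference positive there, and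
  (P2) spreads the strict inequality over the whole cell.\<close>

lemma cusp_separated:
  assumes "cusp J I k l" "k < l"
  shows "gen I k l \<and> pot I k = pot I l + 1"
proof -
  have I: "I \<in> K" and J: "J \<subseteq> I" "J \<noteq> {}" and kl: "k < length (ord I)" "l < length (ord I)"
    and face: "face J (ord I ! k) = face J (ord I ! l)" "face J (ord I ! k) \<notin> shs J"
    using assms(1) by (auto simp: cusp_def)
  note sh = ord_nth[OF I kl(1)] ord_nth[OF I kl(2)]
  have "ord I ! k \<noteq> ord I ! l"
    using ord_nth_eq[OF I kl] assms(2) by simp
  then obtain x where x: "x \<in> cell h I" "height (ord I ! k) x \<noteq> height (ord I ! l) x"
    "height (ord I ! k) x > height (ord I ! l) x \<longrightarrow>
       sheet_potential \<mu> (ord I ! k) = sheet_potential \<mu> (ord I ! l) + 1"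
    using cusp_pair_separated[OF I sh _ J face] by blast
  then have gt: "height (ord I ! k) x > height (ord I ! l) x"
    using ord_height_le[OF I assms(2) kl(2) x(1)] by simp
  then have "\<forall>x\<in>cell h I. height (ord I ! k) x > height (ord I ! l) x"
    using P2[OF I sh] x(1) by force
  then show ?thesis
    using I kl gt x(3) by (simp add: gen_iff pot_def)
qed

text \<open>Equality of faces is inherited by \<open>face_face\<close>; that the smaller face is
  still a cusp is the contrapositive of \<open>sheet_face_sheet\<close>.\<close>

lemma cusp_to_face: "cusp J I k l \<Longrightarrow> H \<subseteq> J \<Longrightarrow> H \<noteq> {} \<Longrightarrow> cusp H I k l"
proof -
  assume cusp: "cusp J I k l" and H: "H \<subseteq> J" "H \<noteq> {}"
  then have I: "I \<in> K" and J: "J \<subseteq> I" and kl: "k < length (ord I)" "l < length (ord I)"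
    and face: "face J (ord I ! k) = face J (ord I ! l)" "face J (ord I ! k) \<notin> shs J"
    by (auto simp: cusp_def)
  note sh = ord_nth[OF I kl(1)] ord_nth[OF I kl(2)]
  have "face H (ord I ! k) = face H (ord I ! l)"
    using face_face[OF I sheets_comps[OF sh(1)] J H] face_face[OF I sheets_comps[OF sh(2)] J H] face(1)
    by simp
  moreover have "face H (ord I ! k) \<notin> shs H"
    using sheet_face_sheet[OF I sh(1) J H] face(2) by blast
  ultimately show ?thesis
    using cusp H J by (auto simp: cusp_def)
qed

lemma cusp_unique_partner: "cusp J I k l \<Longrightarrow> cusp J I k l' \<Longrightarrow> l = l'"
proof -
  assume cusp: "cusp J I k l" "cusp J I k l'"
  then have I: "I \<in> K" and J: "J \<subseteq> I" "J \<noteq> {}"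
    and kl: "k < length (ord I)" "l < length (ord I)" "l' < length (ord I)"
    and face: "face J (ord I ! k) \<notin> shs J"
    by (auto simp: cusp_def)
  have "ord I ! l \<noteq> ord I ! k" "ord I ! l' \<noteq> ord I ! k"
    using cusp ord_nth_eq[OF I] kl by (auto simp: cusp_def)
  then have "ord I ! l \<in> shs I \<and> ord I ! l \<noteq> ord I ! k \<and> face J (ord I ! l) = face J (ord I ! k)"
    "ord I ! l' \<in> shs I \<and> ord I ! l' \<noteq> ord I ! k \<and> face J (ord I ! l') = face J (ord I ! k)"
    using cusp ord_nth[OF I kl(2)] ord_nth[OF I kl(3)] by (simp_all add: cusp_def)
  then have "ord I ! l = ord I ! l'"
    using cusp_partner[OF I J ord_nth[OF I kl(1)] face] by blast
  then show ?thesis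
    using ord_nth_eq[OF I kl(2,3)] by simp
qed

lemma sub_faces:
  assumes "sub J i I k" "H \<subseteq> J" "H \<noteq> {}"
  shows "face H (ord J ! i) = face H (ord I ! k)"
  using assms face_face[of I "ord I ! k" J H] sheets_comps[OF ord_nth[of I k]] by (auto simp: sub_def)

lemma sub_upper_unique: "sub J i I k \<Longrightarrow> sub J i I k' \<Longrightarrow> k = k'"
proof -
  assume sub: "sub J i I k" "sub J i I k'"
  then have I: "I \<in> K" and J: "J \<subseteq> I" "J \<noteq> {}" and k: "k < length (ord I)" "k' < length (ord I)"
    and i: "i < length (ord J)"
    by (auto simp: sub_def)
  have "\<exists>!S. S \<in> shs I \<and> face J S = ord J ! i"
    using sheet_extends[OF I J ord_nth[OF face_in_K[OF I J] i]] .
  then have "ord I ! k = ord I ! k'"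
    using sub ord_nth[OF I k(1)] ord_nth[OF I k(2)] by (auto simp: sub_def)
  then show ?thesis
    using ord_nth_eq[OF I k] by simp
qed

lemma sheet_combinatorics: "sheet_combinatorics K (\<lambda>I. length (ord I)) gen sub cusp pot"
proof
  show "finite I" "I \<noteq> {}" if "I \<in> K" for I
    using finite_simplex simplex_nonempty that by blast+
  show "J \<in> K" if "I \<in> K" "J \<subseteq> I" "J \<noteq> {}" for I J
    using face_in_K that .
  show "I \<in> K \<and> i < j \<and> j < length (ord I)" if "gen I i j" for I i j
    using that gen_less[OF that] by (simp add: gen_iff)
  show "gen I i k" if "gen I i j" "gen I j k" for I i j k
    using that by (force simp: gen_iff)
  show "I \<in> K \<and> J \<subseteq> I \<and> J \<noteq> {} \<and> i < length (ord J) \<and> k < length (ord I)" if "sub J i I k" for J i I k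
    using that by (simp add: sub_def)
  show "\<exists>k. sub J i I k" if I: "I \<in> K" and J: "J \<subseteq> I" "J \<noteq> {}" and i: "i < length (ord J)" for I J i
  proof -
    obtain S where S: "S \<in> shs I" "face J S = ord J ! i"
      using sheet_extends[OF I J ord_nth[OF face_in_K[OF I J] i]] by blast
    obtain k where "k < length (ord I)" "ord I ! k = S"
      using ord_index[OF I S(1)] by blast
    then show ?thesis
      using S I J i by (auto simp: sub_def)
  qed
  show "k = k'" if "sub J i I k" "sub J i I k'" for J i I k k'
    using sub_upper_unique that .
  show "i = i'" if sub: "sub J i I k" "sub J i' I k" for J i I k i'
  proof -
    have "J \<in> K"
      using sub face_in_K by (auto simp: sub_def)
    then show ?thesis
      using sub ord_nth_eq[of J i i'] by (auto simp: sub_def)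
  qed
  show "sub H a I k" if sub: "sub H a J b" "sub J b I k" for H a J b I k
    using sub_faces[OF sub(2), of H] sub by (auto simp: sub_def)
  show "cusp J I l k" if "cusp J I k l" for J I k l
    using that by (auto simp: cusp_def)
  show "l = l'" if "cusp J I k l" "cusp J I k l'" for J I k l l'
    using cusp_unique_partner that .
  show "\<not> sub J i I k" if cusp: "cusp J I k l" for J I k l i
  proof
    assume sub: "sub J i I k"
    then have "J \<in> K"
      using face_in_K by (auto simp: sub_def)
    then show False
      using cusp sub ord_nth[of J i] by (auto simp: sub_def cusp_def)
  qed
  show "cusp H I k l" if "cusp J I k l" "H \<subseteq> J" "H \<noteq> {}" for J I k l H
    using cusp_to_face that .
  show "cusp J I k l" if cusp: "cusp H I k l" and H: "H \<subseteq> J" and J: "J \<subseteq> I" and no: "\<And>i. \<not> sub J i I k" for H I k l J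
  proof -
    have I: "I \<in> K" and k: "k < length (ord I)" and Hne: "H \<noteq> {}"
      using cusp by (auto simp: cusp_def)
    have Jne: "J \<noteq> {}"
      using H Hne by auto
    have not_sheet: "face J (ord I ! k) \<notin> shs J"
    proof
      assume "face J (ord I ! k) \<in> shs J"
      then obtain i where "i < length (ord J)" "ord J ! i = face J (ord I ! k)"
        using ord_index[OF face_in_K[OF I J Jne]] by blast
      then show False
        using no[of i] I J Jne k by (simp add: sub_def)
    qed
    \<comment> \<open>(P3) gives \<open>k\<close> some partner above \<open>e_J\<close>. It is also
      a partner above the smaller cell \<open>e_H\<close>, where partners are unique, so it must be
      \<open>l\<close>.\<close>
    obtain S' where S': "S' \<in> shs I" "S' \<noteq> ord I ! k" "face J S' = face J (ord I ! k)"
      using cusp_partner[OF I J Jne ord_nth[OF I k] not_sheet] by blast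
    obtain l' where l': "l' < length (ord I)" "ord I ! l' = S'"
      using ord_index[OF I S'(1)] by blast
    then have "cusp J I k l'"
      using I J Jne k S' not_sheet by (auto simp: cusp_def)
    moreover have "l = l'"
      using cusp_unique_partner[OF cusp cusp_to_face[OF \<open>cusp J I k l'\<close> H Hne]] .
    ultimately show ?thesis by simp
  qed
  show "cusp H J i j \<longleftrightarrow> cusp H I k l" if sub: "sub J i I k" "sub J j I l" and H: "H \<subseteq> J" for J i I k j l H
  proof (cases "H = {}")
    case False
    have "J \<in> K" "i = j \<longleftrightarrow> k = l"
    proof -
      show JK: "J \<in> K"
        using sub face_in_K by (auto simp: sub_def)
      show "i = j \<longleftrightarrow> k = l"
        using sub sub_upper_unique[of J i I k l] ord_nth_eq[OF JK, of i j] by (auto simp: sub_def)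
    qed
    then show ?thesis
      using sub_faces[OF sub(1) H False] sub_faces[OF sub(2) H False] sub H False
      by (auto simp: cusp_def sub_def)
  qed (simp add: cusp_def)
  show "gen I k l" if gen: "gen J i j" and sub: "sub J i I k" "sub J j I l" for J i j I k l
  proof -
    have I: "I \<in> K" and J: "J \<subseteq> I" "J \<noteq> {}" and kl: "k < length (ord I)" "l < length (ord I)"
      using sub by (auto simp: sub_def)
    have "\<forall>x\<in>cell h J. height (face J (ord I ! k)) x > height (face J (ord I ! l)) x"
      using gen sub by (simp add: gen_iff sub_def)
    then show ?thesis
      using height_extends[OF I ord_nth[OF I kl(1)] ord_nth[OF I kl(2)] J] I kl by (simp add: gen_iff)
  qed
  show "gen I k l" "pot I k = pot I l + 1" if "cusp J I k l" "k < l" for J I k l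
    using cusp_separated[OF that] by simp_all
  show "pot J i = pot I k" if sub: "sub J i I k" for J i I k
  proof -
    have I: "I \<in> K" and J: "J \<subseteq> I" "J \<noteq> {}" and k: "k < length (ord I)" and i: "i < length (ord J)"
      and face: "face J (ord I ! k) = ord J ! i"
      using sub by (auto simp: sub_def)
    show ?thesis
      using sheet_potential_face[OF I ord_nth[OF I k] J] ord_nth[OF face_in_K[OF I J] i] face
      by (simp add: pot_def)
  qed
qed

end

sublocale decomposed_legendrian \<subseteq> comb: sheet_combinatorics K "\<lambda>I. length (ord I)" gen sub cusp pot
  by (rule sheet_combinatorics)

context decomposed_legendrian
begin

section \<open>Identification of the matrices with the abstract entries\<close>

lemma comb_gens: "comb.gens = generators K h ord"
  by (auto simp: comb.gens_def gen_def)

lemma comb_deg: "comb.deg = generator_degree \<mu> ord"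
  by (simp add: comb.deg_def generator_degree_def pot_def)

lemma cell_matrix_entry:
  "i < length (ord I) \<Longrightarrow> j < length (ord I) \<Longrightarrow> cell_matrix K h ord I $$ (i, j) = comb.cell_entry I i j"
  by (simp add: cell_matrix_def comb.cell_entry_def gen_def)

lemma face_matrix_entry:
  assumes I: "I \<in> K" and J: "J \<subseteq> I" and kl: "k < length (ord I)" "l < length (ord I)"
  shows "face_matrix T C K h ord I J $$ (k, l) = comb.face_entry I J k l"
proof -
  have sub: "ord J ! i \<subseteq> T closure_of (ord I ! k) \<longleftrightarrow> sub J i I k"
    if "J \<in> K" "i < length (ord J)" "k < length (ord I)" for i k
  proof -
    note J' = that(1,2) simplex_nonempty[OF that(1)]
    then show ?thesis
      using subset_closure_iff[OF I sheets_comps[OF ord_nth[OF I that(3)]] J J'(3) sheets_comps[OF ord_nth[OF J'(1,2)]]]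
        I J J' that(3) by (auto simp: sub_def)
  qed
  have "(J, i, j) \<in> generators K h ord \<and>
      ord J ! i \<subseteq> T closure_of (ord I ! k) \<and> ord J ! j \<subseteq> T closure_of (ord I ! l) \<longleftrightarrow>
      gen J i j \<and> sub J i I k \<and> sub J j I l" for i j
    unfolding gen_def[symmetric]
    using sub[of i k] sub[of j l] kl by (auto simp: gen_iff)
  then have 1: "{(i, j). (J, i, j) \<in> generators K h ord \<and>
      ord J ! i \<subseteq> T closure_of (ord I ! k) \<and> ord J ! j \<subseteq> T closure_of (ord I ! l)} =
    {(i, j). gen J i j \<and> sub J i I k \<and> sub J j I l}"
    by simp
  have 2: "card J = 1 \<and> k < l \<and> meet_at_cusp T C h J (ord I ! k) (ord I ! l) \<longleftrightarrow>
      card J = 1 \<and> k < l \<and> cusp J I k l"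
  proof (cases "J = {}")
    case False
    then show ?thesis
      using meet_at_cusp_iff[OF I sheets_comps[OF ord_nth[OF I kl(1)]] sheets_comps[OF ord_nth[OF I kl(2)]] J]
        ord_nth_eq[OF I kl] I J kl by (auto simp: cusp_def)
  qed simp
  show ?thesis
    unfolding face_matrix_def comb.face_entry_def 1[symmetric] 2[symmetric] using kl by simp
qed

lemma face_matrix_dim [simp]: "dim_row (face_matrix T C K h ord I J) = length (ord I)"
  "dim_col (face_matrix T C K h ord I J) = length (ord I)"
  by (simp_all add: face_matrix_def)

lemma boundary_matrix_dim: "boundary_matrix T C \<mu> K h ord I \<in> carrier_mat (length (ord I)) (length (ord I))"
  by (rule carrier_matI) (simp_all only: boundary_matrix_def Let_def index_mult_mat(2,3) index_add_mat(2,3)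
      theta_matrix_def alternating_sum_def dim_row_mat dim_col_mat)

lemma boundary_matrix_entry:
  assumes I: "I \<in> K" and ij: "i < length (ord I)" "j < length (ord I)"
  shows "boundary_matrix T C \<mu> K h ord I $$ (i, j) = comb.boundary_entry I i j"
proof -
  define v where "v = sorted_list_of_set I"
  define m where "m = card I - 1"
  define N where "N = length (ord I)"
  define M where "M = face_matrix T C K h ord I"
  define D where "D = (if m = 0 then 0\<^sub>m N N else - alternating_sum N m (\<lambda>k. M (I - {v ! k})))
            + alternating_sum N m (\<lambda>k. M (set (take (Suc k) v)) * M (set (drop k v)))"
  have v: "set v = I" "distinct v" "length v = Suc m"
    using finite_simplex[OF I] simplex_nonempty[OF I] by (auto simp: v_def m_def card_gt_0_iff)
  have entry: "M J $$ (k, l) = comb.face_entry I J k l" if "J \<subseteq> I" "k < N" "l < N" for J k l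
    using face_matrix_entry[OF I that[unfolded N_def]] by (simp add: M_def)
  have prod: "(M J * M J') $$ (i, j) = (\<Sum>p<N. comb.face_entry I J i p * comb.face_entry I J' p j)"
    if J: "J \<subseteq> I" "J' \<subseteq> I" for J J'
  proof -
    have "(M J * M J') $$ (i, j) = (\<Sum>p<N. M J $$ (i, p) * M J' $$ (p, j))"
      using ij by (simp add: M_def N_def scalar_prod_def atLeast0LessThan)
    then show ?thesis
      using entry J ij by (simp add: N_def)
  qed
  have Ddim: "D \<in> carrier_mat N N"
    by (rule carrier_matI) (simp_all only: D_def index_add_mat(2,3) alternating_sum_def dim_row_mat dim_col_mat)
  have "boundary_matrix T C \<mu> K h ord I $$ (i, j) = (theta_matrix \<mu> ord I * D) $$ (i, j)"
    by (simp add: boundary_matrix_def Let_def D_def v_def m_def N_def M_def)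
  also have "\<dots> = (\<Sum>p<N. theta_matrix \<mu> ord I $$ (i, p) * D $$ (p, j))"
    using ij Ddim by (simp add: theta_matrix_def N_def scalar_prod_def atLeast0LessThan)
  also have "\<dots> = (\<Sum>p<N. if p = i then sign (pot I i) * D $$ (i, j) else 0)"
    using ij by (intro sum.cong) (auto simp: theta_matrix_def N_def pot_def)
  also have "\<dots> = sign (pot I i) * D $$ (i, j)"
    using ij by (simp add: N_def)
  also have "D $$ (i, j) = comb.curvature I v i j"
  proof -
    have first: "(if m = 0 then 0\<^sub>m N N else - alternating_sum N m (\<lambda>k. M (I - {v ! k}))) $$ (i, j)
        = - (\<Sum>a<length v. (- 1) ^ a * comb.face_entry I (set (omit_nth a v)) i j)"
    \<comment> \<open>For a vertex the first sum is absent from the formula; in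
      \<open>curvature\<close> it is the single term of the empty face, which is 0.\<close>
    proof (cases "m = 0")
      case True
      then have "set (omit_nth 0 v) = {}"
        using v(3) by (simp add: omit_nth_def)
      then show ?thesis
        using True ij v(3) by (simp add: N_def)
    next
      case False
      have "(- 1) ^ a * M (I - {v ! a}) $$ (i, j) = (- 1) ^ a * comb.face_entry I (set (omit_nth a v)) i j"
        if "a < length v" for a
        using entry[of "I - {v ! a}" i j] ij set_omit_nth[OF v(2) that] v(1) by (simp add: N_def)
      then show ?thesis
        using False ij v(3) by (simp add: alternating_sum_def N_def lessThan_Suc_atMost)
    qed
    have second: "alternating_sum N m (\<lambda>k. M (set (take (Suc k) v)) * M (set (drop k v))) $$ (i, j) =
        (\<Sum>a<length v. (- 1) ^ a *
          (\<Sum>p<N. comb.face_entry I (set (take (Suc a) v)) i p * comb.face_entry I (set (drop a v)) p j))"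
    proof -
      have "set (take (Suc a) v) \<subseteq> I" "set (drop a v) \<subseteq> I" for a
        using set_take_subset[of "Suc a" v] set_drop_subset[of a v] v(1) by simp_all
      note prod' = prod[OF this]
      show ?thesis
        using ij v(3) by (simp add: alternating_sum_def N_def[symmetric] lessThan_Suc_atMost prod')
    qed
    have "D $$ (i, j) = (if m = 0 then 0\<^sub>m N N else - alternating_sum N m (\<lambda>k. M (I - {v ! k}))) $$ (i, j)
        + alternating_sum N m (\<lambda>k. M (set (take (Suc k) v)) * M (set (drop k v))) $$ (i, j)"
      using ij by (simp add: D_def alternating_sum_def N_def)
    moreover have "comb.curvature I v i j = - (\<Sum>a<length v. (- 1) ^ a * comb.face_entry I (set (omit_nth a v)) i j)
        + (\<Sum>a<length v. (- 1) ^ a *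
          (\<Sum>p<N. comb.face_entry I (set (take (Suc a) v)) i p * comb.face_entry I (set (drop a v)) p j))"
      by (simp add: comb.curvature_def N_def)
    ultimately show ?thesis
      by (simp only: first second)
  qed
  finally show ?thesis
    by (simp add: comb.boundary_entry_def v_def)
qed

lemma cellular_differential_iff:
  "cellular_differential T C \<mu> K h ord d \<longleftrightarrow> graded_derivation comb.gens comb.deg d \<and>
     (\<forall>I\<in>K. \<forall>i<length (ord I). \<forall>j<length (ord I). d (comb.cell_entry I i j) = comb.boundary_entry I i j)"
proof -
  have "map_mat d (cell_matrix K h ord I) = boundary_matrix T C \<mu> K h ord I \<longleftrightarrow>
      (\<forall>i<length (ord I). \<forall>j<length (ord I). d (comb.cell_entry I i j) = comb.boundary_entry I i j)"
    if I: "I \<in> K" for I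
  proof -
    have dim: "dim_row (cell_matrix K h ord I) = length (ord I)" "dim_col (cell_matrix K h ord I) = length (ord I)"
      by (simp_all add: cell_matrix_def)
    have "map_mat d (cell_matrix K h ord I) = boundary_matrix T C \<mu> K h ord I \<longleftrightarrow>
      (\<forall>i<length (ord I). \<forall>j<length (ord I).
         map_mat d (cell_matrix K h ord I) $$ (i, j) = boundary_matrix T C \<mu> K h ord I $$ (i, j))"
      using boundary_matrix_dim[of I] dim unfolding mat_eq_iff by auto
    then show ?thesis
      using dim cell_matrix_entry[of _ I] boundary_matrix_entry[OF I] by simp
  qed
  then show ?thesis
    unfolding cellular_differential_def comb_gens comb_deg by simp
qed

end

theorem theorem2p9:
  fixes X :: "'a topology"
    and A :: "('a, 'e::euclidean_space) chart set"
    and L C :: "('a, 'e) jet set"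
    and \<mu> :: "('a, 'e) jet \<Rightarrow> int"
    and K :: "nat set set"
    and h :: "(nat \<Rightarrow> real) \<Rightarrow> 'a"
    and ord :: "nat set \<Rightarrow> ('a, 'e) jet set list"
  assumes "smooth_manifold X A"
    and "closed_legendrian A L"
    and "mild_front X A L C"
    and "maslov_potential (legendrian_topology A L) C \<mu>"
    and "simplicial_decomposition X K h"
    and "compatible X (legendrian_topology A L) C K h"
    and "sheet_ordering (legendrian_topology A L) C K h ord"
  shows "(\<exists>!d. cellular_differential (legendrian_topology A L) C \<mu> K h ord d) \<and>
         (\<forall>d. cellular_differential (legendrian_topology A L) C \<mu> K h ord d \<longrightarrow>
            (\<forall>x\<in>free_algebra (generators K h ord). d (d x) = 0))"
proof -
  interpret decomposed_legendrian X A L C \<mu> K h ord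
    using assms by unfold_locales
  have "d (d x) = 0"
    if "cellular_differential T C \<mu> K h ord d" "x \<in> free_algebra (generators K h ord)" for d x
  proof -
    interpret d: sheet_differential K "\<lambda>I. length (ord I)" gen sub cusp pot d
      using that(1) unfolding cellular_differential_iff by unfold_locales simp_all
    show ?thesis
      using d.d_d that(2) by (simp add: comb_gens)
  qed
  then show ?thesis
    using comb.ex1_sheet_differential unfolding cellular_differential_iff by blast
qed

end
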